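(* Let $P_\lambda$, $\lambda\in\Delta$, be a holomorphic family of topologically conjugate complex polynomials of degree $d\ge 2$ with connected Julia set. Let $\psi_\lambda(z)$ be the McMullen--Sullivan holomorphic motion, defined on $\hat{\mathbb C}$ over $\Delta$, and let $\phi_\lambda$ be the B\"ottcher coordinate of $P_\lambda$. Then $$\phi_0(z)=\phi_\lambda(\psi_\lambda(z))$$ for all $\lambda\in\Delta$ and all $z\in\mathbb C\setminus K_0$. In particular, $\psi_\lambda$ is holomorphic on $\mathbb C\setminus K_0$ for each fixed $\lambda\in\Delta$.
   Context: $\Delta$ is a disk (or polydisk) of parameters with basepoint $0$; $\mathbb D$ denotes the closed unit disk in $\mathbb C$. The coefficients of $P_\lambda$ depend holomorphically on $\lambda$. $K_\lambda$ is the filled Julia set of $P_\lambda$ (points with bounded forward orbit) and $J_\lambda=\partial K_\lambda$ is its Julia set. B\"ottcher coordinate: for a degree-$d$ monic polynomial $P$ with connected filled Julia set $K$, it is the holomorphic bijection $\phi:\mathbb C\setminus K\to\mathbb C\setminus\mathbb D$ with $\phi(P(z))=\phi(z)^d$, given near infinity by $\phi(z)=\lim_{n\to\infty}(P^n(z))^{1/d^n}$, where the roots are chosen to approximate the identity (so $\phi(z)/z\to1$ as $z\to\infty$). $\phi_\lambda$ is the B\"ottcher coordinate of $P_\lambda$. Holomorphic motion: a holomorphic motion of $E\subset\hat{\mathbb C}$ over $\Delta$ (centered at $0$) is a map $\alpha:\Delta\times E\to\hat{\mathbb C}$ with $\alpha(0,z)=z$ for all $z\in E$, $\alpha(\lambda,\cdot)$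 injective for each $\lambda$, and $\alpha(\cdot,z)$ holomorphic for each $z\in E$. Harmonic Beltrami coefficient: a Beltrami coefficient $\mu$ is harmonic on an open set $U\subset\hat{\mathbb C}$ if $\mu(z)=\overline{\nu(z)}/\rho^2(z)$ on $U$, where $\nu$ is holomorphic on $U$ and $\rho^2$ is the area density of the hyperbolic metric on $U$. McMullen--Sullivan holomorphic motion: the holomorphic motion $\psi:\Delta\times\hat{\mathbb C}\to\hat{\mathbb C}$, $\psi_\lambda(z)=\psi(\lambda,z)$, obtained by taking the unique motion respecting the dynamics on the grand orbits of the critical points of the polynomials and extending it canonically to $\hat{\mathbb C}$ by the Bers--Royden theorem (the extension with harmonic Beltrami coefficient on the complement of the closure of the set initially moved). ($\Delta$ is assumed small enough that this motion is defined over $\Delta$.) It satisfies: (1) $\psi_0(z)=z$; (2) each $\psi_\lambda$ is a homeomorphism; (3) $\psi_\lambda(z)$ is holomorphic in $\lambda$ for each $z$; (4) $\psi_\lambda P_0=P_\lambda\psi_\lambda$; (5) each $\psi_\lambda$ is quasiconformal with harmonic Beltrami coefficient on $\mathbb C\setminus K_0$. *)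

theory Defs
  imports "HOL-Complex_Analysis.Complex_Analysis" "HOL-Computational_Algebra.Polynomial"
begin

section \<open>The parameter space\<close>

text \<open>
  A polydisk centred at the base point 0 of C^n. For a one-element index type it is a disk.
\<close>

definition polydisk :: "real ^ 'n \<Rightarrow> (complex ^ 'n) set" where
  "polydisk r = {t. \<forall>i. norm (t $ i) < r $ i}"

text \<open>
  Holomorphy in several variables: Frechet differentiability with a complex-linear derivative.
  The definition is meant for open sets.
\<close>

definition holomorphic_at_param :: "(complex ^ 'n \<Rightarrow> complex) \<Rightarrow> complex ^ 'n \<Rightarrow> bool" where
  "holomorphic_at_param f a \<longleftrightarrow>
     (\<exists>D. (f has_derivative D) (at a) \<and> (\<forall>c v. D (c *s v) = c * D v))"

definition holomorphic_on_param :: "(complex ^ 'n \<Rightarrow> complex) \<Rightarrow> (complex ^ 'n) set \<Rightarrow> bool" where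
  "holomorphic_on_param f D \<longleftrightarrow> (\<forall>a\<in>D. holomorphic_at_param f a)"


section \<open>The Riemann sphere and holomorphic motions\<close>

text \<open>The point at infinity is \<open>None\<close>.\<close>

definition riemann_sphere :: "complex option topology" where
  "riemann_sphere = Alexandroff_compactification euclidean"

text \<open>The chart at infinity; its value at \<open>Some 0\<close> is irrelevant.\<close>

definition inv_chart :: "complex option \<Rightarrow> complex" where
  "inv_chart w = (case w of None \<Rightarrow> 0 | Some z \<Rightarrow> inverse z)"

definition sphere_holomorphic_on :: "(complex ^ 'n \<Rightarrow> complex option) \<Rightarrow> (complex ^ 'n) set \<Rightarrow> bool" where
  "sphere_holomorphic_on f D \<longleftrightarrow>
     continuous_map (top_of_set D) riemann_sphere f \<and>
     (\<forall>a\<in>D. f a \<noteq> None \<longrightarrow> holomorphic_at_param (\<lambda>t. the (f t)) a) \<and>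
     (\<forall>a\<in>D. f a \<noteq> Some 0 \<longrightarrow> holomorphic_at_param (\<lambda>t. inv_chart (f t)) a)"

definition holomorphic_motion ::
  "(complex ^ 'n) set \<Rightarrow> complex option set \<Rightarrow> (complex ^ 'n \<Rightarrow> complex option \<Rightarrow> complex option) \<Rightarrow> bool" where
  "holomorphic_motion D E \<alpha> \<longleftrightarrow>
     (\<forall>z\<in>E. \<alpha> 0 z = z) \<and>
     (\<forall>t\<in>D. inj_on (\<alpha> t) E) \<and>
     (\<forall>z\<in>E. sphere_holomorphic_on (\<lambda>t. \<alpha> t z) D)"


section \<open>Polynomial dynamics\<close>

definition filled_julia :: "complex poly \<Rightarrow> complex set" where
  "filled_julia p = {z. bounded (range (\<lambda>n. (poly p ^^ n) z))}"

definition julia :: "complex poly \<Rightarrow> complex set" where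
  "julia p = frontier (filled_julia p)"

definition topologically_conjugate :: "complex poly \<Rightarrow> complex poly \<Rightarrow> bool" where
  "topologically_conjugate p q \<longleftrightarrow>
     (\<exists>h h'. homeomorphism UNIV UNIV h h' \<and> (\<forall>z. h (poly p z) = poly q (h z)))"

text \<open>
  The Boettcher coordinate of a monic polynomial of degree at least 2 with connected filled Julia
  set. The functions \<open>g n\<close> are the branches of the \<open>d^n\<close>-th roots of the iterates that approximate
  the identity near infinity. Only the values of \<open>\<phi>\<close> outside the filled Julia set matter.
\<close>

definition boettcher_coordinate :: "complex poly \<Rightarrow> (complex \<Rightarrow> complex) \<Rightarrow> bool" where
  "boettcher_coordinate p \<phi> \<longleftrightarrow>
     \<phi> holomorphic_on (- filled_julia p) \<and>
     bij_betw \<phi> (- filled_julia p) (- cball 0 1) \<and>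
     (\<forall>z \<in> - filled_julia p. \<phi> (poly p z) = \<phi> z ^ degree p) \<and>
     (\<exists>R g. filled_julia p \<subseteq> cball 0 R \<and>
        (\<forall>n. g n holomorphic_on (- cball 0 R) \<and>
             (\<forall>z \<in> - cball 0 R. g n z ^ (degree p ^ n) = (poly p ^^ n) z) \<and>
             ((\<lambda>z. g n z / z) \<longlongrightarrow> 1) at_infinity) \<and>
        (\<forall>z \<in> - cball 0 R. (\<lambda>n. g n z) \<longlonglongrightarrow> \<phi> z)) \<and>
     ((\<lambda>z. \<phi> z / z) \<longlongrightarrow> 1) at_infinity"

text \<open>The extension of a nonconstant polynomial to the sphere.\<close>

definition poly_sphere :: "complex poly \<Rightarrow> complex option \<Rightarrow> complex option" where
  "poly_sphere p = map_option (poly p)"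

text \<open>Critical points on the sphere of a polynomial of degree at least 2; infinity is one of them.\<close>

definition critical_points :: "complex poly \<Rightarrow> complex option set" where
  "critical_points p = insert None (Some ` {c. poly (pderiv p) c = 0})"

definition grand_orbit :: "('a \<Rightarrow> 'a) \<Rightarrow> 'a \<Rightarrow> 'a set" where
  "grand_orbit f x = {y. \<exists>m n. (f ^^ m) x = (f ^^ n) y}"

definition critical_grand_orbits :: "complex poly \<Rightarrow> complex option set" where
  "critical_grand_orbits p = (\<Union>c\<in>critical_points p. grand_orbit (poly_sphere p) c)"

definition critical_orbit_motion ::
  "(complex ^ 'n) set \<Rightarrow> (complex ^ 'n \<Rightarrow> complex poly)
     \<Rightarrow> (complex ^ 'n \<Rightarrow> complex option \<Rightarrow> complex option) \<Rightarrow> bool" where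
  "critical_orbit_motion D P \<alpha> \<longleftrightarrow>
     holomorphic_motion D (critical_grand_orbits (P 0)) \<alpha> \<and>
     (\<forall>t\<in>D. \<alpha> t ` critical_points (P 0) = critical_points (P t) \<and>
            \<alpha> t ` critical_grand_orbits (P 0) = critical_grand_orbits (P t) \<and>
            (\<forall>z\<in>critical_grand_orbits (P 0).
               \<alpha> t (poly_sphere (P 0) z) = poly_sphere (P t) (\<alpha> t z)))"


section \<open>Quasiconformal maps and Beltrami coefficients\<close>

text \<open>
  Complex-valued test functions on \<open>U\<close>: continuously differentiable with compact support in \<open>U\<close>;
  \<open>\<eta>'\<close> is the (real) derivative of \<open>\<eta>\<close>.
\<close>

definition test_function ::
  "complex set \<Rightarrow> (complex \<Rightarrow> complex) \<Rightarrow> (complex \<Rightarrow> complex \<Rightarrow> complex) \<Rightarrow> bool" where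
  "test_function U \<eta> \<eta>' \<longleftrightarrow>
     (\<forall>z. (\<eta> has_derivative \<eta>' z) (at z)) \<and>
     (\<forall>v. continuous_on UNIV (\<lambda>z. \<eta>' z v)) \<and>
     (\<exists>C. compact C \<and> C \<subseteq> U \<and> (\<forall>z. z \<notin> C \<longrightarrow> \<eta> z = 0))"

text \<open>The Wirtinger derivatives of a map with real derivative \<open>L\<close>.\<close>

definition wirtinger_z :: "(complex \<Rightarrow> complex) \<Rightarrow> complex" where
  "wirtinger_z L = (L 1 - \<i> * L \<i>) / 2"

definition wirtinger_zbar :: "(complex \<Rightarrow> complex) \<Rightarrow> complex" where
  "wirtinger_zbar L = (L 1 + \<i> * L \<i>) / 2"

definition locally_L2_on :: "complex set \<Rightarrow> (complex \<Rightarrow> complex) \<Rightarrow> bool" where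
  "locally_L2_on U f \<longleftrightarrow>
     set_borel_measurable lebesgue U f \<and>
     (\<forall>C. compact C \<and> C \<subseteq> U \<longrightarrow> set_integrable lebesgue C (\<lambda>z. (norm (f z))\<^sup>2))"

text \<open>\<open>p\<close> and \<open>q\<close> are the distributional derivatives of \<open>f\<close> with respect to z and zbar on \<open>U\<close>.\<close>

definition weak_derivatives_on ::
  "complex set \<Rightarrow> (complex \<Rightarrow> complex) \<Rightarrow> (complex \<Rightarrow> complex) \<Rightarrow> (complex \<Rightarrow> complex) \<Rightarrow> bool" where
  "weak_derivatives_on U f p q \<longleftrightarrow>
     (\<forall>\<eta> \<eta>'. test_function U \<eta> \<eta>' \<longrightarrow>
        (LINT z|lebesgue. f z * wirtinger_z (\<eta>' z)) = - (LINT z|lebesgue. p z * \<eta> z) \<and>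
        (LINT z|lebesgue. f z * wirtinger_zbar (\<eta>' z)) = - (LINT z|lebesgue. q z * \<eta> z))"

text \<open>
  The analytic definition of quasiconformality, for a homeomorphism \<open>f\<close> of the sphere with Beltrami
  coefficient \<open>\<mu>\<close>. The two (possibly equal) points infinity and the preimage of infinity need not be
  considered, because isolated points are removable for quasiconformal homeomorphisms.
\<close>

definition quasiconformal_with :: "(complex option \<Rightarrow> complex option) \<Rightarrow> (complex \<Rightarrow> complex) \<Rightarrow> bool" where
  "quasiconformal_with f \<mu> \<longleftrightarrow>
     homeomorphic_map riemann_sphere riemann_sphere f \<and>
     (let U = {z. f (Some z) \<noteq> None} in
        set_borel_measurable lebesgue U \<mu> \<and>
        (\<exists>k<1. AE z in lebesgue. z \<in> U \<longrightarrow> norm (\<mu> z) \<le> k) \<and>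
        (\<exists>p q. locally_L2_on U p \<and> locally_L2_on U q \<and>
           weak_derivatives_on U (\<lambda>z. the (f (Some z))) p q \<and>
           (AE z in lebesgue. z \<in> U \<longrightarrow> q z = \<mu> z * p z)))"


section \<open>The hyperbolic metric and harmonic Beltrami coefficients\<close>

text \<open>
  The components of a plane open set are hyperbolic iff the set omits two points of the plane.
\<close>

definition hyperbolic_open :: "complex set \<Rightarrow> bool" where
  "hyperbolic_open U \<longleftrightarrow> open U \<and> (\<exists>a b. a \<noteq> b \<and> a \<notin> U \<and> b \<notin> U)"

text \<open>
  The length density at \<open>z\<close> of the hyperbolic metric (of curvature -1) on the component of \<open>U\<close>
  containing \<open>z\<close>: the push-forward of \<open>2 |dw| / (1 - |w|^2)\<close> under a holomorphic universal covering
  by the unit disk, normalized to send 0 to \<open>z\<close>.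
\<close>

definition hyperbolic_density :: "complex set \<Rightarrow> complex \<Rightarrow> real" where
  "hyperbolic_density U z =
     (THE \<rho>. \<exists>\<pi>. \<pi> holomorphic_on ball 0 1 \<and>
        covering_space (ball 0 1) \<pi> (connected_component_set U z) \<and>
        \<pi> 0 = z \<and> \<rho> = 2 / norm (deriv \<pi> 0))"

definition harmonic_beltrami_on :: "complex set \<Rightarrow> (complex \<Rightarrow> complex) \<Rightarrow> bool" where
  "harmonic_beltrami_on U \<mu> \<longleftrightarrow>
     (\<exists>\<nu>. \<nu> holomorphic_on U \<and>
        (\<forall>z\<in>U. \<mu> z = cnj (\<nu> z) / complex_of_real ((hyperbolic_density U z)\<^sup>2)))"

text \<open>Beltrami coefficients matter only up to null sets, hence the existential quantifier.\<close>

definition quasiconformal_harmonic_on :: "(complex option \<Rightarrow> complex option) \<Rightarrow> complex set \<Rightarrow> bool" where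
  "quasiconformal_harmonic_on f U \<longleftrightarrow>
     (\<exists>\<mu>. quasiconformal_with f \<mu> \<and> harmonic_beltrami_on U \<mu>)"


section \<open>The McMullen--Sullivan motion\<close>

text \<open>
  The Bers--Royden extension of the motion of the grand orbits of the critical points: its Beltrami
  coefficient is harmonic on the complement of the closure of these orbits. The complement is a
  subset of the plane since infinity is a critical point. It fails to be hyperbolic only when
  \<open>P 0\<close> is affinely conjugate to a power map; harmonicity on it is then meaningless, and is only
  required on the complement of the filled Julia set, which is always hyperbolic.
\<close>

definition mcmullen_sullivan_motion ::
  "(complex ^ 'n) set \<Rightarrow> (complex ^ 'n \<Rightarrow> complex poly)
     \<Rightarrow> (complex ^ 'n \<Rightarrow> complex option \<Rightarrow> complex option) \<Rightarrow> bool" where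
  "mcmullen_sullivan_motion D P \<psi> \<longleftrightarrow>
     holomorphic_motion D UNIV \<psi> \<and>
     critical_orbit_motion D P \<psi> \<and>
     (let U = {z. Some z \<notin> riemann_sphere closure_of critical_grand_orbits (P 0)} in
        hyperbolic_open U \<longrightarrow> (\<forall>t\<in>D. quasiconformal_harmonic_on (\<psi> t) U)) \<and>
     (\<forall>t\<in>D. homeomorphic_map riemann_sphere riemann_sphere (\<psi> t) \<and>
            (\<forall>z. \<psi> t (poly_sphere (P 0) z) = poly_sphere (P t) (\<psi> t z)) \<and>
            quasiconformal_harmonic_on (\<psi> t) (- filled_julia (P 0)))"

end

theory Submission
  imports Defs
begin

text \<open>
  Fix a parameter \<open>t\<close> and write \<open>f\<close> for the motion at \<open>t\<close>, \<open>U\<close> for the complement of the filled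
  Julia set of \<open>P 0\<close>, and \<open>\<mu>\<close> for the harmonic Beltrami coefficient of \<open>f\<close> on \<open>U\<close>.

  The map \<open>f\<close> conjugates \<open>P 0\<close> to the holomorphic map \<open>P t\<close>, so \<open>\<mu>\<close> is invariant under \<open>P 0\<close>. The
  polynomial \<open>P 0\<close> acts on \<open>U\<close> as the self-covering \<open>w \<mapsto> w ^ d\<close> of the exterior of the disk, hence as
  a local isometry of the hyperbolic metric, and invariance of \<open>\<mu> = cnj \<nu> / \<rho>\<^sup>2\<close> means invariance of
  the quadratic differential \<open>\<nu> dz\<^sup>2\<close>. In the coordinate \<open>s = log \<phi>\<close> on the right half-plane this is
  a function with \<open>H s = d\<^sup>2 * H (d * s)\<close> and period \<open>2 \<pi> i\<close>. Then every \<open>2 \<pi> i / d ^ n\<close> is a period,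
  so \<open>H\<close> is constant, and \<open>H = d\<^sup>2 * H\<close> gives \<open>H = 0\<close>. So \<open>\<mu> = 0\<close> on \<open>U\<close>
  (\<open>harmonic_coefficient_zero\<close>), and \<open>f\<close> is holomorphic on \<open>U\<close> by Weyl's lemma
  (\<open>harmonic_conjugacy_holomorphic\<close>).

  The invariance of \<open>\<mu>\<close> (\<open>beltrami_coefficient_invariant\<close>) is read off from the weak
  derivatives. The explicit hyperbolic density shows that \<open>\<mu>\<close> is continuously
  differentiable, so it can be multiplied into test functions. Computing the weak derivatives of
  \<open>f \<circ> P 0 = P t \<circ> f\<close> in two ways, by substitution on the left and by the product rule on the right,
  gives \<open>\<integral> p * c * \<zeta> = 0\<close> for all test functions \<open>\<zeta>\<close>, where \<open>p\<close> is the weak z-derivative of \<open>f\<close> and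
  the continuous function \<open>c\<close> measures the failure of invariance. Where \<open>c\<close> does not vanish, both
  weak derivatives of \<open>f\<close> are zero, so \<open>f\<close> is locally constant there, against injectivity.

  Now \<open>A = \<phi> t \<circ> f \<circ> (\<phi> 0)\<inverse>\<close> is an injective holomorphic self-map of the exterior of the disk that
  commutes with \<open>w \<mapsto> w ^ d\<close> and fixes infinity. Iterating \<open>A (w ^ d) = A w ^ d\<close> towards infinity
  shows \<open>norm (A w) = norm w\<close>, so \<open>A\<close> is multiplication by a root of unity \<open>\<omega>\<close> of order dividing
  \<open>d - 1\<close> (\<open>power_conjugacy_rotation\<close>). Along the segment from the base point to \<open>t\<close> the number \<open>\<omega>\<close>
  varies continuously, because Boettcher coordinates are close to the identity near infinity,
  uniformly for polynomials with bounded coefficients (\<open>boettcher_near_identity\<close>). So it is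
  constant (\<open>rotation_number_constant\<close>), and at the base point it is 1.

  Two topological points remain. A motion of the sphere could a priori move infinity, which is
  excluded by continuity, since a finite image of infinity would be a fixed point of a polynomial
  and so lie in a fixed disk (\<open>infinity_fixed_on_segment\<close>). And \<open>f\<close> maps \<open>U\<close> into the basin of
  infinity of \<open>P t\<close> because preimages of bounded sets under \<open>f\<close> are bounded.
\<close>

section \<open>Locally integrable functions and weak first-order derivatives\<close>

text \<open>
  Both Wirtinger derivatives have this form, so facts about weak derivatives are proved once for
  all \<open>a\<close> and \<open>b\<close>.
\<close>

definition first_order_op :: "complex \<Rightarrow> complex \<Rightarrow> (complex \<Rightarrow> complex) \<Rightarrow> complex" where
  "first_order_op a b L = a * L 1 + b * L \<i>"

lemma wirtinger_z_eq: "wirtinger_z = first_order_op (1/2) (- \<i>/2)"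
  by (auto simp: fun_eq_iff wirtinger_z_def first_order_op_def field_simps)

lemma wirtinger_zbar_eq: "wirtinger_zbar = first_order_op (1/2) (\<i>/2)"
  by (auto simp: fun_eq_iff wirtinger_zbar_def first_order_op_def field_simps)

definition weak_op_on ::
  "complex set \<Rightarrow> complex \<Rightarrow> complex \<Rightarrow> (complex \<Rightarrow> complex) \<Rightarrow> (complex \<Rightarrow> complex) \<Rightarrow> bool" where
  "weak_op_on U a b f q \<longleftrightarrow> (\<forall>\<eta> \<eta>'. test_function U \<eta> \<eta>' \<longrightarrow>
     (LINT z|lebesgue. f z * first_order_op a b (\<eta>' z)) = - (LINT z|lebesgue. q z * \<eta> z))"

definition locally_integrable :: "(complex \<Rightarrow> complex) \<Rightarrow> bool" where
  "locally_integrable q \<longleftrightarrow> (\<forall>C. compact C \<longrightarrow> set_integrable lebesgue C q)"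

lemma continuous_lebesgue_measurable:
  fixes f :: "complex \<Rightarrow> 'b::{banach, second_countable_topology}"
  assumes "continuous_on UNIV f" shows "f \<in> borel_measurable lebesgue"
  using borel_measurable_continuous_onI[OF assms] by (simp add: measurable_completion)

lemma locally_integrable_continuous:
  assumes "continuous_on UNIV f" shows "locally_integrable f"
  unfolding locally_integrable_def
  by (meson absolutely_integrable_continuous_real assms continuous_on_subset subset_UNIV
      absolutely_integrable_continuous borel_integrable_compact set_integrable_def 
      integrable_completion borel_measurable_integrable)

text \<open>
  On a compact set \<open>h\<close> is bounded, so the product is dominated by a multiple of \<open>q\<close>.
\<close>

lemma locally_integrable_mult_continuous:
  assumes q: "locally_integrable q" and h: "continuous_on UNIV h"
  shows "locally_integrable (\<lambda>z. h z * q z)"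
  unfolding locally_integrable_def set_integrable_def
proof (intro allI impI)
  fix C :: "complex set" assume C: "compact C"
  obtain M where M: "\<And>z. z \<in> C \<Longrightarrow> norm (h z) \<le> M"
    using compact_imp_bounded[OF compact_continuous_image[OF continuous_on_subset[OF h subset_UNIV] C]]
    unfolding bounded_iff by blast
  have i: "integrable lebesgue (\<lambda>z. indicator C z *\<^sub>R q z)"
    using q C unfolding locally_integrable_def set_integrable_def by blast
  have i2: "integrable lebesgue (\<lambda>z. of_real M * (indicator C z *\<^sub>R q z))"
    using i by (rule integrable_mult_right)
  have eq: "(\<lambda>z. indicator C z *\<^sub>R (h z * q z)) = (\<lambda>z. h z * (indicator C z *\<^sub>R q z))" by simp
  show "integrable lebesgue (\<lambda>z. indicator C z *\<^sub>R (h z * q z))" unfolding eq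
  proof (rule Bochner_Integration.integrable_bound[OF i2])
    show "(\<lambda>z. h z * (indicator C z *\<^sub>R q z)) \<in> borel_measurable lebesgue"
      using i continuous_lebesgue_measurable[OF h] by (intro borel_measurable_times) auto
    show "AE z in lebesgue. norm (h z * (indicator C z *\<^sub>R q z)) \<le> norm (of_real M * (indicator C z *\<^sub>R q z))"
    proof (rule AE_I2)
      fix z show "norm (h z * (indicator C z *\<^sub>R q z)) \<le> norm (of_real M * (indicator C z *\<^sub>R q z))"
        using M[of z] by (cases "z \<in> C") (auto simp: norm_mult mult_right_mono intro: order_trans[OF _ abs_ge_self])
    qed
  qed
qed

lemma integrable_mult_compact_support:
  assumes q: "locally_integrable q" and h: "continuous_on UNIV h" and C: "compact C"
    and supp: "\<And>z. z \<notin> C \<Longrightarrow> h z = 0"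
  shows "integrable lebesgue (\<lambda>z. q z * h z)"
proof -
  have "integrable lebesgue (\<lambda>z. indicator C z *\<^sub>R (h z * q z))"
    using locally_integrable_mult_continuous[OF q h] C
    unfolding locally_integrable_def set_integrable_def by blast
  moreover have "(\<lambda>z. indicator C z *\<^sub>R (h z * q z)) = (\<lambda>z. q z * h z)"
    using supp by (auto simp: fun_eq_iff indicator_def)
  ultimately show ?thesis by simp
qed

lemma integrable_compact_support:
  fixes h :: "complex \<Rightarrow> complex"
  assumes h: "continuous_on UNIV h" and C: "compact C"
    and supp: "\<And>z. z \<notin> C \<Longrightarrow> h z = 0"
  shows "integrable lebesgue h"
proof -
  have "locally_integrable (\<lambda>_. 1)" by (rule locally_integrable_continuous) auto
  from integrable_mult_compact_support[OF this h C supp] show ?thesis by simp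
qed

lemma locally_integrable_add:
  "locally_integrable p \<Longrightarrow> locally_integrable q \<Longrightarrow> locally_integrable (\<lambda>z. p z + q z)"
  unfolding locally_integrable_def by (auto intro: set_integral_add)

text \<open>
  On a compact set \<open>norm p\<close> is dominated by the integrable function \<open>1 + (norm p)\<^sup>2\<close>.
\<close>

lemma locally_L2_imp_locally_integrable:
  assumes "locally_L2_on UNIV p" shows "locally_integrable p"
  unfolding locally_integrable_def set_integrable_def
proof (intro allI impI)
  fix C :: "complex set" assume C: "compact C"
  have m: "p \<in> borel_measurable lebesgue"
    using assms unfolding locally_L2_on_def set_borel_measurable_def by simp
  have i: "integrable lebesgue (\<lambda>z. indicator C z *\<^sub>R (norm (p z))\<^sup>2)"
    using assms C unfolding locally_L2_on_def set_integrable_def by simp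
  have "set_integrable lebesgue C (\<lambda>_. 1::complex)"
    using locally_integrable_continuous[of "\<lambda>_. 1"] C unfolding locally_integrable_def by simp
  then have "integrable lebesgue (\<lambda>z. norm (indicator C z *\<^sub>R (1::complex)))"
    unfolding set_integrable_def by (rule integrable_norm)
  then have "integrable lebesgue (\<lambda>z. norm (indicator C z *\<^sub>R (1::complex)) + indicator C z *\<^sub>R (norm (p z))\<^sup>2)"
    using i by (rule Bochner_Integration.integrable_add)
  then show "integrable lebesgue (\<lambda>z. indicator C z *\<^sub>R p z)"
  proof (rule Bochner_Integration.integrable_bound)
    have "C \<in> sets lebesgue" using C by (simp add: borel_compact sets_completionI_sets)
    then show "(\<lambda>z. indicator C z *\<^sub>R p z) \<in> borel_measurable lebesgue"
      using m by (intro borel_measurable_scaleR) auto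
    have "x \<le> 1 + x\<^sup>2" for x :: real
      by (smt (verit, best) one_le_power power2_eq_square mult_left_le_one_le zero_le_power2 self_le_power pos2)
    then show "AE z in lebesgue. norm (indicator C z *\<^sub>R p z) \<le>
       norm (norm (indicator C z *\<^sub>R (1::complex)) + indicator C z *\<^sub>R (norm (p z))\<^sup>2)"
      by (intro AE_I2) (auto simp: indicator_def abs_of_nonneg)
  qed
qed

section \<open>Convolution with a test function\<close>

lemma test_function_subset: "test_function U \<eta> \<eta>' \<Longrightarrow> U \<subseteq> V \<Longrightarrow> test_function V \<eta> \<eta>'"
  unfolding test_function_def by blast

lemma test_function_continuous: "test_function U \<eta> \<eta>' \<Longrightarrow> continuous_on UNIV \<eta>"
  unfolding test_function_def
  by (auto intro!: continuous_at_imp_continuous_on intro: has_derivative_continuous)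

text \<open>
  The derivative vanishes off \<open>C\<close> as well, since the complement of \<open>C\<close> is open.
\<close>

lemma test_function_supportE:
  assumes "test_function U \<eta> \<eta>'"
  obtains C where "compact C" "C \<subseteq> U" "\<And>z. z \<notin> C \<Longrightarrow> \<eta> z = 0" "\<And>z v. z \<notin> C \<Longrightarrow> \<eta>' z v = 0"
proof -
  obtain C where C: "compact C" "C \<subseteq> U" "\<And>z. z \<notin> C \<Longrightarrow> \<eta> z = 0"
    and d: "\<And>z. (\<eta> has_derivative \<eta>' z) (at z)"
    using assms unfolding test_function_def by blast
  have "\<eta>' z v = 0" if "z \<notin> C" for z v
  proof -
    have "open (- C)" using C(1) by (simp add: compact_imp_closed open_Compl)
    then have "((\<lambda>_. 0) has_derivative \<eta>' z) (at z)"
      using has_derivative_transform_within_open[OF d[of z], of "-C" "\<lambda>_. 0"] that C(3) by auto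
    then have "\<eta>' z = (\<lambda>_. 0)" using has_derivative_const has_derivative_unique by blast
    then show ?thesis by simp
  qed
  with C that show thesis by blast
qed

lemma continuous_first_order_op:
  assumes "\<And>v. continuous_on S (\<lambda>z. L z v)"
  shows "continuous_on S (\<lambda>z. first_order_op a b (L z))"
  unfolding first_order_op_def by (intro continuous_intros assms)

lemma test_function_deriv_continuous:
  assumes "test_function U \<eta> \<eta>'"
  shows "continuous_on UNIV (\<lambda>z. \<eta>' z v)"
  using assms unfolding test_function_def by blast

lemma lebesgue_integral_eq_box:
  fixes h :: "complex \<Rightarrow> complex"
  assumes h: "continuous_on UNIV h" and supp: "\<And>z. z \<notin> cbox a b \<Longrightarrow> h z = 0"
  shows "(LINT z|lebesgue. h z) = integral (cbox a b) h"
proof -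
  have eq: "(\<lambda>z. indicator (cbox a b) z *\<^sub>R h z) = h"
    using supp by (auto simp: indicator_def fun_eq_iff)
  have "integrable lebesgue h" 
    by (rule integrable_compact_support[OF h compact_cbox]) (rule supp)
  then have "set_integrable lebesgue (cbox a b) h" unfolding set_integrable_def eq .
  from set_lebesgue_integral_eq_integral(2)[OF this]
  show ?thesis unfolding set_lebesgue_integral_def eq by simp
qed

text \<open>
  Confines the integration variable of a convolution to a box, locally uniformly in the other
  variable.
\<close>

lemma box_containing_translates:
  fixes C :: "complex set"
  assumes "compact C"
  shows "\<exists>a b. \<forall>x t. x \<in> cball z 1 \<longrightarrow> t \<notin> cbox a b \<longrightarrow> x - t \<notin> C"
proof -
  obtain r where r: "\<forall>x\<in>C. norm x \<le> r"
    using compact_imp_bounded[OF assms] unfolding bounded_iff by blast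
  obtain b where b: "cball z (r + 1) \<subseteq> cbox (- b) b"
    by (rule bounded_subset_cbox_symmetric[OF bounded_cball])
  have "x - t \<notin> C" if xt: "x \<in> cball z 1" "t \<notin> cbox (- b) b" for x t
  proof
    assume "x - t \<in> C"
    then have "norm (x - t) \<le> r" using r by blast
    moreover have "norm (z - x) \<le> 1" using xt(1) by (simp add: dist_norm)
    ultimately have "norm (z - t) \<le> r + 1"
      using norm_triangle_ineq[of "z - x" "x - t"] by simp
    then show False using b xt(2) by (auto simp: dist_norm)
  qed
  then show ?thesis by blast
qed

text \<open>
  Near a given point only a fixed box of the integration variable matters, which allows
  differentiation under the integral sign.
\<close>

lemma convolution_has_derivative:
  assumes f: "continuous_on UNIV f" and k: "test_function UNIV k k'"
  shows "((\<lambda>z. LINT w|lebesgue. f w * k (z - w)) has_derivative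
          (\<lambda>v. LINT w|lebesgue. f w * k' (z - w) v)) (at z)"
proof -
  obtain C where C: "compact C" and "C \<subseteq> UNIV" and C0: "\<And>z. z \<notin> C \<Longrightarrow> k z = 0" "\<And>z v. z \<notin> C \<Longrightarrow> k' z v = 0"
    by (rule test_function_supportE[OF k]) (rule that)
  obtain a b where out: "\<And>x t. x \<in> cball z 1 \<Longrightarrow> t \<notin> cbox a b \<Longrightarrow> x - t \<notin> C"
    using box_containing_translates[OF C, of z] by blast
  have dk: "\<And>z. (k has_derivative k' z) (at z)" and ck': "\<And>v. continuous_on UNIV (\<lambda>z. k' z v)"
    using k unfolding test_function_def by auto
  have ck: "continuous_on UNIV k" by (rule test_function_continuous[OF k])
  define fx where "fx x t = Blinfun (\<lambda>v. f t * k' (x - t) v)" for x t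
  have fx: "blinfun_apply (fx x t) = (\<lambda>v. f t * k' (x - t) v)" for x t
    unfolding fx_def
    by (rule bounded_linear_Blinfun_apply)
       (intro bounded_linear_const_mult has_derivative_bounded_linear[OF dk])
  have cont1: "continuous_on UNIV (\<lambda>w. f w * k (x - w))" for x
    by (intro continuous_on_mult f continuous_on_compose2[OF ck] continuous_intros) simp
  have cont2: "continuous_on UNIV (\<lambda>w. f w * k' (x - w) v)" for x v
    by (intro continuous_on_mult f continuous_on_compose2[OF ck'] continuous_intros) simp
  have 1: "((\<lambda>x. integral (cbox a b) (\<lambda>w. f w * k (x - w))) has_derivative
         integral (cbox a b) (fx z)) (at z within cball z 1)"
  proof (rule leibniz_rule)
    show "((\<lambda>x. f t * k (x - t)) has_derivative blinfun_apply (fx x t)) (at x within cball z 1)"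
      for x t
      unfolding fx
    proof (rule has_derivative_at_withinI)
      have "((\<lambda>x. x - t) has_derivative (\<lambda>v. v)) (at x)" 
        using has_derivative_diff[OF has_derivative_ident has_derivative_const, of t] by simp
      from has_derivative_compose[OF this dk]
      show "((\<lambda>x. f t * k (x - t)) has_derivative (\<lambda>v. f t * k' (x - t) v)) (at x)"
        by (rule has_derivative_mult_right)
    qed
    show "(\<lambda>w. f w * k (x - w)) integrable_on cbox a b" for x
      by (rule integrable_continuous[OF continuous_on_subset[OF cont1]]) simp
    show "continuous_on (cball z 1 \<times> cbox a b) (\<lambda>(x, t). fx x t)"
      unfolding case_prod_unfold
      by (rule continuous_on_blinfun_componentwise, unfold fx)
         (intro continuous_on_mult continuous_on_compose2[OF f] continuous_on_compose2[OF ck']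
            continuous_on_diff continuous_on_fst continuous_on_snd continuous_on_id subset_UNIV)
  qed auto
  have 2: "blinfun_apply (integral (cbox a b) (fx z)) = (\<lambda>v. LINT w|lebesgue. f w * k' (z - w) v)"
  proof
    fix v
    have "fx z integrable_on cbox a b"
      by (rule integrable_continuous, rule continuous_on_blinfun_componentwise, unfold fx)
         (rule continuous_on_subset[OF cont2 subset_UNIV])
    then have "blinfun_apply (integral (cbox a b) (fx z)) v = integral (cbox a b) (\<lambda>w. f w * k' (z - w) v)"
      by (simp add: blinfun_apply_integral fx)
    also have "\<dots> = (LINT w|lebesgue. f w * k' (z - w) v)"
      by (rule lebesgue_integral_eq_box[symmetric, OF cont2]) (simp add: C0 out)
    finally show "blinfun_apply (integral (cbox a b) (fx z)) v = (LINT w|lebesgue. f w * k' (z - w) v)" .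
  qed
  have 3: "(LINT w|lebesgue. f w * k (x - w)) = integral (cbox a b) (\<lambda>w. f w * k (x - w))"
    if "x \<in> cball z 1" for x
    by (rule lebesgue_integral_eq_box[OF cont1]) (use C0(1)[OF out[OF that]] in simp)
  have "((\<lambda>x. LINT w|lebesgue. f w * k (x - w)) has_derivative
       (\<lambda>v. LINT w|lebesgue. f w * k' (z - w) v)) (at z within cball z 1)"
  proof (rule has_derivative_transform)
    show "((\<lambda>x. integral (cbox a b) (\<lambda>w. f w * k (x - w))) has_derivative
        (\<lambda>v. LINT w|lebesgue. f w * k' (z - w) v)) (at z within cball z 1)"
      using 1 unfolding 2 .
  qed (use 3 in auto)
  then show ?thesis using at_within_interior[of z "cball z 1"] by simp
qed

lemma convolution_continuous:
  fixes f h :: "complex \<Rightarrow> complex"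
  assumes f: "continuous_on UNIV f" and h: "continuous_on UNIV h"
    and C: "compact C" "\<And>z. z \<notin> C \<Longrightarrow> h z = 0"
  shows "continuous_on UNIV (\<lambda>z. LINT w|lebesgue. f w * h (z - w))"
proof (rule continuous_at_imp_continuous_on, rule ballI)
  fix z :: complex
  obtain a b where out: "\<And>x t. x \<in> cball z 1 \<Longrightarrow> t \<notin> cbox a b \<Longrightarrow> x - t \<notin> C"
    using box_containing_translates[OF C(1), of z] by blast
  have cont1: "continuous_on UNIV (\<lambda>w. f w * h (x - w))" for x
    by (intro continuous_on_mult f continuous_on_compose2[OF h] continuous_intros) simp
  have "continuous_on (cball z 1) (\<lambda>x. integral (cbox a b) (\<lambda>w. f w * h (x - w)))"
    by (rule integral_continuous_on_param)
      (unfold case_prod_unfold, intro continuous_on_mult continuous_on_compose2[OF f] continuous_on_compose2[OF h]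
            continuous_on_diff continuous_on_fst continuous_on_snd continuous_on_id subset_UNIV)
  moreover have "integral (cbox a b) (\<lambda>w. f w * h (x - w)) = (LINT w|lebesgue. f w * h (x - w))"
    if "x \<in> cball z 1" for x
    by (rule lebesgue_integral_eq_box[symmetric, OF cont1]) (use C(2)[OF out[OF that]] in simp)
  ultimately have "continuous_on (cball z 1) (\<lambda>x. LINT w|lebesgue. f w * h (x - w))"
    using continuous_on_cong[of "cball z 1" "cball z 1" "\<lambda>x. integral (cbox a b) (\<lambda>w. f w * h (x - w))"
       "\<lambda>x. LINT w|lebesgue. f w * h (x - w)"] by blast
  then have "continuous_on (ball z 1) (\<lambda>z. LINT w|lebesgue. f w * h (z - w))"
    using ball_subset_cball continuous_on_subset by blast
  then show "isCont (\<lambda>z. LINT w|lebesgue. f w * h (z - w)) z"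
    by (simp add: continuous_on_eq_continuous_at)
qed

text \<open>
  The double integrals in the product rule below have continuous integrands with compact support: the
  locally integrable weak derivatives never enter them.
\<close>

lemma fubini_compact_support:
  fixes F :: "complex \<Rightarrow> complex \<Rightarrow> complex"
  assumes F: "continuous_on UNIV (\<lambda>(x,y). F x y)" and C: "compact C" "compact D"
    and supp: "\<And>x y. x \<notin> C \<or> y \<notin> D \<Longrightarrow> F x y = 0"
  shows "(LINT x|lebesgue. LINT y|lebesgue. F x y) = (LINT y|lebesgue. LINT x|lebesgue. F x y)"
proof -
  have eq: "(\<lambda>p. indicator (C \<times> D) p *\<^sub>R (\<lambda>(x,y). F x y) p) = (\<lambda>(x,y). F x y)"
    using supp by (auto simp: fun_eq_iff indicator_def)
  have "integrable lborel (\<lambda>p. indicator (C \<times> D) p *\<^sub>R (\<lambda>(x,y). F x y) p)"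
    by (rule borel_integrable_compact[OF compact_Times[OF C] continuous_on_subset[OF F]]) simp
  then have i: "integrable (lborel \<Otimes>\<^sub>M lborel) (\<lambda>(x,y). F x y)"
    unfolding eq by (simp add: lborel_prod)
  have Fm: "(\<lambda>(x,y). F x y) \<in> borel_measurable (lborel \<Otimes>\<^sub>M lborel)"
    using i by (rule borel_measurable_integrable)
  have 1: "(LINT y|lebesgue. F x y) = (LINT y|lborel. F x y)" for x
    by (rule integral_completion) (use measurable_compose[OF measurable_Pair1'[of x] Fm] in simp)
  have 2: "(LINT x|lebesgue. F x y) = (LINT x|lborel. F x y)" for y
    by (rule integral_completion) (use measurable_compose[OF measurable_Pair2'[of y] Fm] in simp)
  have 3: "(\<lambda>x. LINT y|lborel. F x y) \<in> borel_measurable lborel"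
    by (rule lborel.borel_measurable_lebesgue_integral[OF Fm])
  have "(\<lambda>(y,x). F x y) \<in> borel_measurable (lborel \<Otimes>\<^sub>M lborel)"
    using measurable_pair_swap[OF Fm] by (simp add: case_prod_unfold)
  then have 4: "(\<lambda>y. LINT x|lborel. F x y) \<in> borel_measurable lborel"
    using lborel.borel_measurable_lebesgue_integral by blast
  show ?thesis
    unfolding 1 2 integral_completion[OF 3] integral_completion[OF 4]
    by (rule lborel_pair.Fubini_integral[OF i, symmetric])
qed

section \<open>Mollifiers\<close>

text \<open>
  The second conjunct says that \<open>k\<close> is real and nonnegative. Evenness lets a convolution be moved
  from one factor of an integral to the other.
\<close>

definition mollifier :: "real \<Rightarrow> (complex \<Rightarrow> complex) \<Rightarrow> (complex \<Rightarrow> complex \<Rightarrow> complex) \<Rightarrow> bool" where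
  "mollifier e k k' \<longleftrightarrow> test_function (cball 0 e) k k' \<and> (\<forall>z. k z = of_real (norm (k z))) \<and>
     (\<forall>z. k (- z) = k z) \<and> (LINT z|lebesgue. k z) = 1"

lemma has_derivative_max0_squared:
  "((\<lambda>x::real. (max 0 x)\<^sup>2) has_derivative (\<lambda>v. 2 * max 0 x * v)) (at x)"
proof -
  have "((\<lambda>x::real. (max 0 x)\<^sup>2) has_real_derivative 2 * max 0 x) (at x)"
  proof (cases x "0::real" rule: linorder_cases)
    case less
    have "((\<lambda>x::real. 0) has_real_derivative 2 * max 0 x) (at x)" using less by auto
    then show ?thesis
      by (rule DERIV_cong_ev[OF refl _ refl, THEN iffD2, rotated])
         (use less in \<open>auto intro!: eventually_mono[OF eventually_nhds_in_open[of "{..<0}" x]]\<close>)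
  next
    case greater
    have "((\<lambda>x::real. x\<^sup>2) has_real_derivative 2 * max 0 x) (at x)"
      using greater by (auto intro!: derivative_eq_intros)
    then show ?thesis
      by (rule DERIV_cong_ev[OF refl _ refl, THEN iffD2, rotated])
         (use greater in \<open>auto intro!: eventually_mono[OF eventually_nhds_in_open[of "{0<..}" x]]\<close>)
  next
    case equal
    have "(\<lambda>h::real. ((max 0 (0 + h))\<^sup>2 - (max 0 0)\<^sup>2) / h) = (\<lambda>h. max 0 h)"
      by (auto simp: fun_eq_iff max_def power2_eq_square)
    moreover have "isCont (\<lambda>h::real. max 0 h) 0" by (intro continuous_intros)
    ultimately show ?thesis using equal unfolding DERIV_def isCont_def by simp
  qed
  then show ?thesis by (simp add: has_field_derivative_def)
qed

lemma test_function_scale: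
  assumes "test_function U k k'"
  shows "test_function U (\<lambda>z. c * k z) (\<lambda>z v. c * k' z v)"
  unfolding test_function_def
proof (intro conjI allI)
  show "((\<lambda>z. c * k z) has_derivative (\<lambda>v. c * k' z v)) (at z)" for z
    using assms unfolding test_function_def by (intro has_derivative_mult_right) auto
  show "continuous_on UNIV (\<lambda>z. c * k' z v)" for v
    using assms unfolding test_function_def by (intro continuous_intros) auto
  show "\<exists>C. compact C \<and> C \<subseteq> U \<and> (\<forall>z. z \<notin> C \<longrightarrow> c * k z = 0)"
    using assms unfolding test_function_def by auto
qed

text \<open>
  The function \<open>(max 0 (e\<^sup>2 - (norm z)\<^sup>2))\<^sup>2\<close> is continuously differentiable; it is divided by its
  integral.
\<close>

lemma mollifier_exists:
  assumes e: "0 < e"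
  obtains k k' where "mollifier e k k'"
proof -
  define h :: "complex \<Rightarrow> real" where "h z = (max 0 (e\<^sup>2 - z \<bullet> z))\<^sup>2" for z
  define h' :: "complex \<Rightarrow> complex \<Rightarrow> real" where "h' z v = 2 * max 0 (e\<^sup>2 - z \<bullet> z) * (- 2 * (z \<bullet> v))" for z v
  have dh: "(h has_derivative h' z) (at z)" for z
  proof -
    have "((\<lambda>z. e\<^sup>2 - z \<bullet> z) has_derivative (\<lambda>v. - 2 * (z \<bullet> v))) (at z)"
      by (auto intro!: derivative_eq_intros simp: inner_commute)
    from has_derivative_compose[OF this has_derivative_max0_squared]
    show ?thesis unfolding h_def h'_def .
  qed
  have h0: "h z = 0" if "z \<notin> cball 0 e" for z
  proof -
    have "e < norm z" using that by simp
    then have "e\<^sup>2 < (norm z)\<^sup>2" using e by (intro power_strict_mono) auto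
    then show ?thesis unfolding h_def by (simp add: dot_square_norm)
  qed
  have hpos: "h z > 0" if "z \<in> ball 0 e" for z
  proof -
    have "(norm z)\<^sup>2 < e\<^sup>2" using that e by (intro power_strict_mono) auto
    then show ?thesis unfolding h_def by (simp add: dot_square_norm)
  qed
  have hnn: "h z \<ge> 0" for z unfolding h_def by simp
  define k where "k z = complex_of_real (h z)" for z
  have tk: "test_function (cball 0 e) k (\<lambda>z v. complex_of_real (h' z v))"
    unfolding test_function_def
  proof (intro conjI allI)
    show "(k has_derivative (\<lambda>v. complex_of_real (h' z v))) (at z)" for z
      unfolding k_def by (rule has_derivative_of_real[OF dh])
    show "continuous_on UNIV (\<lambda>z. complex_of_real (h' z v))" for v
      unfolding h'_def by (intro continuous_intros)
    show "\<exists>C. compact C \<and> C \<subseteq> cball 0 e \<and> (\<forall>z. z \<notin> C \<longrightarrow> k z = 0)"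
      using h0 unfolding k_def by (intro exI[of _ "cball 0 e"]) auto
  qed
  have ki: "integrable lebesgue k"
    by (rule integrable_compact_support[OF test_function_continuous[OF tk] compact_cball[of 0 e]])
       (simp add: k_def h0)
  have "(\<lambda>z. norm (k z)) = h" using hnn by (auto simp: k_def fun_eq_iff)
  then have hi: "integrable lebesgue h"
    using integrable_norm[OF ki] by (simp only:)
  define I where "I = (LINT z|lebesgue. h z)"
  have kI: "(LINT z|lebesgue. k z) = complex_of_real I" unfolding k_def I_def by (rule integral_of_real[OF hi])
  have "I \<noteq> 0"
  proof
    assume "I = 0"
    then have "AE z in lebesgue. h z = 0"
      unfolding I_def using integral_nonneg_eq_0_iff_AE[OF hi] hnn by simp
    then have "AE z in lebesgue. z \<notin> ball (0::complex) e"
      by (rule AE_mp) (use hpos in \<open>auto intro!: AE_I2 simp: order_less_le\<close>)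
    then have "ball (0::complex) e \<in> null_sets lebesgue"
      by (subst AE_iff_null_sets) (auto simp: Compl_eq)
    then have "negligible (ball (0::complex) e)" by (simp add: negligible_iff_null_sets)
    then show False using open_not_negligible[of "ball (0::complex) e"] e by auto
  qed
  moreover have "I \<ge> 0" unfolding I_def using hnn by simp
  ultimately have I: "I > 0" by simp
  show thesis
  proof (rule that)
    show "mollifier e (\<lambda>z. complex_of_real (1 / I) * k z) (\<lambda>z v. complex_of_real (1 / I) * complex_of_real (h' z v))"
      unfolding mollifier_def
    proof (intro conjI allI test_function_scale tk)
      show "complex_of_real (1 / I) * k z = complex_of_real (norm (complex_of_real (1 / I) * k z))" for z
        using I hnn[of z] by (simp add: k_def norm_mult norm_divide)
      show "complex_of_real (1 / I) * k (- z) = complex_of_real (1 / I) * k z" for z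
        unfolding k_def h_def by simp
      show "(LINT z|lebesgue. complex_of_real (1 / I) * k z) = 1"
        using I by (subst integral_mult_right_zero) (simp add: kI)
    qed
  qed
qed

definition convolve :: "(complex \<Rightarrow> complex) \<Rightarrow> (complex \<Rightarrow> complex) \<Rightarrow> complex \<Rightarrow> complex" where
  "convolve f k z = (LINT w|lebesgue. f w * k (z - w))"

lemma lebesgue_integral_translate:
  assumes k: "continuous_on UNIV (k :: complex \<Rightarrow> complex)"
  shows "(LINT w|lebesgue. k (w - z)) = (LINT w|lebesgue. k w)"
proof -
  have km: "k \<in> borel_measurable borel" using k by (rule borel_measurable_continuous_onI)
  have "(LINT w|lebesgue. k w) = (LINT w|lborel. k w)"
    using km by (intro integral_completion) simp
  also have "\<dots> = (LINT w|distr lborel borel ((+) (- z)). k w)"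
    by (simp only: lborel_distr_plus)
  also have "\<dots> = (LINT w|lborel. k (w - z))"
    using km by (subst integral_distr) simp_all
  also have "\<dots> = (LINT w|lebesgue. k (w - z))"
    using km by (intro integral_completion[symmetric]) simp
  finally show ?thesis by simp
qed

text \<open>
  A convolution with a mollifier is a weighted average of the values of \<open>f\<close> within distance \<open>e\<close>.
\<close>

lemma convolve_close:
  assumes f: "continuous_on UNIV f" and m: "mollifier e k k'"
    and d: "\<And>w. w \<in> cball z e \<Longrightarrow> norm (f w - f z) \<le> \<delta>"
  shows "norm (convolve f k z - f z) \<le> \<delta>"
proof -
  have tk: "test_function (cball 0 e) k k'" and kn: "\<And>z. k z = of_real (norm (k z))"
    and ke: "\<And>z. k (- z) = k z" and k1: "(LINT z|lebesgue. k z) = 1"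
    using m unfolding mollifier_def by auto
  have ck: "continuous_on UNIV k" by (rule test_function_continuous[OF tk])
  have k0: "k w = 0" if "w \<notin> cball 0 e" for w
    using tk that unfolding test_function_def by blast
  have kz: "k (z - w) = k (w - z)" for w using ke[of "w - z"] by simp
  have k0': "k (z - w) = 0" if "w \<notin> cball z e" for w
    by (rule k0) (use that in \<open>simp add: dist_norm norm_minus_commute\<close>)
  have ck2: "continuous_on UNIV (\<lambda>w. k (z - w))"
    by (rule continuous_on_compose2[OF ck]) (auto intro!: continuous_intros)
  have i1: "integrable lebesgue (\<lambda>w. f w * k (z - w))"
    by (rule integrable_compact_support[OF continuous_on_mult[OF f ck2] compact_cball[of z e]]) (simp add: k0')
  have i2: "integrable lebesgue (\<lambda>w. f z * k (z - w))"
    by (rule integrable_compact_support[OF continuous_on_mult[OF continuous_on_const ck2] compact_cball[of z e]])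
       (simp add: k0')
  have i3: "integrable lebesgue (\<lambda>w. k (z - w))"
    by (rule integrable_compact_support[OF ck2 compact_cball[of z e]]) (rule k0')
  have 1: "(LINT w|lebesgue. k (z - w)) = 1"
    unfolding kz lebesgue_integral_translate[OF ck] k1 ..
  have "convolve f k z - f z = (LINT w|lebesgue. f w * k (z - w)) - (LINT w|lebesgue. f z * k (z - w))"
    unfolding convolve_def using 1 by simp
  also have "\<dots> = (LINT w|lebesgue. f w * k (z - w) - f z * k (z - w))"
    by (rule Bochner_Integration.integral_diff[OF i1 i2, symmetric])
  finally have "norm (convolve f k z - f z) \<le> (LINT w|lebesgue. norm (f w * k (z - w) - f z * k (z - w)))"
    by (simp add: integral_norm_bound)
  also have "\<dots> \<le> (LINT w|lebesgue. \<delta> * norm (k (z - w)))"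
  proof (rule integral_mono)
    show "integrable lebesgue (\<lambda>w. norm (f w * k (z - w) - f z * k (z - w)))"
      using i1 i2 by (intro integrable_norm Bochner_Integration.integrable_diff)
    show "integrable lebesgue (\<lambda>w. \<delta> * norm (k (z - w)))"
      by (intro integrable_mult_right integrable_norm i3)
    show "norm (f w * k (z - w) - f z * k (z - w)) \<le> \<delta> * norm (k (z - w))" for w
    proof (cases "w \<in> cball z e")
      case True
      have "f w * k (z - w) - f z * k (z - w) = (f w - f z) * k (z - w)" by (simp add: algebra_simps)
      then show ?thesis using d[OF True] by (simp add: norm_mult mult_right_mono)
    next
      case False
      then show ?thesis by (simp add: k0')
    qed
  qed
  also have "\<dots> = \<delta> * (LINT w|lebesgue. norm (k (z - w)))" by simp
  also have "(LINT w|lebesgue. norm (k (z - w))) = 1"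
  proof -
    have "complex_of_real (LINT w|lebesgue. norm (k (z - w))) = (LINT w|lebesgue. of_real (norm (k (z - w))))"
      by (rule integral_of_real[symmetric], rule integrable_norm, rule i3)
    also have "\<dots> = 1" using 1 kn by simp
    finally show ?thesis using of_real_eq_1_iff by blast
  qed
  finally show ?thesis by simp
qed

lemma convolve_uniform_approx:
  assumes f: "continuous_on UNIV f" and K: "compact K" and \<delta>: "0 < \<delta>"
  obtains e0 where "0 < e0" 
    "\<And>e k k' z. e \<le> e0 \<Longrightarrow> mollifier e k k' \<Longrightarrow> z \<in> K \<Longrightarrow> norm (convolve f k z - f z) \<le> \<delta>"
proof -
  define K1 where "K1 = {x + y |x y. x \<in> K \<and> y \<in> cball (0::complex) 1}"
  have "compact K1" unfolding K1_def by (rule compact_sums[OF K compact_cball])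
  then have "uniformly_continuous_on K1 f"
    using compact_uniformly_continuous continuous_on_subset[OF f subset_UNIV] by blast
  then obtain d where d: "d > 0" "\<And>x x'. x \<in> K1 \<Longrightarrow> x' \<in> K1 \<Longrightarrow> dist x' x < d \<Longrightarrow> dist (f x') (f x) < \<delta>"
    unfolding uniformly_continuous_on_def using \<delta> by metis
  show thesis
  proof (rule that[of "min 1 (d/2)"])
    show "0 < min 1 (d/2)" using d(1) by simp
    fix e k k' z assume e: "e \<le> min 1 (d/2)" and m: "mollifier e k k'" and z: "z \<in> K"
    show "norm (convolve f k z - f z) \<le> \<delta>"
    proof (rule convolve_close[OF f m])
      fix w assume w: "w \<in> cball z e"
      have "dist w z < d" using w e d(1) by (simp add: dist_commute)
      moreover have "z = z + 0" "w = z + (w - z)" by simp_all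
      then have "z \<in> K1" "w \<in> K1"
        unfolding K1_def using z w e by (fastforce simp: dist_norm norm_minus_commute)+
      ultimately show "norm (f w - f z) \<le> \<delta>" using d(2) by (force simp: dist_norm)
    qed
  qed
qed

text \<open>
  For fixed \<open>z\<close> the kernel \<open>w \<mapsto> k (z - w)\<close> is itself a test function, so the defining identity of
  the weak derivative applies to it.
\<close>

lemma first_order_op_convolve:
  assumes f: "continuous_on UNIV f" and w: "weak_op_on U a b f q"
    and m: "mollifier e k k'" and U: "cball z e \<subseteq> U"
  shows "first_order_op a b (\<lambda>v. LINT w|lebesgue. f w * k' (z - w) v) = (LINT w|lebesgue. q w * k (z - w))"
proof -
  have tk: "test_function (cball 0 e) k k'" using m unfolding mollifier_def by auto
  obtain C where C: "compact C" "C \<subseteq> cball 0 e" and C0: "\<And>z. z \<notin> C \<Longrightarrow> k z = 0" "\<And>z v. z \<notin> C \<Longrightarrow> k' z v = 0"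
    by (rule test_function_supportE[OF tk]) (rule that)
  have k0: "k (z - w) = 0" if "w \<notin> cball z e" for w
    by (rule C0) (use that C(2) in \<open>auto simp: dist_norm subset_eq\<close>)
  have k0': "k' (z - w) v = 0" if "w \<notin> cball z e" for w v
    by (rule C0) (use that C(2) in \<open>auto simp: dist_norm subset_eq\<close>)
  have dk: "(k has_derivative k' z) (at z)" for z using tk unfolding test_function_def by blast
  have lin: "k' x (- v) = - k' x v" for x v
    using linear_neg[OF has_derivative_linear[OF dk]] by blast
  have ck: "continuous_on UNIV (\<lambda>w. k' (z - w) v)" for v
    by (rule continuous_on_compose2[OF test_function_deriv_continuous[OF tk]]) (auto intro!: continuous_intros)
  have t: "test_function U (\<lambda>w. k (z - w)) (\<lambda>w v. - k' (z - w) v)"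
    unfolding test_function_def
  proof (intro conjI allI)
    fix w
    have "((\<lambda>w. z - w) has_derivative (\<lambda>v. - v)) (at w)"
      by (auto intro!: derivative_eq_intros)
    from has_derivative_compose[OF this dk]
    show "((\<lambda>w. k (z - w)) has_derivative (\<lambda>v. - k' (z - w) v)) (at w)"
      by (simp add: lin)
  next
    show "continuous_on UNIV (\<lambda>w. - k' (z - w) v)" for v
      by (intro continuous_intros ck)
    show "\<exists>C. compact C \<and> C \<subseteq> U \<and> (\<forall>w. w \<notin> C \<longrightarrow> k (z - w) = 0)"
      using U k0 by (intro exI[of _ "cball z e"]) auto
  qed
  have i: "integrable lebesgue (\<lambda>w. f w * k' (z - w) v)" for v
    by (rule integrable_compact_support[OF continuous_on_mult[OF f ck] compact_cball[of z e]]) (simp add: k0')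
  have "first_order_op a b (\<lambda>v. LINT w|lebesgue. f w * k' (z - w) v)
      = (LINT w|lebesgue. a * (f w * k' (z - w) 1) + b * (f w * k' (z - w) \<i>))"
    unfolding first_order_op_def using i by simp
  also have "\<dots> = (LINT w|lebesgue. - (f w * first_order_op a b (\<lambda>v. - k' (z - w) v)))"
    by (rule Bochner_Integration.integral_cong) (auto simp: first_order_op_def algebra_simps)
  also have "\<dots> = (LINT w|lebesgue. q w * k (z - w))"
    using w t unfolding weak_op_on_def by simp
  finally show ?thesis .
qed

section \<open>Weyl's lemma and the product rule for weak derivatives\<close>

lemma convolve_has_derivative:
  assumes "continuous_on UNIV f" "mollifier e k k'"
  shows "(convolve f k has_derivative (\<lambda>v. LINT w|lebesgue. f w * k' (z - w) v)) (at z)"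
proof -
  have "test_function UNIV k k'"
    using assms(2) test_function_subset unfolding mollifier_def by blast
  from convolution_has_derivative[OF assms(1) this] show ?thesis unfolding convolve_def .
qed

lemma convolve_deriv_continuous:
  assumes "continuous_on UNIV f" "mollifier e k k'"
  shows "continuous_on UNIV (\<lambda>z. LINT w|lebesgue. f w * k' (z - w) v)"
proof -
  have tk: "test_function (cball 0 e) k k'" using assms(2) unfolding mollifier_def by auto
  obtain C where C: "compact C" "C \<subseteq> cball 0 e" and C0: "\<And>z. z \<notin> C \<Longrightarrow> k z = 0" "\<And>z v. z \<notin> C \<Longrightarrow> k' z v = 0"
    by (rule test_function_supportE[OF tk]) (rule that)
  show ?thesis
    by (rule convolution_continuous[OF assms(1) test_function_deriv_continuous[OF tk] C(1)]) (rule C0)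
qed

lemma mollifier_sequence:
  obtains \<kappa> \<kappa>' where "\<And>n. mollifier (inverse (real (Suc n))) (\<kappa> n) (\<kappa>' n)"
proof -
  have "\<exists>p. mollifier (inverse (real (Suc n))) (fst p) (snd p)" for n
    using mollifier_exists[of "inverse (real (Suc n))"] by (metis fst_conv snd_conv inverse_positive_iff_positive of_nat_0_less_iff zero_less_Suc)
  then obtain p where "\<And>n. mollifier (inverse (real (Suc n))) (fst (p n)) (snd (p n))" by metis
  then show thesis by (rule that)
qed

lemma convolve_uniform_limit:
  assumes f: "continuous_on UNIV f" and m: "\<And>n. mollifier (inverse (real (Suc n))) (\<kappa> n) (\<kappa>' n)"
    and K: "compact K"
  shows "uniform_limit K (\<lambda>n. convolve f (\<kappa> n)) f sequentially"
proof (rule uniform_limitI)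
  fix \<epsilon> :: real assume e: "0 < \<epsilon>"
  obtain e0 where e0: "0 < e0" 
    "\<And>e k k' z. e \<le> e0 \<Longrightarrow> mollifier e k k' \<Longrightarrow> z \<in> K \<Longrightarrow> norm (convolve f k z - f z) \<le> \<epsilon>/2"
    using convolve_uniform_approx[OF f K, of "\<epsilon>/2"] e by auto
  have "eventually (\<lambda>n. inverse (real (Suc n)) < e0) sequentially"
    using LIMSEQ_inverse_real_of_nat e0(1) order_tendstoD(2) by blast
  then show "\<forall>\<^sub>F n in sequentially. \<forall>x\<in>K. dist (convolve f (\<kappa> n) x) (f x) < \<epsilon>"
  proof (rule eventually_mono)
    fix n assume "inverse (real (Suc n)) < e0"
    then have "\<forall>x\<in>K. norm (convolve f (\<kappa> n) x - f x) \<le> \<epsilon>/2"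
      using e0(2)[OF _ m] by simp
    then show "\<forall>x\<in>K. dist (convolve f (\<kappa> n) x) (f x) < \<epsilon>"
      using e by (fastforce simp: dist_norm)
  qed
qed

lemma real_linear_complex:
  assumes "linear D" shows "D v = Re v *\<^sub>R D 1 + Im v *\<^sub>R D \<i>"
proof -
  have "D (Re v *\<^sub>R 1 + Im v *\<^sub>R \<i>) = Re v *\<^sub>R D 1 + Im v *\<^sub>R D \<i>"
    by (simp only: linear_add[OF assms] linear_scale[OF assms])
  moreover have "Re v *\<^sub>R 1 + Im v *\<^sub>R \<i> = v" by (simp add: complex_eq_iff)
  ultimately show ?thesis by simp
qed

text \<open>
  The Cauchy--Riemann equation at a point.
\<close>

lemma complex_linear_if_dbar_zero:
  assumes lin: "linear D" and 0: "first_order_op (1/2) (\<i>/2) D = 0"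
  shows "D = (*) (D 1)"
proof
  fix v
  have "D 1 + \<i> * D \<i> = 0" using 0 by (simp add: first_order_op_def flip: add_divide_distrib)
  then have "\<i> * D \<i> = - D 1" by (simp add: eq_neg_iff_add_eq_0 add.commute)
  then have "- (\<i> * (\<i> * D \<i>)) = \<i> * D 1" by simp
  then have Di: "D \<i> = \<i> * D 1" by (simp flip: mult.assoc)
  have "D v = Re v *\<^sub>R D 1 + Im v *\<^sub>R (\<i> * D 1)" using real_linear_complex[OF lin, of v] Di by simp
  also have "\<dots> = D 1 * (Re v *\<^sub>R 1 + Im v *\<^sub>R \<i>)"
    by (simp only: scaleR_conv_of_real distrib_left mult_ac mult_1_right mult_1_left)
  also have "Re v *\<^sub>R 1 + Im v *\<^sub>R \<i> = v" by (simp add: complex_eq_iff)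
  finally show "D v = D 1 * v" .
qed

lemma uniformly_small_balls_inside:
  fixes U :: "complex set"
  assumes "open U" "z \<in> U"
  obtains r N where "r > 0" "\<And>n x. x \<in> ball z r \<Longrightarrow> cball x (inverse (real (Suc (n + N)))) \<subseteq> U"
proof -
  obtain s where s: "s > 0" "cball z s \<subseteq> U" using assms open_contains_cball by blast
  obtain N where N: "inverse (real (Suc N)) < s / 2" using reals_Archimedean[of "s / 2"] s(1) by auto
  show thesis
  proof (rule that[of "s / 2" N])
    fix n x assume x: "x \<in> ball z (s / 2)"
    have "inverse (real (Suc (n + N))) \<le> inverse (real (Suc N))" by (rule le_imp_inverse_le) auto
    then have e: "inverse (real (Suc (n + N))) \<le> s / 2" using N by linarith
    have "cball x (inverse (real (Suc (n + N)))) \<subseteq> cball z s"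
    proof
      fix y assume "y \<in> cball x (inverse (real (Suc (n + N))))"
      then have "dist x y \<le> s / 2" using e by simp
      moreover have "dist z x \<le> s / 2" using x by simp
      ultimately show "y \<in> cball z s" using dist_triangle[of z y x] by simp
    qed
    then show "cball x (inverse (real (Suc (n + N)))) \<subseteq> U" using s(2) by blast
  qed (use s(1) in simp)
qed

text \<open>
  The mollified functions are classically differentiable and satisfy the Cauchy--Riemann equation, so
  they are holomorphic; they converge to \<open>f\<close> locally uniformly.
\<close>

lemma weyl_lemma:
  assumes U: "open U" and f: "continuous_on UNIV f"
    and w: "weak_op_on U (1/2) (\<i>/2) f (\<lambda>_. 0)"
  shows "f holomorphic_on U"
proof -
  obtain \<kappa> \<kappa>' where m: "\<And>n. mollifier (inverse (real (Suc n))) (\<kappa> n) (\<kappa>' n)"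
    by (rule mollifier_sequence) (rule that)
  have "\<exists>r>0. f holomorphic_on ball z r" if z: "z \<in> U" for z
  proof -
    obtain r N where r: "r > 0" and sub: "\<And>n x. x \<in> ball z r \<Longrightarrow> cball x (inverse (real (Suc (n + N)))) \<subseteq> U"
      by (rule uniformly_small_balls_inside[OF U z]) (rule that)
    have "f holomorphic_on ball z r"
    proof (rule holomorphic_uniform_sequence)
      show "open (ball z r)" by simp
      fix n
      show "convolve f (\<kappa> (n + N)) holomorphic_on ball z r"
      proof (rule holomorphic_onI)
        fix x assume x: "x \<in> ball z r"
        let ?e = "inverse (real (Suc (n + N)))"
        have xU: "cball x ?e \<subseteq> U" by (rule sub[OF x])
        define D where "D v = (LINT w|lebesgue. f w * \<kappa>' (n + N) (x - w) v)" for v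
        have D: "(convolve f (\<kappa> (n + N)) has_derivative D) (at x)"
          unfolding D_def by (rule convolve_has_derivative[OF f m])
        have "first_order_op (1/2) (\<i>/2) D = 0"
          using first_order_op_convolve[OF f w m xU] unfolding D_def by simp
        moreover have "linear D" using D has_derivative_linear by blast
        ultimately have "D = (*) (D 1)" by (intro complex_linear_if_dbar_zero)
        then have "(convolve f (\<kappa> (n + N)) has_field_derivative D 1) (at x)"
          using D unfolding has_field_derivative_def by (simp only:)
        then show "convolve f (\<kappa> (n + N)) field_differentiable (at x within ball z r)"
          using field_differentiable_at_within field_differentiable_def by blast
      qed
    next
      fix x assume "x \<in> ball z r"
      then obtain d where d: "0 < d" "cball x d \<subseteq> ball z r"
        using open_contains_cball[of "ball z r"] by blast
      have "uniform_limit (cball x d) (\<lambda>n. convolve f (\<kappa> n)) f sequentially"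
        by (rule convolve_uniform_limit[OF f m compact_cball])
      then have "uniform_limit (cball x d) (\<lambda>n. convolve f (\<kappa> (n + N))) f sequentially"
        unfolding uniform_limit_iff
        using sequentially_offset[where P = "\<lambda>n. \<forall>y\<in>cball x d. dist (convolve f (\<kappa> n) y) (f y) < e" for e]
        by blast
      with d show "\<exists>d>0. cball x d \<subseteq> ball z r \<and> uniform_limit (cball x d) (\<lambda>n. convolve f (\<kappa> (n + N))) f sequentially"
        by blast
    qed
    then show ?thesis using r by blast
  qed
  then have "f analytic_on U" unfolding analytic_on_def by blast
  then show ?thesis by (rule analytic_imp_holomorphic)
qed

text \<open>
  The mollified functions have derivative zero on a ball, and constancy passes to the limit.
\<close>

lemma weak_ops_zero_imp_locally_constant:
  assumes U: "open U" and f: "continuous_on UNIV f"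
    and w1: "weak_op_on U (1/2) (- \<i>/2) f (\<lambda>_. 0)" and w2: "weak_op_on U (1/2) (\<i>/2) f (\<lambda>_. 0)"
    and z: "z \<in> U"
  shows "\<exists>r>0. \<forall>w\<in>ball z r. f w = f z"
proof -
  obtain \<kappa> \<kappa>' where m: "\<And>n. mollifier (inverse (real (Suc n))) (\<kappa> n) (\<kappa>' n)"
    by (rule mollifier_sequence) (rule that)
  obtain r N where r: "r > 0" and sub: "\<And>n x. x \<in> ball z r \<Longrightarrow> cball x (inverse (real (Suc (n + N)))) \<subseteq> U"
    by (rule uniformly_small_balls_inside[OF U z]) (rule that)
  have eq: "convolve f (\<kappa> (n + N)) y = convolve f (\<kappa> (n + N)) z" if y: "y \<in> ball z r" for n y
  proof -
    have "\<exists>c. \<forall>x\<in>ball z r. convolve f (\<kappa> (n + N)) x = c"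
    proof (rule has_derivative_zero_constant)
      fix x assume x: "x \<in> ball z r"
      let ?e = "inverse (real (Suc (n + N)))"
      have xU: "cball x ?e \<subseteq> U" by (rule sub[OF x])
      define D where "D v = (LINT w|lebesgue. f w * \<kappa>' (n + N) (x - w) v)" for v
      have D: "(convolve f (\<kappa> (n + N)) has_derivative D) (at x)"
        unfolding D_def by (rule convolve_has_derivative[OF f m])
      have "first_order_op (1/2) (\<i>/2) D = 0"
        using first_order_op_convolve[OF f w2 m xU] unfolding D_def by simp
      then have 1: "D 1 + \<i> * D \<i> = 0" by (simp add: first_order_op_def flip: add_divide_distrib)
      have "first_order_op (1/2) (- \<i>/2) D = 0"
        using first_order_op_convolve[OF f w1 m xU] unfolding D_def by simp
      then have 2: "D 1 - \<i> * D \<i> = 0" by (simp add: first_order_op_def flip: diff_divide_distrib)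
      have D1: "D 1 = 0" "D \<i> = 0" using 1 2 by (auto simp: algebra_simps)
      have lin: "linear D" using D has_derivative_linear by blast
      have "D v = 0" for v using real_linear_complex[OF lin, of v] D1 by simp
      then have "D = (\<lambda>_. 0)" by (simp add: fun_eq_iff)
      then show "(convolve f (\<kappa> (n + N)) has_derivative (\<lambda>_. 0)) (at x within ball z r)"
        using D has_derivative_at_withinI by blast
    qed simp
    then show ?thesis using y r by (metis centre_in_ball)
  qed
  have lim: "(\<lambda>n. convolve f (\<kappa> (n + N)) y) \<longlonglongrightarrow> f y" for y
    by (rule LIMSEQ_ignore_initial_segment,
        rule tendsto_uniform_limitI[OF convolve_uniform_limit[OF f m, of "{y}"]]) auto
  have "f y = f z" if "y \<in> ball z r" for y
    using LIMSEQ_unique[OF lim[of y]] lim[of z] eq[OF that] by simp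
  then show ?thesis using r by blast
qed

lemma integral_mult_uniform_limit:
  assumes q: "locally_integrable q" and D: "compact D"
    and hn: "\<And>n. continuous_on UNIV (h n)" and h: "continuous_on UNIV g"
    and supp: "\<And>n z. z \<notin> D \<Longrightarrow> h n z = 0" "\<And>z. z \<notin> D \<Longrightarrow> g z = 0"
    and lim: "uniform_limit D h g sequentially"
  shows "(\<lambda>n. LINT z|lebesgue. q z * h n z) \<longlonglongrightarrow> (LINT z|lebesgue. q z * g z)"
proof (rule LIMSEQ_I)
  fix e :: real assume e: "e > 0"
  have qi: "integrable lebesgue (\<lambda>z. indicator D z *\<^sub>R q z)"
    using q D unfolding locally_integrable_def set_integrable_def by blast
  define I where "I = (LINT z|lebesgue. norm (indicator D z *\<^sub>R q z))"
  have I: "I \<ge> 0" unfolding I_def by simp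
  define \<delta> where "\<delta> = e / (I + 1)"
  have \<delta>: "\<delta> > 0" "\<delta> * I < e" unfolding \<delta>_def using e I by (auto simp: field_simps)
  obtain N where N: "\<And>n z. n \<ge> N \<Longrightarrow> z \<in> D \<Longrightarrow> dist (h n z) (g z) < \<delta>"
    using uniform_limitD[OF lim \<delta>(1)] unfolding eventually_sequentially by blast
  have "norm ((LINT z|lebesgue. q z * h n z) - (LINT z|lebesgue. q z * g z)) < e" if n: "n \<ge> N" for n
  proof -
    have i1: "integrable lebesgue (\<lambda>z. q z * h n z)"
      by (rule integrable_mult_compact_support[OF q hn D]) (rule supp)
    have i2: "integrable lebesgue (\<lambda>z. q z * g z)"
      by (rule integrable_mult_compact_support[OF q h D]) (rule supp)
    have "norm ((LINT z|lebesgue. q z * h n z) - (LINT z|lebesgue. q z * g z))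
        = norm (LINT z|lebesgue. q z * h n z - q z * g z)"
      using i1 i2 by simp
    also have "\<dots> \<le> (LINT z|lebesgue. norm (q z * h n z - q z * g z))"
      by (rule integral_norm_bound)
    also have "\<dots> \<le> (LINT z|lebesgue. \<delta> * norm (indicator D z *\<^sub>R q z))"
    proof (rule integral_mono)
      show "integrable lebesgue (\<lambda>z. norm (q z * h n z - q z * g z))"
        by (intro integrable_norm Bochner_Integration.integrable_diff i1 i2)
      show "integrable lebesgue (\<lambda>z. \<delta> * norm (indicator D z *\<^sub>R q z))"
        by (intro integrable_mult_right integrable_norm qi)
      fix z
      show "norm (q z * h n z - q z * g z) \<le> \<delta> * norm (indicator D z *\<^sub>R q z)"
      proof (cases "z \<in> D")
        case True
        have "norm (q z * h n z - q z * g z) = norm (q z) * norm (h n z - g z)"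
          by (simp flip: norm_mult add: algebra_simps)
        also have "\<dots> \<le> norm (q z) * \<delta>"
          using N[OF n True] by (intro mult_left_mono) (auto simp: dist_norm)
        finally show ?thesis using True by (simp add: mult.commute)
      next
        case False
        then show ?thesis using supp by simp
      qed
    qed
    also have "\<dots> = \<delta> * I" unfolding I_def by simp
    finally show ?thesis using \<delta>(2) by linarith
  qed
  then show "\<exists>N. \<forall>n\<ge>N. norm ((LINT z|lebesgue. q z * h n z) - (LINT z|lebesgue. q z * g z)) < e" by blast
qed

text \<open>
  The factor \<open>m\<close> may be arbitrary outside \<open>V\<close>, because \<open>\<eta>\<close> vanishes near the complement of \<open>V\<close>.
\<close>

lemma test_function_mult_C1:
  assumes V: "open V" and m: "\<And>z. z \<in> V \<Longrightarrow> (m has_derivative m' z) (at z)"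
    and mc: "\<And>v. continuous_on V (\<lambda>z. m' z v)" and t: "test_function V \<eta> \<eta>'"
  shows "test_function V (\<lambda>z. m z * \<eta> z) (\<lambda>z v. if z \<in> V then m z * \<eta>' z v + m' z v * \<eta> z else 0)"
proof -
  obtain C where C: "compact C" "C \<subseteq> V" and C0: "\<And>z. z \<notin> C \<Longrightarrow> \<eta> z = 0" "\<And>z v. z \<notin> C \<Longrightarrow> \<eta>' z v = 0"
    by (rule test_function_supportE[OF t]) (rule that)
  have oC: "open (- C)" using C(1) by (simp add: compact_imp_closed open_Compl)
  have d\<eta>: "(\<eta> has_derivative \<eta>' z) (at z)" for z using t unfolding test_function_def by blast
  have mcont: "continuous_on V m"
    by (rule continuous_at_imp_continuous_on, rule ballI, rule has_derivative_continuous[OF m])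
  show ?thesis
    unfolding test_function_def
  proof (intro conjI allI)
    fix z
    show "((\<lambda>z. m z * \<eta> z) has_derivative (\<lambda>v. if z \<in> V then m z * \<eta>' z v + m' z v * \<eta> z else 0)) (at z)"
    proof (cases "z \<in> V")
      case True
      then show ?thesis using has_derivative_mult[OF m[OF True] d\<eta>] by simp
    next
      case False
      then have "z \<in> - C" using C(2) by blast
      have "((\<lambda>_. 0 :: complex) has_derivative (\<lambda>_. 0)) (at z)" by simp
      then have "((\<lambda>z. m z * \<eta> z) has_derivative (\<lambda>_. 0)) (at z)"
        by (rule has_derivative_transform_within_open[OF _ oC \<open>z \<in> - C\<close>]) (simp add: C0)
      then show ?thesis using False by simp
    qed
  next
    fix v
    let ?F = "\<lambda>z. if z \<in> V then m z * \<eta>' z v + m' z v * \<eta> z else 0"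
    have "continuous_on V (\<lambda>z. m z * \<eta>' z v + m' z v * \<eta> z)"
      by (intro continuous_on_add continuous_on_mult mcont mc
          continuous_on_subset[OF test_function_continuous[OF t] subset_UNIV]
          continuous_on_subset[OF test_function_deriv_continuous[OF t] subset_UNIV])
    then have 1: "continuous_on V ?F" by (rule continuous_on_eq) simp
    have 2: "continuous_on (- C) ?F"
      by (rule continuous_on_eq[of _ "\<lambda>_. 0"]) (auto simp: C0)
    have "continuous_on (V \<union> - C) ?F" by (rule continuous_on_open_Un[OF V oC 1 2])
    moreover have "V \<union> - C = UNIV" using C(2) by blast
    ultimately show "continuous_on UNIV ?F" by simp
  next
    show "\<exists>C. compact C \<and> C \<subseteq> V \<and> (\<forall>z. z \<notin> C \<longrightarrow> m z * \<eta> z = 0)"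
      using C C0 by (intro exI[of _ C]) auto
  qed
qed

text \<open>
  Only \<open>f\<close> is mollified, to \<open>F n\<close>. Since \<open>F n * \<eta>\<close> is a test function for \<open>g\<close>, the integral of
  \<open>g * F n\<close> against the derivative of \<open>\<eta>\<close> splits into one with \<open>q\<close> and one with the derivative of
  \<open>F n\<close>. In the latter the convolution is moved over to \<open>g * \<eta>\<close>, which turns it into a test function
  \<open>H n\<close> for \<open>f\<close> and produces the factor \<open>p\<close>. All continuous functions involved converge uniformly.
\<close>

lemma weak_op_mult:
  assumes f: "continuous_on UNIV f" and g: "continuous_on UNIV g"
    and wf: "weak_op_on UNIV a b f p" and wg: "weak_op_on UNIV a b g q"
    and p: "locally_integrable p" and q: "locally_integrable q"
  shows "weak_op_on UNIV a b (\<lambda>z. f z * g z) (\<lambda>z. g z * p z + f z * q z)"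
  unfolding weak_op_on_def
proof (intro allI impI)
  fix \<eta> \<eta>' assume t: "test_function UNIV \<eta> \<eta>'"
  obtain C where C: "compact C" "C \<subseteq> UNIV" and C0: "\<And>z. z \<notin> C \<Longrightarrow> \<eta> z = 0" "\<And>z v. z \<notin> C \<Longrightarrow> \<eta>' z v = 0"
    by (rule test_function_supportE[OF t]) (rule that)
  define C1 where "C1 = {x + y |x y. x \<in> C \<and> y \<in> cball (0::complex) 1}"
  have C1: "compact C1" unfolding C1_def by (rule compact_sums[OF C(1) compact_cball])
  have CC1: "C \<subseteq> C1" unfolding C1_def by force
  obtain \<kappa> \<kappa>' where m: "\<And>n. mollifier (inverse (real (Suc n))) (\<kappa> n) (\<kappa>' n)"
    by (rule mollifier_sequence) (rule that)
  have tk: "test_function (cball 0 (inverse (real (Suc n)))) (\<kappa> n) (\<kappa>' n)"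
    and even: "\<kappa> n (- z) = \<kappa> n z" for n z
    using m[of n] unfolding mollifier_def by auto
  have dk: "(\<kappa> n has_derivative \<kappa>' n z) (at z)" for n z using tk unfolding test_function_def by blast
  have lin: "\<kappa>' n x (- v) = - \<kappa>' n x v" for n x v
    using linear_neg[OF has_derivative_linear[OF dk]] by blast
  have odd: "\<kappa>' n (- z) v = - \<kappa>' n z v" for n z v
  proof -
    have "((\<lambda>w. - w) has_derivative (\<lambda>v. - v)) (at z)" by (auto intro!: derivative_eq_intros)
    from has_derivative_compose[OF this dk]
    have "(\<kappa> n has_derivative (\<lambda>v. - \<kappa>' n (- z) v)) (at z)" by (simp add: lin even)
    then have "(\<lambda>v. - \<kappa>' n (- z) v) = \<kappa>' n z" using dk has_derivative_unique by blast
    then show ?thesis by (metis minus_minus)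
  qed
  have \<kappa>0: "\<kappa> n (x - y) = 0" "\<kappa>' n (x - y) v = 0" if "x \<notin> C1" "y \<in> C" for n x y v
  proof -
    have "x = y + (x - y)" by simp
    then have "x - y \<notin> cball 0 1" using that unfolding C1_def by blast
    moreover have "inverse (real (Suc n)) \<le> 1" by (simp add: inverse_le_1_iff)
    ultimately have nin: "x - y \<notin> cball 0 (inverse (real (Suc n)))" by auto
    obtain B where B: "B \<subseteq> cball 0 (inverse (real (Suc n)))"
      and B0: "\<And>z. z \<notin> B \<Longrightarrow> \<kappa> n z = 0" "\<And>z v. z \<notin> B \<Longrightarrow> \<kappa>' n z v = 0"
      by (rule test_function_supportE[OF tk[of n]]) (rule that)
    show "\<kappa> n (x - y) = 0" "\<kappa>' n (x - y) v = 0" using nin B B0 by blast+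
  qed
  define F where "F n = convolve f (\<kappa> n)" for n
  define F' where "F' n z v = (LINT w|lebesgue. f w * \<kappa>' n (z - w) v)" for n z v
  have dF: "(F n has_derivative F' n z) (at z)" for n z
    unfolding F_def F'_def by (rule convolve_has_derivative[OF f m])
  have cF': "continuous_on UNIV (\<lambda>z. F' n z v)" for n v
    unfolding F'_def by (rule convolve_deriv_continuous[OF f m])
  have c\<eta>: "continuous_on UNIV \<eta>" and c\<eta>': "continuous_on UNIV (\<lambda>z. \<eta>' z v)" for v
    by (rule test_function_continuous[OF t], rule test_function_deriv_continuous[OF t])
  define g\<eta> where "g\<eta> z = g z * \<eta> z" for z
  have cg\<eta>: "continuous_on UNIV g\<eta>" unfolding g\<eta>_def by (rule continuous_on_mult[OF g c\<eta>])
  define H where "H n = convolve g\<eta> (\<kappa> n)" for n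
  define H' where "H' n z v = (LINT w|lebesgue. g\<eta> w * \<kappa>' n (z - w) v)" for n z v
  have dH: "(H n has_derivative H' n z) (at z)" for n z
    unfolding H_def H'_def by (rule convolve_has_derivative[OF cg\<eta> m])
  have cH': "continuous_on UNIV (\<lambda>z. H' n z v)" for n v
    unfolding H'_def by (rule convolve_deriv_continuous[OF cg\<eta> m])
  have g\<eta>0: "g\<eta> z = 0" if "z \<notin> C" for z unfolding g\<eta>_def using C0 that by simp
  have H0: "H n z = 0" if "z \<notin> C1" for n z
  proof -
    have "(\<lambda>w. g\<eta> w * \<kappa> n (z - w)) = (\<lambda>_. 0)"
      using \<kappa>0(1)[OF that] g\<eta>0 by fastforce
    then show ?thesis unfolding H_def convolve_def by simp
  qed
  have cF: "continuous_on UNIV (F n)" for n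
    by (rule continuous_at_imp_continuous_on, rule ballI, rule has_derivative_continuous[OF dF])
  have cH: "continuous_on UNIV (H n)" for n
    by (rule continuous_at_imp_continuous_on, rule ballI, rule has_derivative_continuous[OF dH])
  have tH: "test_function UNIV (H n) (H' n)" for n
    unfolding test_function_def
  proof (intro conjI allI dH cH')
    show "\<exists>C. compact C \<and> C \<subseteq> UNIV \<and> (\<forall>z. z \<notin> C \<longrightarrow> H n z = 0)"
      using C1 H0 by (intro exI[of _ C1]) simp
  qed
  have tF: "test_function UNIV (\<lambda>z. F n z * \<eta> z) (\<lambda>z v. F n z * \<eta>' z v + F' n z v * \<eta> z)" for n
    using test_function_mult_C1[OF open_UNIV dF cF' t, of n] by simp
  have cop: "continuous_on UNIV (\<lambda>z. first_order_op a b (\<eta>' z))"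
    and copF: "continuous_on UNIV (\<lambda>z. first_order_op a b (F' n z))" for n
    by (rule continuous_first_order_op[OF c\<eta>'], rule continuous_first_order_op[OF cF'])
  have op0: "first_order_op a b (\<eta>' z) = 0" if "z \<notin> C" for z
    using C0(2)[OF that] by (simp add: first_order_op_def)

  \<comment> \<open>the weak derivative of \<open>g\<close>, tested against \<open>F n * \<eta>\<close>\<close>
  have step1: "(LINT z|lebesgue. g z * (F n z * first_order_op a b (\<eta>' z)))
     = - (LINT z|lebesgue. q z * (F n z * \<eta> z)) - (LINT z|lebesgue. g\<eta> z * first_order_op a b (F' n z))" for n
  proof -
    have i1: "integrable lebesgue (\<lambda>z. g z * (F n z * first_order_op a b (\<eta>' z)))"
      by (rule integrable_compact_support[OF continuous_on_mult[OF g continuous_on_mult[OF cF cop]] C(1)])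
         (simp add: op0)
    have i2: "integrable lebesgue (\<lambda>z. g\<eta> z * first_order_op a b (F' n z))"
      by (rule integrable_compact_support[OF continuous_on_mult[OF cg\<eta> copF] C(1)]) (simp add: g\<eta>0)
    have "(LINT z|lebesgue. g z * (F n z * first_order_op a b (\<eta>' z))) + (LINT z|lebesgue. g\<eta> z * first_order_op a b (F' n z))
      = (LINT z|lebesgue. g z * (F n z * first_order_op a b (\<eta>' z)) + g\<eta> z * first_order_op a b (F' n z))"
      by (rule Bochner_Integration.integral_add[OF i1 i2, symmetric])
    also have "\<dots> = (LINT z|lebesgue. g z * first_order_op a b (\<lambda>v. F n z * \<eta>' z v + F' n z v * \<eta> z))"
      by (rule Bochner_Integration.integral_cong) (auto simp: first_order_op_def g\<eta>_def algebra_simps)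
    also have "\<dots> = - (LINT z|lebesgue. q z * (F n z * \<eta> z))"
      using wg tF[of n] unfolding weak_op_on_def by blast
    finally show ?thesis by (simp add: algebra_simps)
  qed

  \<comment> \<open>by Fubini and evenness of the kernel, the convolution moves from \<open>f\<close> to \<open>g * \<eta>\<close>\<close>
  have step2: "(LINT z|lebesgue. g\<eta> z * first_order_op a b (F' n z)) = (LINT w|lebesgue. p w * H n w)" for n
  proof -
    define G where "G z w = g\<eta> z * (f w * first_order_op a b (\<kappa>' n (z - w)))" for z w
    have c\<kappa>: "continuous_on UNIV (\<lambda>z. \<kappa>' n z v)" for v by (rule test_function_deriv_continuous[OF tk])
    have ck: "continuous_on UNIV (\<lambda>w. \<kappa>' n (z - w) v)" for z v
      by (rule continuous_on_compose2[OF c\<kappa>]) (auto intro!: continuous_intros)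
    obtain B where B: "compact B" and B0: "\<And>z. z \<notin> B \<Longrightarrow> \<kappa> n z = 0" "\<And>z v. z \<notin> B \<Longrightarrow> \<kappa>' n z v = 0"
      and "B \<subseteq> cball 0 (inverse (real (Suc n)))"
      by (rule test_function_supportE[OF tk[of n]]) (rule that)
    have i1: "integrable lebesgue (\<lambda>w. f w * \<kappa>' n (z - w) v)" for z v
    proof (rule integrable_compact_support[OF continuous_on_mult[OF f ck]])
      show "compact ((\<lambda>x. z - x) ` B)"
        by (rule compact_continuous_image[OF _ B]) (intro continuous_intros)
      fix w assume "w \<notin> (\<lambda>x. z - x) ` B"
      then have "z - w \<notin> B" using image_eqI[of w "\<lambda>x. z - x" "z - w" B] by auto
      then show "f w * \<kappa>' n (z - w) v = 0" by (simp add: B0)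
    qed
    have i2: "integrable lebesgue (\<lambda>z. g\<eta> z * \<kappa>' n (w - z) v)" for w v
      by (rule integrable_compact_support[OF continuous_on_mult[OF cg\<eta> ck] C(1)]) (simp add: g\<eta>0)
    have "g\<eta> z * first_order_op a b (F' n z) = (LINT w|lebesgue. G z w)" for z
    proof -
      have "first_order_op a b (F' n z) = (LINT w|lebesgue. a * (f w * \<kappa>' n (z - w) 1) + b * (f w * \<kappa>' n (z - w) \<i>))"
        unfolding first_order_op_def F'_def using i1 by simp
      also have "\<dots> = (LINT w|lebesgue. f w * first_order_op a b (\<kappa>' n (z - w)))"
        by (rule Bochner_Integration.integral_cong) (auto simp: first_order_op_def algebra_simps)
      finally show ?thesis unfolding G_def by simp
    qed
    then have "(LINT z|lebesgue. g\<eta> z * first_order_op a b (F' n z)) = (LINT z|lebesgue. LINT w|lebesgue. G z w)"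
      by simp
    also have "\<dots> = (LINT w|lebesgue. LINT z|lebesgue. G z w)"
    proof (rule fubini_compact_support[OF _ C(1) C1])
      define K where "K x = first_order_op a b (\<kappa>' n x)" for x
      have cK: "continuous_on UNIV K" unfolding K_def by (rule continuous_first_order_op[OF c\<kappa>])
      have "continuous_on UNIV (\<lambda>p. g\<eta> (fst p) * (f (snd p) * K (fst p - snd p)))"
        by (intro continuous_on_mult continuous_on_compose2[OF cg\<eta>] continuous_on_compose2[OF f]
            continuous_on_compose2[OF cK]
            continuous_on_diff continuous_on_fst continuous_on_snd continuous_on_id subset_UNIV)
      then show "continuous_on UNIV (\<lambda>(x, y). G x y)"
        unfolding G_def K_def case_prod_unfold .
      show "G x y = 0" if "x \<notin> C \<or> y \<notin> C1" for x y
      proof (cases "x \<in> C")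
        case True
        then have "\<kappa>' n (x - y) v = 0" for v
          using \<kappa>0(2)[of y x n v] odd[of n "y - x" v] that by simp
        then show ?thesis unfolding G_def first_order_op_def by simp
      qed (simp add: G_def g\<eta>0)
    qed
    also have "\<dots> = (LINT w|lebesgue. - (f w * first_order_op a b (H' n w)))"
    proof (rule Bochner_Integration.integral_cong[OF refl])
      fix w
      have "first_order_op a b (H' n w) = (LINT z|lebesgue. a * (g\<eta> z * \<kappa>' n (w - z) 1) + b * (g\<eta> z * \<kappa>' n (w - z) \<i>))"
        unfolding first_order_op_def H'_def using i2 by simp
      then have "- (f w * first_order_op a b (H' n w)) = (LINT z|lebesgue. (- f w) * (a * (g\<eta> z * \<kappa>' n (w - z) 1) + b * (g\<eta> z * \<kappa>' n (w - z) \<i>)))"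
        by simp
      also have "\<dots> = (LINT z|lebesgue. G z w)"
      proof (rule Bochner_Integration.integral_cong[OF refl])
        fix z
        have "\<kappa>' n (w - z) v = - \<kappa>' n (z - w) v" for v using odd[of n "z - w" v] by simp
        then show "(- f w) * (a * (g\<eta> z * \<kappa>' n (w - z) 1) + b * (g\<eta> z * \<kappa>' n (w - z) \<i>)) = G z w"
          unfolding G_def first_order_op_def by (simp add: algebra_simps)
      qed
      finally show "(LINT z|lebesgue. G z w) = - (f w * first_order_op a b (H' n w))" ..
    qed
    also have "\<dots> = (LINT w|lebesgue. p w * H n w)"
      using wf tH[of n] unfolding weak_op_on_def by simp
    finally show ?thesis .
  qed

  have lim1: "(\<lambda>n. LINT z|lebesgue. g z * (F n z * first_order_op a b (\<eta>' z))) \<longlonglongrightarrow>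
       (LINT z|lebesgue. g z * (f z * first_order_op a b (\<eta>' z)))"
  proof (rule integral_mult_uniform_limit[OF locally_integrable_continuous[OF g] C(1)])
    show "uniform_limit C (\<lambda>n z. F n z * first_order_op a b (\<eta>' z)) (\<lambda>z. f z * first_order_op a b (\<eta>' z)) sequentially"
    proof (rule uniform_lim_mult[OF _ uniform_limit_const])
      show "uniform_limit C F f sequentially"
        using convolve_uniform_limit[OF f m C(1)] unfolding F_def by simp
    qed (intro compact_imp_bounded compact_continuous_image C(1) continuous_on_subset[OF f] continuous_on_subset[OF cop] subset_UNIV)+
  qed (intro continuous_on_mult cF f cop | simp add: op0)+
  have lim2: "(\<lambda>n. LINT z|lebesgue. q z * (F n z * \<eta> z)) \<longlonglongrightarrow> (LINT z|lebesgue. q z * (f z * \<eta> z))"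
  proof (rule integral_mult_uniform_limit[OF q C(1)])
    show "uniform_limit C (\<lambda>n z. F n z * \<eta> z) (\<lambda>z. f z * \<eta> z) sequentially"
    proof (rule uniform_lim_mult[OF _ uniform_limit_const])
      show "uniform_limit C F f sequentially"
        using convolve_uniform_limit[OF f m C(1)] unfolding F_def by simp
    qed (intro compact_imp_bounded compact_continuous_image C(1) continuous_on_subset[OF f] continuous_on_subset[OF c\<eta>] subset_UNIV)+
  qed (intro continuous_on_mult cF f c\<eta> | simp add: C0)+
  have lim3: "(\<lambda>n. LINT z|lebesgue. p z * H n z) \<longlonglongrightarrow> (LINT z|lebesgue. p z * g\<eta> z)"
  proof (rule integral_mult_uniform_limit[OF p C1 cH cg\<eta>])
    show "uniform_limit C1 H g\<eta> sequentially"
      using convolve_uniform_limit[OF cg\<eta> m C1] unfolding H_def by simp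
    show "g\<eta> z = 0" if "z \<notin> C1" for z using g\<eta>0 that CC1 by blast
  qed (rule H0)
  have "(LINT z|lebesgue. g z * (f z * first_order_op a b (\<eta>' z)))
     = - (LINT z|lebesgue. q z * (f z * \<eta> z)) - (LINT z|lebesgue. p z * g\<eta> z)"
    using LIMSEQ_unique[OF lim1[unfolded step1 step2] tendsto_diff[OF tendsto_minus[OF lim2] lim3]] .
  also have "\<dots> = - ((LINT z|lebesgue. p z * g\<eta> z) + (LINT z|lebesgue. q z * (f z * \<eta> z)))" by simp
  also have "(LINT z|lebesgue. p z * g\<eta> z) + (LINT z|lebesgue. q z * (f z * \<eta> z))
      = (LINT z|lebesgue. p z * g\<eta> z + q z * (f z * \<eta> z))"
  proof (rule Bochner_Integration.integral_add[symmetric])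
    show "integrable lebesgue (\<lambda>z. p z * g\<eta> z)"
      by (rule integrable_mult_compact_support[OF p cg\<eta> C(1)]) (rule g\<eta>0)
    show "integrable lebesgue (\<lambda>z. q z * (f z * \<eta> z))"
      by (rule integrable_mult_compact_support[OF q continuous_on_mult[OF f c\<eta>] C(1)]) (simp add: C0)
  qed
  finally show "(LINT z|lebesgue. f z * g z * first_order_op a b (\<eta>' z)) = - (LINT z|lebesgue. (g z * p z + f z * q z) * \<eta> z)"
    by (simp add: g\<eta>_def algebra_simps)
qed

lemma weak_op_add:
  assumes f: "continuous_on UNIV f" and g: "continuous_on UNIV g"
    and wf: "weak_op_on UNIV a b f p" and wg: "weak_op_on UNIV a b g q"
    and p: "locally_integrable p" and q: "locally_integrable q"
  shows "weak_op_on UNIV a b (\<lambda>z. f z + g z) (\<lambda>z. p z + q z)"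
  unfolding weak_op_on_def
proof (intro allI impI)
  fix \<eta> \<eta>' assume t: "test_function UNIV \<eta> \<eta>'"
  obtain C where C: "compact C" "C \<subseteq> UNIV" and C0: "\<And>z. z \<notin> C \<Longrightarrow> \<eta> z = 0" "\<And>z v. z \<notin> C \<Longrightarrow> \<eta>' z v = 0"
    by (rule test_function_supportE[OF t]) (rule that)
  have c\<eta>: "continuous_on UNIV \<eta>" by (rule test_function_continuous[OF t])
  have cop: "continuous_on UNIV (\<lambda>z. first_order_op a b (\<eta>' z))"
    by (rule continuous_first_order_op[OF test_function_deriv_continuous[OF t]])
  have op0: "first_order_op a b (\<eta>' z) = 0" if "z \<notin> C" for z
    using C0(2)[OF that] by (simp add: first_order_op_def)
  have i: "integrable lebesgue (\<lambda>z. f z * first_order_op a b (\<eta>' z))"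
    "integrable lebesgue (\<lambda>z. g z * first_order_op a b (\<eta>' z))"
    by (rule integrable_compact_support[OF continuous_on_mult[OF _ cop] C(1)], rule f g, simp add: op0)+
  have j: "integrable lebesgue (\<lambda>z. p z * \<eta> z)" "integrable lebesgue (\<lambda>z. q z * \<eta> z)"
    by (rule integrable_mult_compact_support[OF _ c\<eta> C(1)], rule p q, rule C0, assumption)+
  show "(LINT z|lebesgue. (f z + g z) * first_order_op a b (\<eta>' z)) = - (LINT z|lebesgue. (p z + q z) * \<eta> z)"
    using wf wg t i j unfolding weak_op_on_def by (simp add: distrib_right)
qed

section \<open>Polynomials of a weakly differentiable function and holomorphic substitution\<close>

text \<open>
  The integral of the translate \<open>\<eta> (w - z)\<close> over \<open>w\<close> does not depend on \<open>z\<close>; differentiate in \<open>z\<close>.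
\<close>

lemma lebesgue_integral_deriv_test_function:
  assumes t: "test_function UNIV \<eta> \<eta>'"
  shows "(LINT z|lebesgue. \<eta>' z v) = 0"
proof -
  have d\<eta>: "(\<eta> has_derivative \<eta>' z) (at z)" for z using t unfolding test_function_def by blast
  have lin: "\<eta>' x (- v) = - \<eta>' x v" for x v
    using linear_neg[OF has_derivative_linear[OF d\<eta>]] by blast
  obtain C where C: "compact C" "C \<subseteq> UNIV" and C0: "\<And>z. z \<notin> C \<Longrightarrow> \<eta> z = 0" "\<And>z v. z \<notin> C \<Longrightarrow> \<eta>' z v = 0"
    by (rule test_function_supportE[OF t]) (rule that)
  have t': "test_function UNIV (\<lambda>z. \<eta> (- z)) (\<lambda>z v. - \<eta>' (- z) v)"
    unfolding test_function_def
  proof (intro conjI allI)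
    fix z :: complex
    have "((\<lambda>w. - w) has_derivative (\<lambda>v. - v)) (at z)" by (auto intro!: derivative_eq_intros)
    from has_derivative_compose[OF this d\<eta>[of "- z"]]
    show "((\<lambda>z. \<eta> (- z)) has_derivative (\<lambda>v. - \<eta>' (- z) v)) (at z)" by (simp add: lin)
    have "continuous_on UNIV (\<lambda>z. \<eta>' (- z) v)" for v
      by (rule continuous_on_compose2[OF test_function_deriv_continuous[OF t]]) (auto intro!: continuous_intros)
    then show "continuous_on UNIV (\<lambda>z. - \<eta>' (- z) v)" for v by (rule continuous_on_minus)
    have "compact (uminus ` C)" by (rule compact_negations[OF C(1)])
    moreover have "\<eta> (- z) = 0" if "z \<notin> uminus ` C" for z
      using that C0(1)[of "- z"] by (metis image_eqI minus_minus)
    ultimately show "\<exists>C. compact C \<and> C \<subseteq> UNIV \<and> (\<forall>z. z \<notin> C \<longrightarrow> \<eta> (- z) = 0)" by blast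
  qed
  define F where "F z = (LINT w|lebesgue. \<eta> (w - z))" for z
  define G where "G v = (LINT w|lebesgue. - \<eta>' (w - 0) v)" for v
  have "(F has_derivative G) (at 0)"
    using convolution_has_derivative[OF continuous_on_const[of UNIV 1] t', of 0]
    unfolding F_def G_def by simp
  moreover have "F = (\<lambda>_. F 0)"
    unfolding F_def using lebesgue_integral_translate[OF test_function_continuous[OF t]] by simp
  ultimately have "G = (\<lambda>_. 0)" using has_derivative_const has_derivative_unique by metis
  then have "G v = 0" by simp
  then show ?thesis unfolding G_def by simp
qed

lemma weak_op_const: "weak_op_on UNIV a b (\<lambda>_. c) (\<lambda>_. 0)"
  unfolding weak_op_on_def
proof (intro allI impI)
  fix \<eta> \<eta>' assume t: "test_function UNIV \<eta> \<eta>'"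
  obtain C where C: "compact C" "C \<subseteq> UNIV" and C0: "\<And>z. z \<notin> C \<Longrightarrow> \<eta> z = 0" "\<And>z v. z \<notin> C \<Longrightarrow> \<eta>' z v = 0"
    by (rule test_function_supportE[OF t]) (rule that)
  have i: "integrable lebesgue (\<lambda>z. \<eta>' z v)" for v
    by (rule integrable_compact_support[OF test_function_deriv_continuous[OF t] C(1)]) (rule C0)
  have "(LINT z|lebesgue. c * first_order_op a b (\<eta>' z)) = c * (a * (LINT z|lebesgue. \<eta>' z 1) + b * (LINT z|lebesgue. \<eta>' z \<i>))"
    unfolding first_order_op_def using i by simp
  then show "(LINT z|lebesgue. c * first_order_op a b (\<eta>' z)) = - (LINT z|lebesgue. 0 * \<eta> z)"
    by (simp add: lebesgue_integral_deriv_test_function[OF t])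
qed

text \<open>
  Horner's scheme reduces this chain rule to the product rule.
\<close>

lemma weak_op_poly:
  assumes f: "continuous_on UNIV f" and w: "weak_op_on UNIV a b f p" and p: "locally_integrable p"
  shows "weak_op_on UNIV a b (\<lambda>z. poly F (f z)) (\<lambda>z. poly (pderiv F) (f z) * p z)"
proof (induction F)
  case 0
  then show ?case using weak_op_const[of a b 0] by simp
next
  case (pCons c F)
  have cF: "continuous_on UNIV (\<lambda>z. poly F (f z))" and cF': "continuous_on UNIV (\<lambda>z. poly (pderiv F) (f z))"
    by (intro continuous_intros f)+
  have lF: "locally_integrable (\<lambda>z. poly (pderiv F) (f z) * p z)"
    by (rule locally_integrable_mult_continuous[OF p cF'])
  have l1: "locally_integrable (\<lambda>z. poly F (f z) * p z + f z * (poly (pderiv F) (f z) * p z))"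
    by (intro locally_integrable_add locally_integrable_mult_continuous p lF f cF)
  have 1: "weak_op_on UNIV a b (\<lambda>z. f z * poly F (f z)) (\<lambda>z. poly F (f z) * p z + f z * (poly (pderiv F) (f z) * p z))"
    by (rule weak_op_mult[OF f cF w pCons.IH p lF])
  have l0: "locally_integrable (\<lambda>_. 0)" by (rule locally_integrable_continuous) simp
  have "weak_op_on UNIV a b (\<lambda>z. c + f z * poly F (f z)) (\<lambda>z. 0 + (poly F (f z) * p z + f z * (poly (pderiv F) (f z) * p z)))"
    by (rule weak_op_add[OF _ continuous_on_mult[OF f cF] weak_op_const 1 l0 l1]) simp
  then show ?case by (simp add: pderiv_pCons algebra_simps)
qed

text \<open>
  The change-of-variables theorem lives on \<open>real ^ 'm\<close>; this isometry carries it to the complex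
  plane.
\<close>

definition to_vec2 :: "complex \<Rightarrow> real^2" where "to_vec2 z = vector [Re z, Im z]"
definition of_vec2 :: "real^2 \<Rightarrow> complex" where "of_vec2 x = Complex (x $ 1) (x $ 2)"

lemma of_to_vec2 [simp]: "of_vec2 (to_vec2 z) = z"
  by (simp add: of_vec2_def to_vec2_def)

lemma to_of_vec2 [simp]: "to_vec2 (of_vec2 x) = x"
  by (simp add: of_vec2_def to_vec2_def vec_eq_iff forall_2)

lemma linear_to_vec2: "linear to_vec2"
  by (rule linearI) (auto simp: to_vec2_def vec_eq_iff forall_2)

lemma linear_of_vec2: "linear of_vec2"
  by (rule linearI) (auto simp: of_vec2_def complex_eq_iff)

lemma of_vec2_cbox: "of_vec2 ` cbox u v = cbox (of_vec2 u) (of_vec2 v)"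
proof
  show "of_vec2 ` cbox u v \<subseteq> cbox (of_vec2 u) (of_vec2 v)"
    by (auto simp: of_vec2_def mem_box_cart in_cbox_complex_iff)
  show "cbox (of_vec2 u) (of_vec2 v) \<subseteq> of_vec2 ` cbox u v"
  proof
    fix z assume z: "z \<in> cbox (of_vec2 u) (of_vec2 v)"
    have "to_vec2 z \<in> cbox u v"
      using z by (auto simp: mem_box_cart forall_2 in_cbox_complex_iff of_vec2_def to_vec2_def)
    then show "z \<in> of_vec2 ` cbox u v" by (metis image_eqI of_to_vec2)
  qed
qed

lemma to_vec2_cbox: "to_vec2 ` cbox a b = cbox (to_vec2 a) (to_vec2 b)"
proof -
  have "to_vec2 ` (of_vec2 ` cbox (to_vec2 a) (to_vec2 b)) = cbox (to_vec2 a) (to_vec2 b)"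
    by (simp add: image_comp o_def)
  then show ?thesis by (simp add: of_vec2_cbox)
qed

lemma content_of_vec2_cbox: "measure lborel (of_vec2 ` cbox u v) = measure lborel (cbox u v)"
proof (cases "cbox u v = {}")
  case False
  then have ne: "cbox (of_vec2 u) (of_vec2 v) \<noteq> {}" by (simp flip: of_vec2_cbox)
  have "measure lborel (cbox (of_vec2 u) (of_vec2 v)) = (v$1 - u$1) * (v$2 - u$2)"
    by (subst content_cbox'[OF ne]) (auto simp: Basis_complex_def of_vec2_def)
  also have "\<dots> = measure lborel (cbox u v)"
    using False by (subst content_cbox_cart) (auto simp: UNIV_2)
  finally show ?thesis by (simp add: of_vec2_cbox)
qed simp

lemma has_integral_to_vec2:
  assumes h: "(h has_integral i) K" and K: "bounded K"
  shows "((\<lambda>x. to_vec2 (h (of_vec2 x))) has_integral to_vec2 i) (to_vec2 ` K)"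
proof -
  obtain b where b: "K \<subseteq> cbox (- b) b" using bounded_subset_cbox_symmetric[OF K] by blast
  have 1: "((\<lambda>z. if z \<in> K then h z else 0) has_integral i) (cbox (- b) b)"
    using h has_integral_restrict[OF b] by blast
  have "((\<lambda>x. if of_vec2 x \<in> K then h (of_vec2 x) else 0) has_integral (1 / 1) *\<^sub>R i) (to_vec2 ` cbox (- b) b)"
  proof (rule has_integral_twiddle[OF _ _ _ _ _ _ _ 1])
    show "isCont of_vec2 x" for x
      using linear_continuous_at linear_conv_bounded_linear linear_of_vec2 by blast
    show "\<exists>w z. of_vec2 ` cbox u v = cbox w z" for u v using of_vec2_cbox by blast
    show "\<exists>w z. to_vec2 ` cbox u v = cbox w z" for u v using to_vec2_cbox by blast
    show "measure lborel (of_vec2 ` cbox u v) = 1 * measure lborel (cbox u v)" for u v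
      by (simp add: content_of_vec2_cbox)
  qed auto
  moreover have "of_vec2 x \<in> K \<longleftrightarrow> x \<in> to_vec2 ` K" for x
    by (metis image_iff of_to_vec2 to_of_vec2)
  ultimately have "((\<lambda>x. if x \<in> to_vec2 ` K then h (of_vec2 x) else 0) has_integral i) (to_vec2 ` cbox (- b) b)"
    by simp
  then have "((\<lambda>x. h (of_vec2 x)) has_integral i) (to_vec2 ` K)"
    using has_integral_restrict[OF image_mono[OF b]] by blast
  from has_integral_linear[OF this, of to_vec2] show ?thesis
    using linear_to_vec2 by (simp add: o_def linear_conv_bounded_linear)
qed

text \<open>
  Multiplication by \<open>c\<close> scales areas by the square of \<open>norm c\<close>.
\<close>

lemma det_complex_mult: "det (matrix (\<lambda>v. to_vec2 (c * of_vec2 v))) = (norm c)\<^sup>2"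
  by (simp add: det_2 matrix_def axis_def to_vec2_def of_vec2_def cmod_power2) (simp add: power2_eq_square)

lemma absolutely_integrable_continuous_compact:
  fixes f :: "'a::euclidean_space \<Rightarrow> 'b::euclidean_space"
  assumes "compact S" "continuous_on S f"
  shows "f absolutely_integrable_on S"
proof -
  have i: "integrable lborel (\<lambda>x. indicator S x *\<^sub>R f x)"
    by (rule borel_integrable_compact[OF assms])
  then have "integrable (completion lborel) (\<lambda>x. indicator S x *\<^sub>R f x)"
    by (subst integrable_completion[OF borel_measurable_integrable])
  then show ?thesis unfolding set_integrable_def .
qed

text \<open>
  The preimage of \<open>C\<close> under the injective map \<open>P\<close> is compact, so both integrands are continuous on
  compact sets and the theorem for \<open>real ^ 2\<close> applies to them.
\<close>

lemma lebesgue_integral_holomorphic_substitution: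
  fixes G :: "complex \<Rightarrow> complex"
  assumes B: "open B" and P: "P holomorphic_on B" and inj: "inj_on P B"
    and C: "compact C" "C \<subseteq> P ` B" and G: "continuous_on C G" and G0: "\<And>w. w \<notin> C \<Longrightarrow> G w = 0"
  shows "(LINT w|lebesgue. G w) =
         (LINT z|lebesgue. (if z \<in> B then of_real ((norm (deriv P z))\<^sup>2) * G (P z) else 0))"
proof -
  obtain S where S: "S holomorphic_on P ` B" and SP: "\<And>z. z \<in> B \<Longrightarrow> S (P z) = z"
    using holomorphic_has_inverse[OF P B inj] by metis
  define K where "K = S ` C"
  have K: "compact K" unfolding K_def
    by (rule compact_continuous_image[OF continuous_on_subset[OF holomorphic_on_imp_continuous_on[OF S] C(2)] C(1)])
  have KB: "K \<subseteq> B" unfolding K_def using C(2) SP by auto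
  have PK: "P ` K = C" unfolding K_def using C(2) SP by (force simp: image_iff)
  have K_iff: "P z \<in> C \<longleftrightarrow> z \<in> K" if "z \<in> B" for z
    using that PK KB inj by (metis image_eqI inj_on_image_mem_iff)
  define J where "J z = complex_of_real ((norm (deriv P z))\<^sup>2) * G (P z)" for z
  have cP: "continuous_on K P" using P KB continuous_on_subset holomorphic_on_imp_continuous_on by blast
  have cJ: "continuous_on K J"
    unfolding J_def
  proof (intro continuous_intros)
    show "continuous_on K (deriv P)"
      using holomorphic_deriv[OF P B] KB continuous_on_subset holomorphic_on_imp_continuous_on by blast
    show "continuous_on K (\<lambda>z. G (P z))"
      by (rule continuous_on_compose2[OF G cP]) (simp add: PK)
  qed
  have aG: "G absolutely_integrable_on C" by (rule absolutely_integrable_continuous_compact[OF C(1) G])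
  have aJ: "J absolutely_integrable_on K" by (rule absolutely_integrable_continuous_compact[OF K cJ])
  have iG: "(G has_integral integral C G) C"
    using aG by (simp add: absolutely_integrable_on_def integrable_integral)
  have iJ: "(J has_integral integral K J) K"
    using aJ by (simp add: absolutely_integrable_on_def integrable_integral)
  have 1: "(\<lambda>w. indicator C w *\<^sub>R G w) = G" using G0 by (auto simp: fun_eq_iff indicator_def)
  have LG: "(LINT w|lebesgue. G w) = integral C G"
    using set_lebesgue_integral_eq_integral(2)[OF aG] unfolding set_lebesgue_integral_def 1 .
  have 2: "(\<lambda>z. indicator K z *\<^sub>R J z) = (\<lambda>z. if z \<in> B then J z else 0)"
  proof
    fix z show "indicator K z *\<^sub>R J z = (if z \<in> B then J z else 0)"
    proof (cases "z \<in> K")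
      case True then show ?thesis using KB by auto
    next
      case False
      then have "z \<in> B \<Longrightarrow> J z = 0" unfolding J_def using K_iff G0 by simp
      then show ?thesis using False by simp
    qed
  qed
  have LJ: "(LINT z|lebesgue. (if z \<in> B then J z else 0)) = integral K J"
    using set_lebesgue_integral_eq_integral(2)[OF aJ] unfolding set_lebesgue_integral_def 2 .
  define g where "g x = to_vec2 (P (of_vec2 x))" for x
  define g' where "g' x v = to_vec2 (deriv P (of_vec2 x) * of_vec2 v)" for x v
  define f0 where "f0 x = to_vec2 (G (of_vec2 x))" for x
  have bl: "bounded_linear to_vec2" "bounded_linear of_vec2"
    using linear_to_vec2 linear_of_vec2 by (auto simp: linear_conv_bounded_linear)
  have det: "det (matrix (g' x)) = (norm (deriv P (of_vec2 x)))\<^sup>2" for x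
    unfolding g'_def[abs_def] by (rule det_complex_mult)
  have im: "g ` (to_vec2 ` K) = to_vec2 ` C"
    unfolding g_def PK[symmetric] by (simp add: image_comp o_def)
  have f0i: "f0 absolutely_integrable_on (g ` (to_vec2 ` K)) \<and> integral (g ` (to_vec2 ` K)) f0 = to_vec2 (integral C G)"
  proof
    show "integral (g ` (to_vec2 ` K)) f0 = to_vec2 (integral C G)"
      unfolding im f0_def
      by (rule integral_unique[OF has_integral_to_vec2[OF iG compact_imp_bounded[OF C(1)]]])
    have "continuous_on (to_vec2 ` C) f0"
      unfolding f0_def
      by (intro continuous_on_compose2[OF linear_continuous_on[OF bl(1)]] continuous_on_compose2[OF G]
            linear_continuous_on[OF bl(2)]) auto
    moreover have "compact (to_vec2 ` C)"
      by (rule compact_continuous_image[OF linear_continuous_on[OF bl(1)] C(1)])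
    ultimately show "f0 absolutely_integrable_on (g ` (to_vec2 ` K))"
      unfolding im by (rule absolutely_integrable_continuous_compact[rotated])
  qed
  have "integral (to_vec2 ` K) (\<lambda>x. \<bar>det (matrix (g' x))\<bar> *\<^sub>R f0 (g x)) = to_vec2 (integral C G)"
  proof (rule conjunct2, rule has_absolute_integral_change_of_variables_compact[THEN iffD2, OF _ _ _ f0i])
    show "compact (to_vec2 ` K)"
      by (rule compact_continuous_image[OF linear_continuous_on[OF bl(1)] K])
    show "inj_on g (to_vec2 ` K)"
    proof (rule inj_onI)
      fix x y assume xy: "x \<in> to_vec2 ` K" "y \<in> to_vec2 ` K" "g x = g y"
      then have "P (of_vec2 x) = P (of_vec2 y)" unfolding g_def by (metis of_to_vec2)
      moreover have "of_vec2 x \<in> B" "of_vec2 y \<in> B" using xy KB by auto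
      ultimately have "of_vec2 x = of_vec2 y" using inj by (metis inj_onD)
      then show "x = y" by (metis to_of_vec2)
    qed
    fix x assume "x \<in> to_vec2 ` K"
    then have "of_vec2 x \<in> B" using KB by auto
    then have "(P has_field_derivative deriv P (of_vec2 x)) (at (of_vec2 x))"
      using P B holomorphic_derivI by blast
    then have dP: "(P has_derivative (*) (deriv P (of_vec2 x))) (at (of_vec2 x))"
      unfolding has_field_derivative_def .
    have "((\<lambda>x. P (of_vec2 x)) has_derivative (\<lambda>v. deriv P (of_vec2 x) * of_vec2 v)) (at x)"
      by (rule has_derivative_compose[OF bounded_linear_imp_has_derivative[OF bl(2)] dP])
    from has_derivative_compose[OF this bounded_linear_imp_has_derivative[OF bl(1)]]
    show "(g has_derivative g' x) (at x within to_vec2 ` K)"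
      unfolding g_def[abs_def] g'_def[abs_def] by (rule has_derivative_at_withinI)
  qed
  moreover have "\<bar>det (matrix (g' x))\<bar> *\<^sub>R f0 (g x) = to_vec2 (J (of_vec2 x))" for x
  proof -
    have "to_vec2 (J (of_vec2 x)) = to_vec2 ((norm (deriv P (of_vec2 x)))\<^sup>2 *\<^sub>R G (P (of_vec2 x)))"
      unfolding J_def by (simp add: scaleR_conv_of_real)
    also have "\<dots> = (norm (deriv P (of_vec2 x)))\<^sup>2 *\<^sub>R to_vec2 (G (P (of_vec2 x)))"
      by (rule linear_scale[OF linear_to_vec2])
    finally show ?thesis unfolding det f0_def g_def by simp
  qed
  moreover have "integral (to_vec2 ` K) (\<lambda>x. to_vec2 (J (of_vec2 x))) = to_vec2 (integral K J)"
    by (rule integral_unique[OF has_integral_to_vec2[OF iJ compact_imp_bounded[OF K]]])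
  ultimately have "to_vec2 (integral K J) = to_vec2 (integral C G)" by simp
  then have "integral K J = integral C G" by (metis of_to_vec2)
  then show ?thesis using LG LJ unfolding J_def by simp
qed

section \<open>Pulling test functions back by a conformal map\<close>

definition C1_on :: "complex set \<Rightarrow> (complex \<Rightarrow> complex) \<Rightarrow> bool" where
  "C1_on V m \<longleftrightarrow> (\<exists>m'. (\<forall>z\<in>V. (m has_derivative m' z) (at z)) \<and> (\<forall>v. continuous_on V (\<lambda>z. m' z v)))"

lemma C1_onI:
  assumes "\<And>z. z \<in> V \<Longrightarrow> (m has_derivative m' z) (at z)" "\<And>v. continuous_on V (\<lambda>z. m' z v)"
  shows "C1_on V m"
  using assms unfolding C1_on_def by blast

lemma C1_onE:
  assumes "C1_on V m"
  obtains m' where "\<And>z. z \<in> V \<Longrightarrow> (m has_derivative m' z) (at z)" "\<And>v. continuous_on V (\<lambda>z. m' z v)"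
  using assms unfolding C1_on_def by blast

lemma C1_on_subset: "C1_on V m \<Longrightarrow> W \<subseteq> V \<Longrightarrow> C1_on W m"
  unfolding C1_on_def by (meson continuous_on_subset subsetD)

lemma C1_on_continuous: "C1_on V m \<Longrightarrow> continuous_on V m"
  unfolding C1_on_def
  by (intro continuous_at_imp_continuous_on ballI) (metis has_derivative_continuous)

lemma C1_on_mult:
  assumes "C1_on V m" "C1_on V n" shows "C1_on V (\<lambda>z. m z * n z)"
proof -
  obtain m' where m: "\<And>z. z \<in> V \<Longrightarrow> (m has_derivative m' z) (at z)" "\<And>v. continuous_on V (\<lambda>z. m' z v)"
    by (rule C1_onE[OF assms(1)]) (rule that)
  obtain n' where n: "\<And>z. z \<in> V \<Longrightarrow> (n has_derivative n' z) (at z)" "\<And>v. continuous_on V (\<lambda>z. n' z v)"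
    by (rule C1_onE[OF assms(2)]) (rule that)
  show ?thesis
  proof (rule C1_onI)
    show "((\<lambda>z. m z * n z) has_derivative (\<lambda>v. m z * n' z v + m' z v * n z)) (at z)" if "z \<in> V" for z
      by (rule has_derivative_mult[OF m(1)[OF that] n(1)[OF that]])
    show "continuous_on V (\<lambda>z. m z * n' z v + m' z v * n z)" for v
      by (intro continuous_on_add continuous_on_mult m(2) n(2) C1_on_continuous assms)
  qed
qed

lemma C1_on_diff:
  assumes "C1_on V m" "C1_on V n" shows "C1_on V (\<lambda>z. m z - n z)"
proof -
  obtain m' where m: "\<And>z. z \<in> V \<Longrightarrow> (m has_derivative m' z) (at z)" "\<And>v. continuous_on V (\<lambda>z. m' z v)"
    by (rule C1_onE[OF assms(1)]) (rule that)
  obtain n' where n: "\<And>z. z \<in> V \<Longrightarrow> (n has_derivative n' z) (at z)" "\<And>v. continuous_on V (\<lambda>z. n' z v)"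
    by (rule C1_onE[OF assms(2)]) (rule that)
  show ?thesis
  proof (rule C1_onI)
    show "((\<lambda>z. m z - n z) has_derivative (\<lambda>v. m' z v - n' z v)) (at z)" if "z \<in> V" for z
      by (rule has_derivative_diff[OF m(1)[OF that] n(1)[OF that]])
    show "continuous_on V (\<lambda>z. m' z v - n' z v)" for v
      by (intro continuous_on_diff m(2) n(2))
  qed
qed

lemma C1_on_inverse:
  assumes "C1_on V m" and nz: "\<And>z. z \<in> V \<Longrightarrow> m z \<noteq> 0" shows "C1_on V (\<lambda>z. inverse (m z))"
proof -
  obtain m' where m: "\<And>z. z \<in> V \<Longrightarrow> (m has_derivative m' z) (at z)" "\<And>v. continuous_on V (\<lambda>z. m' z v)"
    by (rule C1_onE[OF assms(1)]) (rule that)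
  show ?thesis
  proof (rule C1_onI)
    show "((\<lambda>z. inverse (m z)) has_derivative (\<lambda>v. - (inverse (m z) * m' z v * inverse (m z)))) (at z)" if "z \<in> V" for z
      by (rule Deriv.has_derivative_inverse[OF nz[OF that] m(1)[OF that]])
    show "continuous_on V (\<lambda>z. - (inverse (m z) * m' z v * inverse (m z)))" for v
      by (intro continuous_on_minus continuous_on_mult continuous_on_inverse m(2) C1_on_continuous[OF assms(1)] ballI nz)
  qed
qed

lemma C1_on_cnj:
  assumes "C1_on V m" shows "C1_on V (\<lambda>z. cnj (m z))"
proof -
  obtain m' where m: "\<And>z. z \<in> V \<Longrightarrow> (m has_derivative m' z) (at z)" "\<And>v. continuous_on V (\<lambda>z. m' z v)"
    by (rule C1_onE[OF assms(1)]) (rule that)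
  show ?thesis
  proof (rule C1_onI)
    show "((\<lambda>z. cnj (m z)) has_derivative (\<lambda>v. cnj (m' z v))) (at z)" if "z \<in> V" for z
      by (rule has_derivative_cnj[OF m(1)[OF that]])
    show "continuous_on V (\<lambda>z. cnj (m' z v))" for v
      by (intro continuous_on_cnj m(2))
  qed
qed

lemma C1_on_holomorphic:
  assumes V: "open V" and h: "h holomorphic_on V" shows "C1_on V h"
proof (rule C1_onI)
  show "(h has_derivative (*) (deriv h z)) (at z)" if "z \<in> V" for z
    using holomorphic_derivI[OF h V that] unfolding has_field_derivative_def .
  show "continuous_on V (\<lambda>z. deriv h z * v)" for v
    by (intro continuous_on_mult continuous_on_const holomorphic_on_imp_continuous_on holomorphic_deriv[OF h V])
qed

text \<open>
  Writing the real derivative of \<open>m\<close> in the basis \<open>1\<close>, \<open>\<i>\<close> makes the continuity of the composed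
  derivative evident.
\<close>

lemma C1_on_compose_holomorphic:
  assumes V: "open V" and h: "h holomorphic_on V" and im: "h ` V \<subseteq> W" and m: "C1_on W m"
  shows "C1_on V (\<lambda>z. m (h z))"
proof -
  obtain m' where m': "\<And>z. z \<in> W \<Longrightarrow> (m has_derivative m' z) (at z)" "\<And>v. continuous_on W (\<lambda>z. m' z v)"
    by (rule C1_onE[OF m]) (rule that)
  have ch: "continuous_on V h" by (rule holomorphic_on_imp_continuous_on[OF h])
  have cd: "continuous_on V (deriv h)" by (intro holomorphic_on_imp_continuous_on holomorphic_deriv[OF h V])
  show ?thesis
  proof (rule C1_onI)
    fix z assume z: "z \<in> V"
    have d: "(h has_derivative (*) (deriv h z)) (at z)"
      using holomorphic_derivI[OF h V z] unfolding has_field_derivative_def .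
    have hz: "h z \<in> W" using im z by blast
    have lin: "linear (m' (h z))" using has_derivative_linear[OF m'(1)[OF hz]] .
    have "((\<lambda>z. m (h z)) has_derivative (\<lambda>v. m' (h z) (deriv h z * v))) (at z)"
      by (rule has_derivative_compose[OF d m'(1)[OF hz]])
    then show "((\<lambda>z. m (h z)) has_derivative
       (\<lambda>v. Re (deriv h z * v) *\<^sub>R m' (h z) 1 + Im (deriv h z * v) *\<^sub>R m' (h z) \<i>)) (at z)"
      by (subst (asm) real_linear_complex[OF lin])
  next
    fix v
    show "continuous_on V (\<lambda>z. Re (deriv h z * v) *\<^sub>R m' (h z) 1 + Im (deriv h z * v) *\<^sub>R m' (h z) \<i>)"
      by (intro continuous_on_add continuous_on_scaleR continuous_on_Re continuous_on_Im continuous_on_mult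
          continuous_on_const cd continuous_on_compose2[OF m'(2) ch im])
  qed
qed

lemma test_function_C1_mult:
  assumes "open V" "C1_on V m" "test_function V \<eta> \<eta>'"
  obtains \<zeta>' where "test_function V (\<lambda>z. m z * \<eta> z) \<zeta>'"
proof -
  obtain m' where m: "\<And>z. z \<in> V \<Longrightarrow> (m has_derivative m' z) (at z)" "\<And>v. continuous_on V (\<lambda>z. m' z v)"
    by (rule C1_onE[OF assms(2)]) (rule that)
  from test_function_mult_C1[OF assms(1) m assms(3)] show thesis by (rule that)
qed

lemma test_function_pullback:
  assumes B: "open B" and P: "P holomorphic_on B" and inj: "inj_on P B"
    and t: "test_function (P ` B) \<zeta> \<zeta>'"
  shows "test_function B (\<lambda>z. if z \<in> B then \<zeta> (P z) else 0)
           (\<lambda>z v. if z \<in> B then \<zeta>' (P z) (deriv P z * v) else 0)"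
proof -
  obtain C where C: "compact C" "C \<subseteq> P ` B" and C0: "\<And>z. z \<notin> C \<Longrightarrow> \<zeta> z = 0" "\<And>z v. z \<notin> C \<Longrightarrow> \<zeta>' z v = 0"
    by (rule test_function_supportE[OF t]) (rule that)
  have d\<zeta>: "(\<zeta> has_derivative \<zeta>' z) (at z)" for z using t unfolding test_function_def by blast
  have lin: "linear (\<zeta>' z)" for z by (rule has_derivative_linear[OF d\<zeta>])
  obtain S where S: "S holomorphic_on P ` B" and SP: "\<And>z. z \<in> B \<Longrightarrow> S (P z) = z"
    using holomorphic_has_inverse[OF P B inj] by metis
  define K where "K = S ` C"
  have K: "compact K" unfolding K_def
    by (rule compact_continuous_image[OF continuous_on_subset[OF holomorphic_on_imp_continuous_on[OF S] C(2)] C(1)])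
  have KB: "K \<subseteq> B" unfolding K_def using C(2) SP by auto
  have PK: "P z \<notin> C" if "z \<in> B" "z \<notin> K" for z
    using that SP[OF that(1)] unfolding K_def by (metis image_eqI)
  have oK: "open (- K)" using K by (simp add: compact_imp_closed open_Compl)
  have cP: "continuous_on B P" by (rule holomorphic_on_imp_continuous_on[OF P])
  have cd: "continuous_on B (deriv P)" by (intro holomorphic_on_imp_continuous_on holomorphic_deriv[OF P B])
  show ?thesis
    unfolding test_function_def
  proof (intro conjI allI)
    fix z
    show "((\<lambda>z. if z \<in> B then \<zeta> (P z) else 0) has_derivative (\<lambda>v. if z \<in> B then \<zeta>' (P z) (deriv P z * v) else 0)) (at z)"
    proof (cases "z \<in> B")
      case True
      have d: "(P has_derivative (*) (deriv P z)) (at z)"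
        using holomorphic_derivI[OF P B True] unfolding has_field_derivative_def .
      have "((\<lambda>z. \<zeta> (P z)) has_derivative (\<lambda>v. \<zeta>' (P z) (deriv P z * v))) (at z)"
        by (rule has_derivative_compose[OF d d\<zeta>])
      then have "((\<lambda>z. if z \<in> B then \<zeta> (P z) else 0) has_derivative (\<lambda>v. \<zeta>' (P z) (deriv P z * v))) (at z)"
        by (rule has_derivative_transform_within_open[OF _ B True]) simp
      then show ?thesis using True by simp
    next
      case False
      then have z: "z \<in> - K" using KB by blast
      have "((\<lambda>_. 0 :: complex) has_derivative (\<lambda>_. 0)) (at z)" by simp
      then have "((\<lambda>z. if z \<in> B then \<zeta> (P z) else 0) has_derivative (\<lambda>_. 0)) (at z)"
        by (rule has_derivative_transform_within_open[OF _ oK z]) (use PK C0 in auto)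
      then show ?thesis using False by simp
    qed
  next
    fix v
    let ?F = "\<lambda>z. if z \<in> B then \<zeta>' (P z) (deriv P z * v) else 0"
    have "continuous_on B (\<lambda>z. Re (deriv P z * v) *\<^sub>R \<zeta>' (P z) 1 + Im (deriv P z * v) *\<^sub>R \<zeta>' (P z) \<i>)"
      by (intro continuous_on_add continuous_on_scaleR continuous_on_Re continuous_on_Im continuous_on_mult
          continuous_on_const cd continuous_on_compose2[OF test_function_deriv_continuous[OF t] cP subset_UNIV])
    then have 1: "continuous_on B ?F"
      by (rule continuous_on_eq) (simp add: real_linear_complex[OF lin, of _ "deriv P _ * v"])
    have 2: "continuous_on (- K) ?F"
      by (rule continuous_on_eq[of _ "\<lambda>_. 0"]) (use PK C0 in auto)
    have "continuous_on (B \<union> - K) ?F" by (rule continuous_on_open_Un[OF B oK 1 2])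
    moreover have "B \<union> - K = UNIV" using KB by blast
    ultimately show "continuous_on UNIV ?F" by simp
  next
    show "\<exists>C. compact C \<and> C \<subseteq> B \<and> (\<forall>z. z \<notin> C \<longrightarrow> (if z \<in> B then \<zeta> (P z) else 0) = 0)"
      using K KB PK C0 by (intro exI[of _ K]) auto
  qed
qed

lemma wirtinger_compose_mult:
  assumes "linear L"
  shows "wirtinger_z (\<lambda>v. L (c * v)) = wirtinger_z L * c"
    "wirtinger_zbar (\<lambda>v. L (c * v)) = wirtinger_zbar L * cnj c"
proof -
  have eqs: "L (c * 1) = Re c *\<^sub>R L 1 + Im c *\<^sub>R L \<i>" "L (c * \<i>) = - Im c *\<^sub>R L 1 + Re c *\<^sub>R L \<i>"
    using real_linear_complex[OF assms, of "c * 1"] real_linear_complex[OF assms, of "c * \<i>"] by simp_all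
  show "wirtinger_z (\<lambda>v. L (c * v)) = wirtinger_z L * c"
    "wirtinger_zbar (\<lambda>v. L (c * v)) = wirtinger_zbar L * cnj c"
    unfolding wirtinger_z_def wirtinger_zbar_def eqs
    by (simp_all add: complex_eq_iff algebra_simps add_divide_distrib diff_divide_distrib)
qed

lemma deriv_left_inverse:
  assumes B: "open B" and P: "P holomorphic_on B" and V: "open (P ` B)" and S: "S holomorphic_on P ` B"
    and SP: "\<And>z. z \<in> B \<Longrightarrow> S (P z) = z" and z: "z \<in> B"
  shows "deriv S (P z) * deriv P z = 1"
proof -
  have "((\<lambda>z. S (P z)) has_field_derivative deriv S (P z) * deriv P z) (at z)"
    using DERIV_chain2[OF holomorphic_derivI[OF S V] holomorphic_derivI[OF P B z]] z by blast
  then have "((\<lambda>z. z) has_field_derivative deriv S (P z) * deriv P z) (at z)"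
    by (rule has_field_derivative_transform_within_open[OF _ B z]) (rule SP)
  then show ?thesis using DERIV_ident DERIV_unique by blast
qed

text \<open>
  The substitution \<open>w = P z\<close> turns the left-hand sides into integrals of \<open>f\<close> against the Wirtinger
  derivatives of \<open>\<zeta>\<close>, multiplied by the derivative of the inverse branch \<open>S\<close> or by its conjugate. This
  factor is holomorphic, respectively antiholomorphic, so the Wirtinger derivative in question does not
  see it and it may be absorbed into the test function. In this form the weak derivatives \<open>p\<close> and
  \<open>q\<close> need not be composed with \<open>P\<close>.
\<close>

lemma weak_wirtinger_pullback:
  assumes f: "continuous_on UNIV f"
    and wp: "weak_op_on UNIV (1/2) (- \<i>/2) f p" and wq: "weak_op_on UNIV (1/2) (\<i>/2) f q"
    and B: "open B" and P: "P holomorphic_on B" and inj: "inj_on P B"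
    and S: "S holomorphic_on P ` B" and SP: "\<And>z. z \<in> B \<Longrightarrow> S (P z) = z"
    and t: "test_function (P ` B) \<zeta> \<zeta>'"
    and \<eta>': "\<And>z v. \<eta>' z v = (if z \<in> B then \<zeta>' (P z) (deriv P z * v) else 0)"
  shows "(LINT z|lebesgue. f (P z) * wirtinger_z (\<eta>' z)) = - (LINT w|lebesgue. p w * (cnj (deriv S w) * \<zeta> w))"
    and "(LINT z|lebesgue. f (P z) * wirtinger_zbar (\<eta>' z)) = - (LINT w|lebesgue. q w * (deriv S w * \<zeta> w))"
proof -
  let ?V = "P ` B"
  obtain C where C: "compact C" "C \<subseteq> ?V" and C0: "\<And>z. z \<notin> C \<Longrightarrow> \<zeta> z = 0" "\<And>z v. z \<notin> C \<Longrightarrow> \<zeta>' z v = 0"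
    by (rule test_function_supportE[OF t]) (rule that)
  have d\<zeta>: "(\<zeta> has_derivative \<zeta>' z) (at z)" for z using t unfolding test_function_def by blast
  have lin: "linear (\<zeta>' z)" for z by (rule has_derivative_linear[OF d\<zeta>])
  have V: "open ?V" by (rule open_mapping_thm3[OF P B inj])
  have S': "deriv S holomorphic_on ?V" by (rule holomorphic_deriv[OF S V])
  have dSP: "deriv S (P z) * deriv P z = 1" if "z \<in> B" for z
    by (rule deriv_left_inverse[OF B P V S SP that])
  have d1: "(deriv S has_derivative (*) (deriv (deriv S) z)) (at z)" if "z \<in> ?V" for z
    using holomorphic_derivI[OF S' V that] unfolding has_field_derivative_def .
  have c1: "continuous_on ?V (\<lambda>z. deriv (deriv S) z * v)" for v
    by (intro continuous_on_mult continuous_on_const holomorphic_on_imp_continuous_on holomorphic_deriv[OF S' V])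
  have d2: "((\<lambda>z. cnj (deriv S z)) has_derivative (\<lambda>v. cnj (deriv (deriv S) z * v))) (at z)" if "z \<in> ?V" for z
    by (rule has_derivative_cnj[OF d1[OF that]])
  have c2: "continuous_on ?V (\<lambda>z. cnj (deriv (deriv S) z * v))" for v
    by (intro continuous_on_cnj c1)
  have cS': "continuous_on C (deriv S)"
    using continuous_on_subset[OF holomorphic_on_imp_continuous_on[OF S'] C(2)] .
  have cz: "continuous_on C (\<lambda>w. wirtinger_z (\<zeta>' w))" "continuous_on C (\<lambda>w. wirtinger_zbar (\<zeta>' w))"
    unfolding wirtinger_z_eq wirtinger_zbar_eq
    by (rule continuous_first_order_op[OF continuous_on_subset[OF test_function_deriv_continuous[OF t] subset_UNIV]])+
  have fC: "continuous_on C f" by (rule continuous_on_subset[OF f subset_UNIV])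
  have w0: "wirtinger_z (\<zeta>' w) = 0" "wirtinger_zbar (\<zeta>' w) = 0" if "w \<notin> C" for w
    using C0(2)[OF that] by (simp_all add: wirtinger_z_def wirtinger_zbar_def)
  have e0: "\<eta>' z = (\<lambda>v. \<zeta>' (P z) (deriv P z * v))" if "z \<in> B" for z
    using \<eta>' that by auto
  have e1: "wirtinger_z (\<eta>' z) = 0" "wirtinger_zbar (\<eta>' z) = 0" if "z \<notin> B" for z
    using \<eta>'[of z] that by (simp_all add: wirtinger_z_def wirtinger_zbar_def)

  define G1 where "G1 w = f w * (wirtinger_z (\<zeta>' w) * cnj (deriv S w))" for w
  have "(LINT z|lebesgue. f (P z) * wirtinger_z (\<eta>' z)) =
      (LINT z|lebesgue. (if z \<in> B then of_real ((norm (deriv P z))\<^sup>2) * G1 (P z) else 0))"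
  proof (rule Bochner_Integration.integral_cong[OF refl])
    fix z
    show "f (P z) * wirtinger_z (\<eta>' z) = (if z \<in> B then of_real ((norm (deriv P z))\<^sup>2) * G1 (P z) else 0)"
    proof (cases "z \<in> B")
      case True
      have "of_real ((norm (deriv P z))\<^sup>2) * cnj (deriv S (P z)) = deriv P z * cnj (deriv S (P z) * deriv P z)"
        unfolding complex_norm_square by (simp add: mult_ac)
      also have "\<dots> = deriv P z" using dSP[OF True] by simp
      finally have "of_real ((norm (deriv P z))\<^sup>2) * G1 (P z) = f (P z) * (wirtinger_z (\<zeta>' (P z)) * deriv P z)"
        unfolding G1_def by (metis mult.assoc mult.left_commute)
      then show ?thesis using True by (simp add: e0 wirtinger_compose_mult[OF lin])
    qed (simp add: e1)
  qed
  also have "\<dots> = (LINT w|lebesgue. G1 w)"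
  proof (rule lebesgue_integral_holomorphic_substitution[OF B P inj C, symmetric])
    show "continuous_on C G1" unfolding G1_def
      by (intro continuous_on_mult fC cz continuous_on_cnj cS')
  qed (simp add: G1_def w0)
  also have "\<dots> = (LINT w|lebesgue. f w * first_order_op (1/2) (- \<i>/2)
      (\<lambda>v. if w \<in> ?V then cnj (deriv S w) * \<zeta>' w v + cnj (deriv (deriv S) w * v) * \<zeta> w else 0))"
  proof (rule Bochner_Integration.integral_cong[OF refl])
    fix w
    show "G1 w = f w * first_order_op (1/2) (- \<i>/2)
      (\<lambda>v. if w \<in> ?V then cnj (deriv S w) * \<zeta>' w v + cnj (deriv (deriv S) w * v) * \<zeta> w else 0)"
    proof (cases "w \<in> ?V")
      case True
      then show ?thesis unfolding G1_def wirtinger_z_def first_order_op_def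
        by (simp add: field_simps)
    next
      case False
      then have "w \<notin> C" using C(2) by blast
      then show ?thesis using False by (simp add: G1_def w0 first_order_op_def)
    qed
  qed
  also have "\<dots> = - (LINT w|lebesgue. p w * (cnj (deriv S w) * \<zeta> w))"
    using wp test_function_subset[OF test_function_mult_C1[OF V d2 c2 t] subset_UNIV]
    unfolding weak_op_on_def by blast
  finally show "(LINT z|lebesgue. f (P z) * wirtinger_z (\<eta>' z)) = - (LINT w|lebesgue. p w * (cnj (deriv S w) * \<zeta> w))" .

  define G2 where "G2 w = f w * (wirtinger_zbar (\<zeta>' w) * deriv S w)" for w
  have "(LINT z|lebesgue. f (P z) * wirtinger_zbar (\<eta>' z)) =
      (LINT z|lebesgue. (if z \<in> B then of_real ((norm (deriv P z))\<^sup>2) * G2 (P z) else 0))"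
  proof (rule Bochner_Integration.integral_cong[OF refl])
    fix z
    show "f (P z) * wirtinger_zbar (\<eta>' z) = (if z \<in> B then of_real ((norm (deriv P z))\<^sup>2) * G2 (P z) else 0)"
    proof (cases "z \<in> B")
      case True
      have "of_real ((norm (deriv P z))\<^sup>2) * deriv S (P z) = cnj (deriv P z) * (deriv S (P z) * deriv P z)"
        unfolding complex_norm_square by (simp add: mult_ac)
      also have "\<dots> = cnj (deriv P z)" using dSP[OF True] by simp
      finally have "of_real ((norm (deriv P z))\<^sup>2) * G2 (P z) = f (P z) * (wirtinger_zbar (\<zeta>' (P z)) * cnj (deriv P z))"
        unfolding G2_def by (metis mult.assoc mult.left_commute)
      then show ?thesis using True by (simp add: e0 wirtinger_compose_mult[OF lin])
    qed (simp add: e1)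
  qed
  also have "\<dots> = (LINT w|lebesgue. G2 w)"
  proof (rule lebesgue_integral_holomorphic_substitution[OF B P inj C, symmetric])
    show "continuous_on C G2" unfolding G2_def
      by (intro continuous_on_mult fC cz cS')
  qed (simp add: G2_def w0)
  also have "\<dots> = (LINT w|lebesgue. f w * first_order_op (1/2) (\<i>/2)
      (\<lambda>v. if w \<in> ?V then deriv S w * \<zeta>' w v + deriv (deriv S) w * v * \<zeta> w else 0))"
  proof (rule Bochner_Integration.integral_cong[OF refl])
    fix w
    show "G2 w = f w * first_order_op (1/2) (\<i>/2)
      (\<lambda>v. if w \<in> ?V then deriv S w * \<zeta>' w v + deriv (deriv S) w * v * \<zeta> w else 0)"
    proof (cases "w \<in> ?V")
      case True
      then show ?thesis unfolding G2_def wirtinger_zbar_def first_order_op_def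
        by (simp add: field_simps)
    next
      case False
      then have "w \<notin> C" using C(2) by blast
      then show ?thesis using False by (simp add: G2_def w0 first_order_op_def)
    qed
  qed
  also have "\<dots> = - (LINT w|lebesgue. q w * (deriv S w * \<zeta> w))"
    using wq test_function_subset[OF test_function_mult_C1[OF V d1 c1 t] subset_UNIV]
    unfolding weak_op_on_def by blast
  finally show "(LINT z|lebesgue. f (P z) * wirtinger_zbar (\<eta>' z)) = - (LINT w|lebesgue. q w * (deriv S w * \<zeta> w))" .
qed

section \<open>Invariance of a smooth Beltrami coefficient\<close>

text \<open>
  If \<open>p\<close> is orthogonal to all test functions on \<open>V\<close>, then so is \<open>q = \<mu> * p\<close>, since \<open>\<mu>\<close> times a test
  function is a test function. So \<open>f\<close> would be locally constant.
\<close>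

lemma continuous_injective_not_weakly_constant:
  assumes V: "open V" and z: "z \<in> V" and f: "continuous_on UNIV f" and inj: "inj f"
    and wp: "weak_op_on UNIV (1/2) (- \<i>/2) f p" and wq: "weak_op_on UNIV (1/2) (\<i>/2) f q"
    and \<mu>: "C1_on V \<mu>" and eq: "AE z in lebesgue. z \<in> V \<longrightarrow> q z = \<mu> z * p z"
    and p0: "\<And>\<eta> \<eta>'. test_function V \<eta> \<eta>' \<Longrightarrow> (LINT z|lebesgue. p z * \<eta> z) = 0"
    and p: "p \<in> borel_measurable lebesgue" and q: "q \<in> borel_measurable lebesgue"
  shows False
proof -
  have w1: "weak_op_on V (1/2) (- \<i>/2) f (\<lambda>_. 0)"
    unfolding weak_op_on_def
  proof (intro allI impI)
    fix \<eta> \<eta>' assume t: "test_function V \<eta> \<eta>'"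
    show "(LINT z|lebesgue. f z * first_order_op (1/2) (- \<i>/2) (\<eta>' z)) = - (LINT z|lebesgue. 0 * \<eta> z)"
      using wp test_function_subset[OF t subset_UNIV] p0[OF t] unfolding weak_op_on_def by simp
  qed
  have w2: "weak_op_on V (1/2) (\<i>/2) f (\<lambda>_. 0)"
    unfolding weak_op_on_def
  proof (intro allI impI)
    fix \<eta> \<eta>' assume t: "test_function V \<eta> \<eta>'"
    obtain \<zeta>' where t2: "test_function V (\<lambda>z. \<mu> z * \<eta> z) \<zeta>'"
      by (rule test_function_C1_mult[OF V \<mu> t]) (rule that)
    have \<eta>0: "\<eta> z = 0" if "z \<notin> V" for z using t that unfolding test_function_def by blast
    have m: "(\<lambda>z. p z * (\<mu> z * \<eta> z)) \<in> borel_measurable lebesgue" "(\<lambda>z. q z * \<eta> z) \<in> borel_measurable lebesgue"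
      by (intro borel_measurable_times p q continuous_lebesgue_measurable test_function_continuous[OF t2]
          test_function_continuous[OF t])+
    have "(LINT z|lebesgue. q z * \<eta> z) = (LINT z|lebesgue. p z * (\<mu> z * \<eta> z))"
    proof (rule integral_cong_AE[OF m(2) m(1)])
      show "AE z in lebesgue. q z * \<eta> z = p z * (\<mu> z * \<eta> z)"
        using eq
      proof (rule AE_mp, intro AE_I2 impI)
        fix z assume h: "z \<in> V \<longrightarrow> q z = \<mu> z * p z"
        show "q z * \<eta> z = p z * (\<mu> z * \<eta> z)"
          using h \<eta>0[of z] by (cases "z \<in> V") auto
      qed
    qed
    also have "\<dots> = 0" by (rule p0[OF t2])
    finally show "(LINT z|lebesgue. f z * first_order_op (1/2) (\<i>/2) (\<eta>' z)) = - (LINT z|lebesgue. 0 * \<eta> z)"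
      using wq test_function_subset[OF t subset_UNIV] unfolding weak_op_on_def by simp
  qed
  obtain r where r: "r > 0" "\<forall>w\<in>ball z r. f w = f z"
    using weak_ops_zero_imp_locally_constant[OF V f w1 w2 z] by blast
  have "z + of_real (r/2) \<in> ball z r" using r(1) by (simp add: dist_norm)
  then have "f (z + of_real (r/2)) = f z" using r(2) by blast
  then have "z + of_real (r/2) = z" using inj by (metis injD)
  then show False using r(1) by simp
qed

text \<open>
  The equation says that the Beltrami differential \<open>\<mu>\<close> is invariant under the polynomial \<open>P0\<close>. If
  it failed at \<open>z0\<close>, the function \<open>c\<close> below, the difference of the two sides in terms of the inverse
  branch \<open>S\<close>, would not vanish near \<open>poly P0 z0\<close>. But \<open>p * c\<close> is orthogonal to every test function,
  hence so is \<open>p\<close>.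
\<close>

lemma beltrami_coefficient_invariant:
  assumes U: "open U" and f: "continuous_on UNIV f" and inj: "inj f"
    and wp: "weak_op_on UNIV (1/2) (- \<i>/2) f p" and wq: "weak_op_on UNIV (1/2) (\<i>/2) f q"
    and p: "locally_integrable p" and q: "locally_integrable q"
    and pm: "p \<in> borel_measurable lebesgue" and qm: "q \<in> borel_measurable lebesgue"
    and eq: "AE z in lebesgue. z \<in> U \<longrightarrow> q z = \<mu> z * p z" and \<mu>: "C1_on U \<mu>"
    and conj: "\<And>z. f (poly P0 z) = poly P1 (f z)"
    and PU: "poly P0 ` U \<subseteq> U" and z0: "z0 \<in> U" and dP: "poly (pderiv P0) z0 \<noteq> 0"
  shows "\<mu> (poly P0 z0) * cnj (poly (pderiv P0) z0) = \<mu> z0 * poly (pderiv P0) z0"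
proof (rule ccontr)
  assume neq: "\<mu> (poly P0 z0) * cnj (poly (pderiv P0) z0) \<noteq> \<mu> z0 * poly (pderiv P0) z0"
  define P where "P = poly P0"
  have dPz: "deriv P z = poly (pderiv P0) z" for z unfolding P_def by (rule DERIV_imp_deriv[OF poly_DERIV])
  have hol: "P holomorphic_on A" for A
  proof (rule holomorphic_onI)
    fix z
    have "P field_differentiable at z"
      unfolding field_differentiable_def P_def using poly_DERIV by blast
    then show "P field_differentiable at z within A" by (rule field_differentiable_at_within)
  qed
  have nz: "deriv P z0 \<noteq> 0" using dP dPz by simp
  obtain r0 where r0: "r0 > 0" "inj_on P (ball z0 r0)"
    using has_complex_derivative_locally_injective[OF hol[of UNIV] UNIV_I open_UNIV nz] by blast
  obtain r1 where r1: "r1 > 0" "ball z0 r1 \<subseteq> U" using openE[OF U z0] by blast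
  define B where "B = ball z0 (min r0 r1)"
  have "B \<subseteq> ball z0 r0" "B \<subseteq> ball z0 r1" by (auto simp: B_def)
  then have B: "open B" "z0 \<in> B" "B \<subseteq> U" "inj_on P B"
    using r0 r1 inj_on_subset[OF r0(2)] by (auto simp: B_def)
  let ?V = "P ` B"
  have V: "open ?V" by (rule open_mapping_thm3[OF hol B(1) B(4)])
  have VU: "?V \<subseteq> U" using PU B(3) unfolding P_def by blast
  obtain S where S: "S holomorphic_on ?V" and SP: "\<And>z. z \<in> B \<Longrightarrow> S (P z) = z"
    using holomorphic_has_inverse[OF hol B(1) B(4)] by metis
  have SV: "S ` ?V \<subseteq> U" using SP B(3) by auto
  have S': "deriv S holomorphic_on ?V" by (rule holomorphic_deriv[OF S V])
  have dSP: "deriv S (P z) * deriv P z = 1" if "z \<in> B" for z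
    by (rule deriv_left_inverse[OF B(1) hol V S SP that])
  define m1 where "m1 w = cnj (deriv S w) * \<mu> (S w)" for w
  define m2 where "m2 w = \<mu> w * deriv S w" for w
  define c where "c w = m1 w - m2 w" for w
  have C\<mu>S: "C1_on ?V (\<lambda>w. \<mu> (S w))" by (rule C1_on_compose_holomorphic[OF V S SV \<mu>])
  have CS: "C1_on ?V (deriv S)" by (rule C1_on_holomorphic[OF V S'])
  have C\<mu>: "C1_on ?V \<mu>" by (rule C1_on_subset[OF \<mu> VU])
  have Cm1: "C1_on ?V m1" unfolding m1_def by (rule C1_on_mult[OF C1_on_cnj[OF CS] C\<mu>S])
  have Cm2: "C1_on ?V m2" unfolding m2_def by (rule C1_on_mult[OF C\<mu> CS])
  have Cc: "C1_on ?V c" unfolding c_def by (rule C1_on_diff[OF Cm1 Cm2])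

  have orth: "(LINT w|lebesgue. p w * (c w * \<zeta> w)) = 0" if t: "test_function ?V \<zeta> \<zeta>'" for \<zeta> \<zeta>'
  proof -
    define \<eta> where "\<eta> z = (if z \<in> B then \<zeta> (P z) else 0)" for z
    have t\<eta>: "test_function B \<eta> (\<lambda>z v. if z \<in> B then \<zeta>' (P z) (deriv P z * v) else 0)"
      unfolding \<eta>_def[abs_def] by (rule test_function_pullback[OF B(1) hol B(4) t])
    obtain \<xi>' where t2: "test_function ?V (\<lambda>w. \<mu> (S w) * \<zeta> w) \<xi>'"
      by (rule test_function_C1_mult[OF V C\<mu>S t]) (rule that)
    define \<theta> where "\<theta> z = (if z \<in> B then \<mu> (S (P z)) * \<zeta> (P z) else 0)" for z
    have t\<theta>: "test_function B \<theta> (\<lambda>z v. if z \<in> B then \<xi>' (P z) (deriv P z * v) else 0)"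
      unfolding \<theta>_def[abs_def] by (rule test_function_pullback[OF B(1) hol B(4) t2])
    define a where "a z = poly (pderiv P1) (f z)" for z
    have ca: "continuous_on UNIV a" unfolding a_def[abs_def] by (intro continuous_intros f)
    \<comment> \<open>the composite \<open>poly P1 \<circ> f = f \<circ> P\<close>, differentiated in two ways\<close>
    have E1: "(LINT w|lebesgue. q w * (deriv S w * \<zeta> w)) = (LINT z|lebesgue. a z * q z * \<eta> z)"
    proof -
      let ?\<eta>' = "\<lambda>z v. if z \<in> B then \<zeta>' (P z) (deriv P z * v) else 0"
      have "- (LINT w|lebesgue. q w * (deriv S w * \<zeta> w)) = (LINT z|lebesgue. f (P z) * wirtinger_zbar (?\<eta>' z))"
        by (rule weak_wirtinger_pullback(2)[OF f wp wq B(1) hol B(4) S SP t refl, symmetric])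
      also have "\<dots> = (LINT z|lebesgue. poly P1 (f z) * wirtinger_zbar (?\<eta>' z))"
        by (simp only: P_def conj)
      also have "\<dots> = - (LINT z|lebesgue. a z * q z * \<eta> z)"
        using weak_op_poly[OF f wq q, of P1] test_function_subset[OF t\<eta> subset_UNIV]
        unfolding weak_op_on_def wirtinger_zbar_eq a_def by blast
      finally show ?thesis by simp
    qed
    \<comment> \<open>\<open>\<zeta>\<close> is multiplied by \<open>\<mu> \<circ> S\<close> so that, pulled back, \<open>\<mu> * p\<close> appears and can be replaced by \<open>q\<close>\<close>
    have E2: "(LINT w|lebesgue. p w * (cnj (deriv S w) * (\<mu> (S w) * \<zeta> w))) = (LINT z|lebesgue. a z * p z * \<theta> z)"
    proof -
      let ?\<eta>' = "\<lambda>z v. if z \<in> B then \<xi>' (P z) (deriv P z * v) else 0"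
      have "- (LINT w|lebesgue. p w * (cnj (deriv S w) * (\<mu> (S w) * \<zeta> w))) = (LINT z|lebesgue. f (P z) * wirtinger_z (?\<eta>' z))"
        by (rule weak_wirtinger_pullback(1)[OF f wp wq B(1) hol B(4) S SP t2 refl, symmetric])
      also have "\<dots> = (LINT z|lebesgue. poly P1 (f z) * wirtinger_z (?\<eta>' z))"
        by (simp only: P_def conj)
      also have "\<dots> = - (LINT z|lebesgue. a z * p z * \<theta> z)"
        using weak_op_poly[OF f wp p, of P1] test_function_subset[OF t\<theta> subset_UNIV]
        unfolding weak_op_on_def wirtinger_z_eq a_def by blast
      finally show ?thesis by simp
    qed
    have E3: "(LINT z|lebesgue. a z * p z * \<theta> z) = (LINT z|lebesgue. a z * q z * \<eta> z)"
    proof (rule integral_cong_AE)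
      show "(\<lambda>z. a z * p z * \<theta> z) \<in> borel_measurable lebesgue" "(\<lambda>z. a z * q z * \<eta> z) \<in> borel_measurable lebesgue"
        by (intro borel_measurable_times pm qm continuous_lebesgue_measurable[OF ca]
            continuous_lebesgue_measurable[OF test_function_continuous[OF t\<eta>]]
            continuous_lebesgue_measurable[OF test_function_continuous[OF t\<theta>]])+
      show "AE z in lebesgue. a z * p z * \<theta> z = a z * q z * \<eta> z"
        using eq
      proof (rule AE_mp, intro AE_I2 impI)
        fix z assume h: "z \<in> U \<longrightarrow> q z = \<mu> z * p z"
        show "a z * p z * \<theta> z = a z * q z * \<eta> z"
        proof (cases "z \<in> B")
          case True
          then have "q z = \<mu> z * p z" "\<theta> z = \<mu> z * \<zeta> (P z)" "\<eta> z = \<zeta> (P z)"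
            using h B(3) SP by (auto simp: \<theta>_def \<eta>_def)
          then show ?thesis by simp
        qed (simp add: \<theta>_def \<eta>_def)
      qed
    qed
    obtain \<tau>1 where t3: "test_function ?V (\<lambda>w. m1 w * \<zeta> w) \<tau>1"
      by (rule test_function_C1_mult[OF V Cm1 t]) (rule that)
    obtain \<tau>2 where t4: "test_function ?V (\<lambda>w. m2 w * \<zeta> w) \<tau>2"
      by (rule test_function_C1_mult[OF V Cm2 t]) (rule that)
    obtain \<tau>3 where t5: "test_function ?V (\<lambda>w. deriv S w * \<zeta> w) \<tau>3"
      by (rule test_function_C1_mult[OF V CS t]) (rule that)
    have E4: "(LINT w|lebesgue. q w * (deriv S w * \<zeta> w)) = (LINT w|lebesgue. p w * (m2 w * \<zeta> w))"
    proof (rule integral_cong_AE)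
      show "(\<lambda>z. q z * (deriv S z * \<zeta> z)) \<in> borel_measurable lebesgue" "(\<lambda>z. p z * (m2 z * \<zeta> z)) \<in> borel_measurable lebesgue"
        by (intro borel_measurable_times pm qm
            continuous_lebesgue_measurable[OF test_function_continuous[OF t4]]
            continuous_lebesgue_measurable[OF test_function_continuous[OF t5]])+
      have \<zeta>0: "\<zeta> w = 0" if "w \<notin> ?V" for w using t that unfolding test_function_def by blast
      show "AE w in lebesgue. q w * (deriv S w * \<zeta> w) = p w * (m2 w * \<zeta> w)"
        using eq
      proof (rule AE_mp, intro AE_I2 impI)
        fix w assume h: "w \<in> U \<longrightarrow> q w = \<mu> w * p w"
        show "q w * (deriv S w * \<zeta> w) = p w * (m2 w * \<zeta> w)"
        proof (cases "w \<in> ?V")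
          case True
          then have "q w = \<mu> w * p w" using h VU by blast
          then show ?thesis by (simp add: m2_def)
        qed (simp add: \<zeta>0)
      qed
    qed
    have int: "integrable lebesgue (\<lambda>w. p w * g w)" if tg: "test_function ?V g g'" for g g'
    proof -
      obtain C where C: "compact C" "C \<subseteq> ?V" "\<And>z. z \<notin> C \<Longrightarrow> g z = 0" "\<And>z v. z \<notin> C \<Longrightarrow> g' z v = 0"
        by (rule test_function_supportE[OF tg]) (rule that)
      show ?thesis
        by (rule integrable_mult_compact_support[OF p test_function_continuous[OF tg] C(1)]) (rule C(3))
    qed
    have "(LINT w|lebesgue. p w * (c w * \<zeta> w)) = (LINT w|lebesgue. p w * (m1 w * \<zeta> w) - p w * (m2 w * \<zeta> w))"
      by (rule Bochner_Integration.integral_cong) (auto simp: c_def algebra_simps)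
    also have "\<dots> = (LINT w|lebesgue. p w * (m1 w * \<zeta> w)) - (LINT w|lebesgue. p w * (m2 w * \<zeta> w))"
      by (rule Bochner_Integration.integral_diff[OF int[OF t3] int[OF t4]])
    also have "(LINT w|lebesgue. p w * (m1 w * \<zeta> w)) = (LINT w|lebesgue. p w * (cnj (deriv S w) * (\<mu> (S w) * \<zeta> w)))"
      unfolding m1_def by (simp only: mult.assoc)
    finally show ?thesis using E1 E2 E3 E4 by simp
  qed

  define W where "W = {w \<in> ?V. c w \<noteq> 0}"
  have W: "open W"
  proof -
    have "open (?V \<inter> c -` (- {0}))"
      by (rule continuous_open_preimage[OF C1_on_continuous[OF Cc] V]) (simp add: open_Compl)
    moreover have "W = ?V \<inter> c -` (- {0})" unfolding W_def by auto
    ultimately show ?thesis by simp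
  qed
  have WV: "W \<subseteq> ?V" unfolding W_def by blast
  have "c (P z0) \<noteq> 0"
  proof
    assume "c (P z0) = 0"
    then have e: "cnj (deriv S (P z0)) * \<mu> z0 = \<mu> (P z0) * deriv S (P z0)"
      unfolding c_def m1_def m2_def using SP[OF B(2)] by simp
    have d: "deriv S (P z0) = inverse (deriv P z0)"
      by (rule inverse_unique[symmetric]) (use dSP[OF B(2)] in \<open>simp add: mult.commute\<close>)
    have "cnj (inverse (deriv P z0)) * \<mu> z0 = \<mu> (P z0) * inverse (deriv P z0)" using e unfolding d .
    then have "\<mu> z0 * deriv P z0 = \<mu> (P z0) * cnj (deriv P z0)"
      using nz by (simp add: field_simps)
    then have "\<mu> (poly P0 z0) * cnj (poly (pderiv P0) z0) = \<mu> z0 * poly (pderiv P0) z0"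
      unfolding dPz unfolding P_def by (rule sym)
    then show False using neq by contradiction
  qed
  then have zW: "P z0 \<in> W" unfolding W_def using B(2) by blast
  have Cinv: "C1_on W (\<lambda>w. inverse (c w))"
    by (rule C1_on_inverse[OF C1_on_subset[OF Cc WV]]) (simp add: W_def)
  have p0: "(LINT w|lebesgue. p w * \<eta> w) = 0" if t: "test_function W \<eta> \<eta>'" for \<eta> \<eta>'
  proof -
    obtain \<zeta>' where t2: "test_function W (\<lambda>w. inverse (c w) * \<eta> w) \<zeta>'"
      by (rule test_function_C1_mult[OF W Cinv t]) (rule that)
    have \<eta>0: "\<eta> w = 0" if "w \<notin> W" for w using t that unfolding test_function_def by blast
    have "(LINT w|lebesgue. p w * \<eta> w) = (LINT w|lebesgue. p w * (c w * (inverse (c w) * \<eta> w)))"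
    proof (rule Bochner_Integration.integral_cong[OF refl])
      fix w show "p w * \<eta> w = p w * (c w * (inverse (c w) * \<eta> w))"
        using \<eta>0[of w] by (cases "w \<in> W") (auto simp: W_def)
    qed
    also have "\<dots> = 0" by (rule orth[OF test_function_subset[OF t2 WV]])
    finally show ?thesis .
  qed
  have WU: "W \<subseteq> U" using WV VU by (rule order_trans)
  have eqW: "AE z in lebesgue. z \<in> W \<longrightarrow> q z = \<mu> z * p z"
    using eq by (rule AE_mp) (rule AE_I2, use WU in blast)
  show False
    by (rule continuous_injective_not_weakly_constant[OF W zW f inj wp wq C1_on_subset[OF \<mu> WU] eqW p0 pm qm])
qed

section \<open>The hyperbolic density of the complement of a filled Julia set\<close>

lemma covering_space_restrict:
  fixes p :: "'a::real_normed_vector \<Rightarrow> 'b::real_normed_vector"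
  assumes cov: "covering_space c p S" and T: "open T" "T \<subseteq> S"
  shows "covering_space (c \<inter> p -` T) p T"
  unfolding covering_space_def
proof (intro conjI ballI)
  have cont: "continuous_on c p" and im: "p ` c = S"
    using cov by (auto simp: covering_space_def)
  show cont': "continuous_on (c \<inter> p -` T) p" by (rule continuous_on_subset[OF cont]) blast
  show "p ` (c \<inter> p -` T) = T" using im T(2) by blast
  fix x assume x: "x \<in> T"
  then have "x \<in> S" using T(2) by blast
  then obtain W \<V> where W: "x \<in> W" "openin (top_of_set S) W"
    and UV: "\<Union>\<V> = c \<inter> p -` W" and op: "\<And>u. u \<in> \<V> \<Longrightarrow> openin (top_of_set c) u"
    and dis: "pairwise disjnt \<V>" and hom: "\<And>u. u \<in> \<V> \<Longrightarrow> \<exists>q. homeomorphism u W p q"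
    using cov unfolding covering_space_def by meson
  define \<V>' where "\<V>' = (\<lambda>u. u \<inter> p -` T) ` \<V>"
  show "\<exists>W. x \<in> W \<and> openin (top_of_set T) W \<and>
       (\<exists>v. \<Union> v = c \<inter> p -` T \<inter> p -` W \<and> (\<forall>u\<in>v. openin (top_of_set (c \<inter> p -` T)) u) \<and>
            pairwise disjnt v \<and> (\<forall>u\<in>v. \<exists>q. homeomorphism u W p q))"
  proof (intro exI[of _ "W \<inter> T"] exI[of _ \<V>'] conjI ballI)
    show "x \<in> W \<inter> T" using W(1) x by blast
    show "openin (top_of_set T) (W \<inter> T)"
    proof -
      obtain O0 where "open O0" "W = S \<inter> O0" using W(2) unfolding openin_open by blast
      then show ?thesis unfolding openin_open using T(2) by blast
    qed
    show "\<Union> \<V>' = c \<inter> p -` T \<inter> p -` (W \<inter> T)"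
      using UV unfolding \<V>'_def by blast
    show "openin (top_of_set (c \<inter> p -` T)) u" if uV: "u \<in> \<V>'" for u
    proof -
      obtain u0 where u0: "u0 \<in> \<V>" "u = u0 \<inter> p -` T" using uV unfolding \<V>'_def by blast
      obtain O0 where O0: "open O0" "u0 = c \<inter> O0" using op[OF u0(1)] unfolding openin_open by blast
      show ?thesis unfolding openin_open using O0 u0(2) by blast
    qed
    show "pairwise disjnt \<V>'"
      using dis unfolding \<V>'_def pairwise_def disjnt_def by blast
    fix u assume "u \<in> \<V>'"
    then obtain u0 where u0: "u0 \<in> \<V>" "u = u0 \<inter> p -` T" unfolding \<V>'_def by blast
    obtain q where q: "homeomorphism u0 W p q" using hom[OF u0(1)] by blast
    have "homeomorphism u (W \<inter> T) p q"
    proof (rule homeomorphism_of_subsets[OF q _ empty_subsetI])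
      show "u \<subseteq> u0" using u0(2) by blast
      show "p ` u = W \<inter> T"
        using homeomorphism_image1[OF q] u0(2) by blast
    qed
    then show "\<exists>q. homeomorphism u (W \<inter> T) p q" by blast
  qed
qed

text \<open>
  A covering stays a covering after homeomorphisms on both sides: evenly covered sets and their
  sheets are carried along.
\<close>

lemma covering_space_transport:
  fixes p :: "'a::real_normed_vector \<Rightarrow> 'b::real_normed_vector" and h :: "'c::real_normed_vector \<Rightarrow> 'a"
    and f :: "'b \<Rightarrow> 'd::real_normed_vector"
  assumes cov: "covering_space c p S" and h: "homeomorphism D c h k" and f: "homeomorphism S S' f g"
  shows "covering_space D (f \<circ> (p \<circ> h)) S'"
  unfolding covering_space_def
proof (intro conjI ballI)
  have cp: "continuous_on c p" and ip: "p ` c = S" using cov by (auto simp: covering_space_def)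
  have ch: "continuous_on D h" and ih: "h ` D = c" using h by (auto simp: homeomorphism_def)
  have cf: "continuous_on S f" and if': "f ` S = S'" and cg: "continuous_on S' g" and ig: "g ` S' = S"
    using f by (auto simp: homeomorphism_def)
  have gf: "g (f y) = y" if "y \<in> S" for y using f that by (auto simp: homeomorphism_def)
  have fg: "f (g y) = y" if "y \<in> S'" for y using f that by (auto simp: homeomorphism_def)
  show "continuous_on D (f \<circ> (p \<circ> h))"
    unfolding o_def
    by (rule continuous_on_compose2[OF cf continuous_on_compose2[OF cp ch]]) (use ih ip in auto)
  show "(f \<circ> (p \<circ> h)) ` D = S'" by (simp only: image_comp[symmetric] ih ip if')
  fix x assume x: "x \<in> S'"
  then have "g x \<in> S" using ig by blast
  then obtain W \<V> where W: "g x \<in> W" "openin (top_of_set S) W"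
    and UV: "\<Union>\<V> = c \<inter> p -` W" and op: "\<And>u. u \<in> \<V> \<Longrightarrow> openin (top_of_set c) u"
    and dis: "pairwise disjnt \<V>" and hom: "\<And>u. u \<in> \<V> \<Longrightarrow> \<exists>q. homeomorphism u W p q"
    using cov unfolding covering_space_def by meson
  define \<V>' where "\<V>' = (\<lambda>u. D \<inter> h -` u) ` \<V>"
  show "\<exists>W. x \<in> W \<and> openin (top_of_set S') W \<and>
       (\<exists>v. \<Union> v = D \<inter> (f \<circ> (p \<circ> h)) -` W \<and> (\<forall>u\<in>v. openin (top_of_set D) u) \<and>
            pairwise disjnt v \<and> (\<forall>u\<in>v. \<exists>q. homeomorphism u W (f \<circ> (p \<circ> h)) q))"
  proof (intro exI[of _ "S' \<inter> g -` W"] exI[of _ \<V>'] conjI ballI)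
    show "x \<in> S' \<inter> g -` W" using W(1) x by blast
    show "openin (top_of_set S') (S' \<inter> g -` W)"
      by (rule continuous_openin_preimage[OF cg _ W(2)]) (use ig in blast)
    have WS: "W \<subseteq> S" using W(2) openin_imp_subset by blast
    show "\<Union> \<V>' = D \<inter> (f \<circ> (p \<circ> h)) -` (S' \<inter> g -` W)"
    proof (intro subset_antisym subsetI)
      fix y assume "y \<in> \<Union> \<V>'"
      then obtain u where u: "u \<in> \<V>" "y \<in> D" "h y \<in> u" unfolding \<V>'_def by blast
      then have "h y \<in> c" "p (h y) \<in> W" using UV by blast+
      then show "y \<in> D \<inter> (f \<circ> (p \<circ> h)) -` (S' \<inter> g -` W)"
        using u(2) WS gf if' by auto
    next
      fix y assume "y \<in> D \<inter> (f \<circ> (p \<circ> h)) -` (S' \<inter> g -` W)"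
      then have y: "y \<in> D" "g (f (p (h y))) \<in> W" by auto
      then have hy: "h y \<in> c" using ih by blast
      then have "p (h y) \<in> W" using y(2) gf ip by auto
      then have "h y \<in> \<Union>\<V>" using UV hy by blast
      then show "y \<in> \<Union> \<V>'" using y(1) unfolding \<V>'_def by blast
    qed
    show "openin (top_of_set D) u" if uV: "u \<in> \<V>'" for u
    proof -
      obtain u0 where u0: "u0 \<in> \<V>" "u = D \<inter> h -` u0" using uV unfolding \<V>'_def by blast
      show ?thesis unfolding u0(2)
        by (rule continuous_openin_preimage[OF ch _ op[OF u0(1)]]) (use ih in blast)
    qed
    show "pairwise disjnt \<V>'"
      using dis unfolding \<V>'_def pairwise_def disjnt_def by blast
    fix u assume "u \<in> \<V>'"
    then obtain u0 where u0: "u0 \<in> \<V>" "u = D \<inter> h -` u0" unfolding \<V>'_def by blast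
    obtain q where q: "homeomorphism u0 W p q" using hom[OF u0(1)] by blast
    have uc: "u0 \<subseteq> c" using op[OF u0(1)] openin_imp_subset by blast
    have 1: "homeomorphism u u0 h k"
    proof (rule homeomorphism_of_subsets[OF h _ empty_subsetI])
      show "u \<subseteq> D" using u0(2) by blast
      show "h ` u = u0" unfolding u0(2) using uc ih by blast
    qed
    have 2: "homeomorphism W (S' \<inter> g -` W) f g"
    proof (rule homeomorphism_of_subsets[OF f WS empty_subsetI])
      show "f ` W = S' \<inter> g -` W" using WS gf fg if' ig by force
    qed
    show "\<exists>q. homeomorphism u (S' \<inter> g -` W) (f \<circ> (p \<circ> h)) q"
      using homeomorphism_compose[OF homeomorphism_compose[OF 1 q] 2] by blast
  qed
qed

text \<open>
  Lift \<open>\<pi>2\<close> through \<open>\<pi>1\<close> to a holomorphic self-map of the disk that fixes 0 and apply the Schwarz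
  lemma. By symmetry this makes the density in the definition of the hyperbolic metric unique.
\<close>

lemma disk_covering_derivative_le:
  assumes S: "covering_space (ball 0 1) \<pi>1 S" "covering_space (ball 0 1) \<pi>2 S"
    and hol: "\<pi>1 holomorphic_on ball 0 1" "\<pi>2 holomorphic_on ball 0 1" and eq: "\<pi>1 0 = \<pi>2 0"
  shows "norm (deriv \<pi>2 0) \<le> norm (deriv \<pi>1 0)"
proof -
  have im: "\<pi>2 \<in> ball 0 1 \<rightarrow> S" using covering_space_imp_surjective[OF S(2)] by blast
  obtain g where g: "continuous_on (ball 0 1) g" "g \<in> ball 0 1 \<rightarrow> ball 0 1" "g 0 = 0"
      "\<And>y. y \<in> ball 0 1 \<Longrightarrow> \<pi>1 (g y) = \<pi>2 y"
  proof (rule covering_space_lift_strong[OF S(1), of 0 0 "ball 0 1" \<pi>2])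
    show "simply_connected (ball (0::complex) 1)" by (simp add: convex_imp_simply_connected)
    show "locally path_connected (ball (0::complex) 1)" by (simp add: convex_imp_locally_path_connected)
    show "continuous_on (ball 0 1) \<pi>2" by (rule holomorphic_on_imp_continuous_on[OF hol(2)])
  qed (use eq im in auto)
  have hg: "g holomorphic_on ball 0 1"
    by (rule covering_space_lift_is_holomorphic[OF S(1) open_ball hol im g(2) g(1) g(4)])
  have "norm (deriv g 0) \<le> 1"
    using Schwarz_Lemma(2)[OF hg g(3), of 0] g(2) by (auto simp: Pi_iff)
  moreover have "deriv \<pi>2 0 = deriv \<pi>1 0 * deriv g 0"
  proof -
    have "(\<pi>1 has_field_derivative deriv \<pi>1 0) (at (g 0))"
      using holomorphic_derivI[OF hol(1) open_ball, of 0] g(3) by simp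
    then have "((\<lambda>y. \<pi>1 (g y)) has_field_derivative deriv \<pi>1 0 * deriv g 0) (at 0)"
      using DERIV_chain2[OF _ holomorphic_derivI[OF hg open_ball, of 0]] by simp
    then have "(\<pi>2 has_field_derivative deriv \<pi>1 0 * deriv g 0) (at 0)"
      by (rule has_field_derivative_transform_within_open[of _ _ _ "ball 0 1"]) (use g(4) in auto)
    then show ?thesis by (rule DERIV_imp_deriv)
  qed
  ultimately show ?thesis by (simp add: norm_mult mult_left_le)
qed

lemma connected_exterior_disk: "connected (- cball (0::complex) 1)"
  by (rule connected_complement_bounded_convex) auto

lemma covering_space_exp_half_plane:
  "covering_space {s. 0 < Re s} exp (- cball (0::complex) 1)"
proof -
  have "covering_space (UNIV \<inter> exp -` (- cball 0 1)) exp (- cball (0::complex) 1)"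
    by (rule covering_space_restrict[OF covering_space_exp_punctured_plane]) (auto simp: open_Compl)
  moreover have "UNIV \<inter> exp -` (- cball 0 1) = {s :: complex. 0 < Re s}" by auto
  ultimately show ?thesis by simp
qed

text \<open>
  The Cayley transform that sends 0 to \<open>w\<close>.
\<close>

lemma homeomorphism_disk_half_plane:
  assumes w: "0 < Re w"
  shows "homeomorphism (ball 0 1) {s. 0 < Re s} (\<lambda>u. (w + cnj w * u) / (1 - u)) (\<lambda>s. (s - w) / (s + cnj w))"
proof -
  have nz1: "1 - u \<noteq> 0" if "norm u < 1" for u :: complex using that by auto
  have nz2: "s + cnj w \<noteq> 0" if "0 < Re s" for s
  proof
    assume "s + cnj w = 0"
    then have "Re (s + cnj w) = 0" by simp
    then show False using that w by simp
  qed
  have re: "0 < Re ((w + cnj w * u) / (1 - u))" if u: "norm u < 1" for u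
  proof -
    have "(Re u)\<^sup>2 + (Im u)\<^sup>2 < 1" using u by (simp add: cmod_def)
    then have "0 < Re w * (1 - ((Re u)\<^sup>2 + (Im u)\<^sup>2))" using w by simp
    also have "\<dots> = Re ((w + cnj w * u) * cnj (1 - u))" by (simp add: algebra_simps power2_eq_square)
    finally have "0 < Re ((w + cnj w * u) * cnj (1 - u))" .
    then show ?thesis unfolding Re_complex_div_gt_0 .
  qed
  have no: "norm ((s - w) / (s + cnj w)) < 1" if s: "0 < Re s" for s
  proof -
    have "(norm (s - w))\<^sup>2 < (norm (s + cnj w))\<^sup>2"
    proof -
      have "(norm (s + cnj w))\<^sup>2 - (norm (s - w))\<^sup>2 = 4 * (Re s * Re w)"
        unfolding cmod_power2 by (simp add: power2_eq_square algebra_simps)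
      moreover have "0 < Re s * Re w" using s w by simp
      ultimately show ?thesis by linarith
    qed
    then have "norm (s - w) < norm (s + cnj w)" by (rule power2_less_imp_less) simp
    then show ?thesis using nz2[OF s] by (simp add: norm_divide)
  qed
  have ww: "w + cnj w \<noteq> 0" using nz2[OF w] .
  have inv1: "((w + cnj w * u) / (1 - u) - w) / ((w + cnj w * u) / (1 - u) + cnj w) = u" if u: "norm u < 1" for u
  proof -
    have "(w + cnj w * u) / (1 - u) - w = (w + cnj w) * u / (1 - u)"
      using nz1[OF u] by (simp add: field_simps)
    moreover have "(w + cnj w * u) / (1 - u) + cnj w = (w + cnj w) / (1 - u)"
      using nz1[OF u] by (simp add: field_simps)
    ultimately show ?thesis using ww nz1[OF u] by simp
  qed
  have inv2: "(w + cnj w * ((s - w) / (s + cnj w))) / (1 - (s - w) / (s + cnj w)) = s" if s: "0 < Re s" for s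
  proof -
    have "1 - (s - w) / (s + cnj w) = (w + cnj w) / (s + cnj w)"
      using nz2[OF s] by (simp add: field_simps)
    moreover have "w + cnj w * ((s - w) / (s + cnj w)) = (w + cnj w) * s / (s + cnj w)"
      using nz2[OF s] by (simp add: field_simps)
    ultimately show ?thesis using ww nz2[OF s] by simp
  qed
  show ?thesis
  proof (rule homeomorphismI)
    show "continuous_on (ball 0 1) (\<lambda>u. (w + cnj w * u) / (1 - u))"
      by (intro continuous_intros ballI) (use nz1 in auto)
    show "continuous_on {s. 0 < Re s} (\<lambda>s. (s - w) / (s + cnj w))"
      by (intro continuous_intros ballI) (use nz2 in auto)
  qed (use re no inv1 inv2 in auto)
qed

text \<open>
  The inverse of \<open>\<phi>\<close>, after the exponential function on the right half-plane and a Cayley transform, is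
  a universal covering of \<open>U\<close> by the disk; its derivative at 0 is computed by the chain rule.
\<close>

lemma hyperbolic_density_exterior:
  assumes U: "open U" and \<phi>: "\<phi> holomorphic_on U" and bij: "bij_betw \<phi> U (- cball 0 1)" and z: "z \<in> U"
  shows "hyperbolic_density U z = norm (deriv \<phi> z) / (norm (\<phi> z) * ln (norm (\<phi> z)))"
proof -
  have inj: "inj_on \<phi> U" and im: "\<phi> ` U = - cball 0 1" using bij by (auto simp: bij_betw_def)
  obtain \<gamma> where \<gamma>: "\<gamma> holomorphic_on - cball 0 1" and \<gamma>\<phi>: "\<And>z. z \<in> U \<Longrightarrow> \<gamma> (\<phi> z) = z"
    and d\<gamma>: "\<And>z. z \<in> U \<Longrightarrow> deriv \<phi> z * deriv \<gamma> (\<phi> z) = 1"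
    using holomorphic_has_inverse[OF \<phi> U inj] unfolding im by metis
  have \<phi>\<gamma>: "\<phi> (\<gamma> w) = w" if "w \<in> - cball 0 1" for w using that \<gamma>\<phi> im by (metis imageE)
  have \<gamma>im: "\<gamma> ` (- cball 0 1) = U" using \<gamma>\<phi> im by (force simp: image_iff)
  have hom: "homeomorphism (- cball 0 1) U \<gamma> \<phi>"
    using \<gamma>\<phi> \<phi>\<gamma> \<gamma>im im holomorphic_on_imp_continuous_on[OF \<gamma>] holomorphic_on_imp_continuous_on[OF \<phi>]
    by (auto intro!: homeomorphismI)
  have "connected U"
    using connected_continuous_image[OF holomorphic_on_imp_continuous_on[OF \<gamma>] connected_exterior_disk]
    unfolding \<gamma>im .
  then have comp: "connected_component_set U z = U" using z by (metis connected_component_eq_self)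
  have n1: "1 < norm (\<phi> z)" using im z by force
  then have nz: "\<phi> z \<noteq> 0" by auto
  define w where "w = Ln (\<phi> z)"
  have ew: "exp w = \<phi> z" unfolding w_def using nz by simp
  have Rw: "Re w = ln (norm (\<phi> z))" unfolding w_def using nz by simp
  have Rw0: "0 < Re w" using Rw ln_gt_zero[OF n1] by (simp only:)
  define C where "C u = (w + cnj w * u) / (1 - u)" for u
  define \<pi> where "\<pi> = \<gamma> \<circ> (exp \<circ> C)"
  have cov: "covering_space (ball 0 1) \<pi> U"
    unfolding \<pi>_def
    by (rule covering_space_transport[OF covering_space_exp_half_plane _ hom])
       (use homeomorphism_disk_half_plane[OF Rw0] in \<open>simp add: C_def[abs_def]\<close>)
  have C0: "C 0 = w" unfolding C_def by simp
  have \<pi>0: "\<pi> 0 = z" unfolding \<pi>_def using C0 ew \<gamma>\<phi>[OF z] by simp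
  have dC: "(C has_field_derivative of_real (2 * Re w)) (at 0)"
    unfolding C_def by (auto intro!: derivative_eq_intros simp: complex_eq_iff)
  have hC: "C holomorphic_on ball 0 1"
    unfolding C_def by (intro holomorphic_intros) auto
  have imC: "(exp \<circ> C) ` ball 0 1 \<subseteq> - cball 0 1"
    using homeomorphism_image1[OF homeomorphism_disk_half_plane[OF Rw0]]
      covering_space_imp_surjective[OF covering_space_exp_half_plane] unfolding C_def[symmetric] by (simp only: image_comp[symmetric] order_refl)
  have h\<pi>: "\<pi> holomorphic_on ball 0 1"
    unfolding \<pi>_def
    by (rule holomorphic_on_compose_gen[OF holomorphic_on_compose[OF hC] \<gamma> imC]) (intro holomorphic_intros)
  have "(\<gamma> has_field_derivative deriv \<gamma> (\<phi> z)) (at (exp (C 0)))"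
    using holomorphic_derivI[OF \<gamma>, of "\<phi> z"] n1 C0 ew by (simp add: open_Compl)
  moreover have "((\<lambda>u. exp (C u)) has_field_derivative \<phi> z * of_real (2 * Re w)) (at 0)"
    using DERIV_chain2[OF DERIV_exp dC] C0 ew by simp
  ultimately have "((\<lambda>u. \<gamma> (exp (C u))) has_field_derivative deriv \<gamma> (\<phi> z) * (\<phi> z * of_real (2 * Re w))) (at 0)"
    by (rule DERIV_chain2)
  then have d\<pi>: "deriv \<pi> 0 = deriv \<gamma> (\<phi> z) * (\<phi> z * of_real (2 * Re w))"
    unfolding \<pi>_def o_def by (rule DERIV_imp_deriv)
  have "norm (deriv \<phi> z) * norm (deriv \<gamma> (\<phi> z)) = 1" using d\<gamma>[OF z] by (metis norm_mult norm_one)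
  then have inv: "norm (deriv \<gamma> (\<phi> z)) = 1 / norm (deriv \<phi> z)"
    by (metis mult_zero_left nonzero_mult_div_cancel_left zero_neq_one)
  have val: "2 / norm (deriv \<pi> 0) = norm (deriv \<phi> z) / (norm (\<phi> z) * ln (norm (\<phi> z)))"
    unfolding d\<pi> norm_mult inv using Rw Rw0 by (simp add: field_simps)
  show ?thesis
    unfolding hyperbolic_density_def comp
  proof (rule the_equality)
    show "\<exists>\<pi>. \<pi> holomorphic_on ball 0 1 \<and> covering_space (ball 0 1) \<pi> U \<and> \<pi> 0 = z \<and>
        norm (deriv \<phi> z) / (norm (\<phi> z) * ln (norm (\<phi> z))) = 2 / norm (deriv \<pi> 0)"
      using h\<pi> cov \<pi>0 val by metis
    fix \<rho> assume "\<exists>\<pi>. \<pi> holomorphic_on ball 0 1 \<and> covering_space (ball 0 1) \<pi> U \<and> \<pi> 0 = z \<and> \<rho> = 2 / norm (deriv \<pi> 0)"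
    then obtain \<sigma> where s: "\<sigma> holomorphic_on ball 0 1" "covering_space (ball 0 1) \<sigma> U" "\<sigma> 0 = z"
      and \<rho>: "\<rho> = 2 / norm (deriv \<sigma> 0)" by blast
    have "norm (deriv \<sigma> 0) = norm (deriv \<pi> 0)"
      using disk_covering_derivative_le[OF cov s(2) h\<pi> s(1)] disk_covering_derivative_le[OF s(2) cov s(1) h\<pi>]
        \<pi>0 s(3) by simp
    then show "\<rho> = norm (deriv \<phi> z) / (norm (\<phi> z) * ln (norm (\<phi> z)))" using \<rho> val by simp
  qed
qed

section \<open>Invariant harmonic coefficients vanish\<close>

text \<open>
  In the coordinate \<open>w = exp s\<close> the equation reads \<open>H s = d\<^sup>2 * H (d * s)\<close> on the right half-plane. By
  induction every \<open>2 * pi * \<i> / d ^ n\<close> is a period; these periods accumulate at 0, so \<open>H\<close> is constant by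
  the identity theorem, and the constant is \<open>d\<^sup>2\<close> times itself.
\<close>

lemma exterior_eigenfunction_zero:
  assumes h: "h holomorphic_on (- cball 0 1)" and d: "2 \<le> d"
    and eq: "\<And>w. w \<in> - cball 0 1 \<Longrightarrow> h w = (of_nat d)\<^sup>2 * h (w ^ d)" and w: "w \<in> - cball 0 1"
  shows "h w = (0::complex)"
proof -
  define R where "R = {s :: complex. 0 < Re s}"
  define H where "H s = h (exp s)" for s
  have R: "open R" "connected R"
    unfolding R_def by (auto simp: open_halfspace_Re_gt intro: convex_connected convex_halfspace_Re_gt)
  have eR: "exp s \<in> - cball 0 1" if "s \<in> R" for s :: complex using that unfolding R_def by simp
  have dR: "of_nat d * s \<in> R" if "s \<in> R" for s using that d unfolding R_def by simp
  have HH: "H s = (of_nat d)\<^sup>2 * H (of_nat d * s)" if "s \<in> R" for s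
    unfolding H_def using eq[OF eR[OF that]] by (simp flip: exp_of_nat_mult)
  have "exp ` R \<subseteq> - cball 0 1" using eR by blast
  then have hol: "H holomorphic_on R"
    unfolding H_def[abs_def] using holomorphic_on_compose_gen[OF _ h, of exp R]
    by (simp add: o_def holomorphic_on_exp)
  define e where "e n = 2 * of_real pi * \<i> / (of_nat d) ^ n" for n
  have ed: "of_nat d * e (Suc n) = e n" for n unfolding e_def using d by simp
  have eRe: "Re (e n) = 0" for n
  proof -
    have "e n = of_real (2 * pi / real d ^ n) * \<i>" unfolding e_def by simp
    then show ?thesis by (simp only: times_complex.sel complex_of_real_def) simp
  qed
  have sR: "s + e n \<in> R" if "s \<in> R" for s n using that eRe unfolding R_def by simp
  have per: "H (s + e n) = H s" if "s \<in> R" for s n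
    using that
  proof (induction n arbitrary: s)
    case 0
    have "exp (s + e 0) = exp s" unfolding e_def by (simp add: exp_add )
    then show ?case unfolding H_def by simp
  next
    case (Suc n)
    have "H (s + e (Suc n)) = (of_nat d)\<^sup>2 * H (of_nat d * s + e n)"
      using HH[OF sR[OF Suc.prems]] by (simp add: distrib_left ed)
    also have "\<dots> = (of_nat d)\<^sup>2 * H (of_nat d * s)" using Suc.IH[OF dR[OF Suc.prems]] by simp
    also have "\<dots> = H s" using HH[OF Suc.prems] by simp
    finally show ?case .
  qed
  have const: "H s = H t" if s: "s \<in> R" and t: "t \<in> R" for s t
  proof -
    have lim: "(\<lambda>n. s + e n) \<longlonglongrightarrow> s"
    proof -
      have "norm (1 / of_nat d :: complex) < 1" using d by (simp add: norm_divide)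
      then have "(\<lambda>n. (1 / of_nat d :: complex) ^ n) \<longlonglongrightarrow> 0" by (rule LIMSEQ_power_zero)
      then have "(\<lambda>n. s + 2 * of_real pi * \<i> * (1 / of_nat d) ^ n) \<longlonglongrightarrow> s + 2 * of_real pi * \<i> * 0"
        by (intro tendsto_add tendsto_mult tendsto_const)
      then show ?thesis unfolding e_def by (simp add: power_divide)
    qed
    have ne: "s + e n \<noteq> s" for n unfolding e_def using d by simp
    have "s islimpt range (\<lambda>n. s + e n)"
      unfolding islimpt_sequential using lim ne by (intro exI[of _ "\<lambda>n. s + e n"]) auto
    have "H t - H s = 0"
    proof (rule analytic_continuation[of "\<lambda>u. H u - H s" R "range (\<lambda>n. s + e n)" s])
      show "(\<lambda>u. H u - H s) holomorphic_on R" by (intro holomorphic_on_diff hol holomorphic_on_const)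
      show "s islimpt range (\<lambda>n. s + e n)" by fact
      show "H u - H s = 0" if "u \<in> range (\<lambda>n. s + e n)" for u using that per[OF s] by auto
    qed (use R s t sR in auto)
    then show ?thesis by simp
  qed
  have nz: "w \<noteq> 0" using w by auto
  define s where "s = Ln w"
  have "exp s = w" unfolding s_def using nz by simp
  moreover have "s \<in> R" unfolding R_def s_def using nz w ln_gt_zero by simp
  ultimately have sw: "s \<in> R" "H s = h w" unfolding H_def by auto
  have "H s = (of_nat d)\<^sup>2 * H s" using HH[OF sw(1)] const[OF dR[OF sw(1)] sw(1)] by simp
  then have "((of_nat d)\<^sup>2 - 1) * H s = 0" by (simp add: algebra_simps)
  moreover have "(of_nat d)\<^sup>2 \<noteq> (1::complex)"
  proof
    assume "(of_nat d)\<^sup>2 = (1::complex)"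
    then have "of_nat (d\<^sup>2) = (of_nat 1 :: complex)" by simp
    then have "d\<^sup>2 = 1" using of_nat_eq_iff by blast
    then show False using d by (simp add: power2_eq_square)
  qed
  ultimately show ?thesis using sw(2) by simp
qed

text \<open>
  Differentiate the functional equation.
\<close>

lemma boettcher_deriv:
  assumes U: "open U" and \<phi>: "\<phi> holomorphic_on U" and PU: "poly P ` U \<subseteq> U"
    and conj: "\<And>z. z \<in> U \<Longrightarrow> \<phi> (poly P z) = \<phi> z ^ d" and z: "z \<in> U"
  shows "deriv \<phi> (poly P z) * poly (pderiv P) z = of_nat d * \<phi> z ^ (d - 1) * deriv \<phi> z"
proof -
  have "poly P z \<in> U" using PU z by blast
  then have "((\<lambda>z. \<phi> (poly P z)) has_field_derivative deriv \<phi> (poly P z) * poly (pderiv P) z) (at z)"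
    by (intro DERIV_chain2[OF holomorphic_derivI[OF \<phi> U]] poly_DERIV)
  then have "((\<lambda>z. \<phi> z ^ d) has_field_derivative deriv \<phi> (poly P z) * poly (pderiv P) z) (at z)"
    by (rule has_field_derivative_transform_within_open[OF _ U z]) (rule conj)
  moreover have "((\<lambda>z. \<phi> z ^ d) has_field_derivative of_nat d * \<phi> z ^ (d - 1) * deriv \<phi> z) (at z)"
    using DERIV_power[OF holomorphic_derivI[OF \<phi> U z], of d] by (simp add: mult_ac)
  ultimately show ?thesis by (rule DERIV_unique)
qed

text \<open>
  Written in the coordinate \<open>w = \<phi> z\<close> and multiplied by \<open>w\<^sup>2\<close>, an invariant quadratic differential
  satisfies the equation of the preceding eigenfunction lemma.
\<close>

lemma invariant_quadratic_differential_zero: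
  assumes U: "open U" and \<phi>: "\<phi> holomorphic_on U" and bij: "bij_betw \<phi> U (- cball 0 1)"
    and PU: "poly P ` U \<subseteq> U" and conj: "\<And>z. z \<in> U \<Longrightarrow> \<phi> (poly P z) = \<phi> z ^ d" and d: "2 \<le> d"
    and \<nu>: "\<nu> holomorphic_on U" and inv: "\<And>z. z \<in> U \<Longrightarrow> \<nu> (poly P z) * (poly (pderiv P) z)\<^sup>2 = \<nu> z"
    and z: "z \<in> U"
  shows "\<nu> z = 0"
proof -
  have inj: "inj_on \<phi> U" and im: "\<phi> ` U = - cball 0 1" using bij by (auto simp: bij_betw_def)
  obtain \<gamma> where \<gamma>: "\<gamma> holomorphic_on - cball 0 1" and \<gamma>\<phi>: "\<And>z. z \<in> U \<Longrightarrow> \<gamma> (\<phi> z) = z"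
    and d\<gamma>: "\<And>z. z \<in> U \<Longrightarrow> deriv \<phi> z * deriv \<gamma> (\<phi> z) = 1"
    using holomorphic_has_inverse[OF \<phi> U inj] unfolding im by metis
  have \<gamma>im: "\<gamma> ` (- cball 0 1) \<subseteq> U" using \<gamma>\<phi> im by (force simp: image_iff)
  have oE: "open (- cball (0::complex) 1)" by (simp add: open_Compl)
  have \<phi>nz: "\<phi> z \<noteq> 0" if "z \<in> U" for z using im that by force
  have d\<phi>: "deriv \<phi> z \<noteq> 0" if "z \<in> U" for z using d\<gamma>[OF that] by auto
  have d\<gamma>': "deriv \<gamma> (\<phi> z) = 1 / deriv \<phi> z" if "z \<in> U" for z
    using d\<gamma>[OF that] d\<phi>[OF that] by (simp add: nonzero_eq_divide_eq mult.commute)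
  define h where "h w = w\<^sup>2 * \<nu> (\<gamma> w) * (deriv \<gamma> w)\<^sup>2" for w
  have hol: "h holomorphic_on - cball 0 1"
  proof -
    have "(\<lambda>w. \<nu> (\<gamma> w)) holomorphic_on - cball 0 1"
      using holomorphic_on_compose_gen[OF \<gamma> \<nu> \<gamma>im] by (simp only: o_def)
    then show ?thesis
      unfolding h_def[abs_def]
      by (intro holomorphic_on_mult holomorphic_on_power holomorphic_on_ident holomorphic_deriv[OF \<gamma> oE])
  qed
  have "h w = (of_nat d)\<^sup>2 * h (w ^ d)" if wE: "w \<in> - cball 0 1" for w
  proof -
    obtain y where y: "y \<in> U" "w = \<phi> y" using wE im by blast
    have Py: "poly P y \<in> U" using PU y(1) by blast
    have wd: "w ^ d = \<phi> (poly P y)" using conj[OF y(1)] y(2) by simp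
    have A: "deriv \<phi> (poly P y) * poly (pderiv P) y = of_nat d * w ^ (d - 1) * deriv \<phi> y"
      using boettcher_deriv[OF U \<phi> PU conj y(1)] y(2) by simp
    have nz: "deriv \<phi> (poly P y) \<noteq> 0" "deriv \<phi> y \<noteq> 0" "w \<noteq> 0"
      using d\<phi>[OF Py] d\<phi>[OF y(1)] \<phi>nz[OF y(1)] y(2) by simp_all
    have wpow: "w ^ (d - 1) * w = w ^ d" using d by (intro power_minus_mult) simp
    define D where "D = deriv \<phi> (poly P y)"
    define F where "F = deriv \<phi> y"
    define Q where "Q = poly (pderiv P) y"
    have nz': "D \<noteq> 0" "F \<noteq> 0" using nz unfolding D_def F_def by simp_all
    have A': "D * Q = of_nat d * w ^ (d - 1) * F" using A unfolding D_def F_def Q_def .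
    have \<gamma>w: "\<gamma> w = y" "deriv \<gamma> w = 1 / F"
      unfolding F_def using \<gamma>\<phi>[OF y(1)] d\<gamma>'[OF y(1)] y(2) by simp_all
    have \<gamma>wd: "\<gamma> (w ^ d) = poly P y" "deriv \<gamma> (w ^ d) = 1 / D"
      unfolding D_def wd using \<gamma>\<phi>[OF Py] d\<gamma>'[OF Py] by simp_all
    have "D\<^sup>2 * h w = w\<^sup>2 * (\<nu> (poly P y) * Q\<^sup>2) / F\<^sup>2 * D\<^sup>2"
      unfolding h_def \<gamma>w Q_def inv[OF y(1)] by (simp add: power_divide)
    also have "\<dots> = w\<^sup>2 * \<nu> (poly P y) * (D * Q)\<^sup>2 / F\<^sup>2"
      by (simp add: power_mult_distrib)
    also have "\<dots> = (of_nat d)\<^sup>2 * (w ^ (d - 1) * w)\<^sup>2 * \<nu> (poly P y)"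
      unfolding A' using nz' by (simp add: power_mult_distrib)
    also have "\<dots> = D\<^sup>2 * ((of_nat d)\<^sup>2 * h (w ^ d))"
      unfolding h_def \<gamma>wd wpow using nz' by (simp add: power_divide)
    finally show ?thesis using nz' by simp
  qed
  then have "h (\<phi> z) = 0" by (rule exterior_eigenfunction_zero[OF hol d]) (use im z in auto)
  then show ?thesis unfolding h_def \<gamma>\<phi>[OF z] d\<gamma>'[OF z] using \<phi>nz[OF z] d\<phi>[OF z] by simp
qed

lemma C1_on_transform:
  assumes V: "open V" and m: "C1_on V m" and eq: "\<And>z. z \<in> V \<Longrightarrow> n z = m z" shows "C1_on V n"
proof -
  obtain m' where m': "\<And>z. z \<in> V \<Longrightarrow> (m has_derivative m' z) (at z)" "\<And>v. continuous_on V (\<lambda>z. m' z v)"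
    by (rule C1_onE[OF m]) (rule that)
  show ?thesis
  proof (rule C1_onI[OF _ m'(2)])
    show "(n has_derivative m' z) (at z)" if "z \<in> V" for z
      by (rule has_derivative_transform_within_open[OF m'(1)[OF that] V that]) (simp add: eq)
  qed
qed

lemma C1_on_ln_norm:
  assumes V: "open V" and h: "h holomorphic_on V" and nz: "\<And>z. z \<in> V \<Longrightarrow> h z \<noteq> 0"
  shows "C1_on V (\<lambda>z. of_real (ln (norm (h z))))"
proof (rule C1_on_compose_holomorphic[OF V h])
  show "h ` V \<subseteq> - {0}" using nz by auto
  show "C1_on (- {0}) (\<lambda>w. complex_of_real (ln (norm w)))"
  proof (rule C1_onI)
    fix w :: complex assume "w \<in> - {0}"
    then have w: "w \<noteq> 0" by simp
    have "((\<lambda>w. ln (norm w)) has_derivative (\<lambda>v. inverse (norm w) * (v \<bullet> sgn w))) (at w)"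
    proof -
      have "(norm has_derivative (\<lambda>v. v \<bullet> sgn w)) (at w)"
        using GDERIV_norm[OF w] unfolding gderiv_def .
      from has_derivative_compose[OF this, of ln "\<lambda>x. inverse (norm w) * x"] show ?thesis
        using DERIV_ln[of "norm w"] w by (simp add: has_field_derivative_def)
    qed
    then show "((\<lambda>w. complex_of_real (ln (norm w))) has_derivative (\<lambda>v. of_real (inverse (norm w) * (v \<bullet> sgn w)))) (at w)"
      by (rule has_derivative_of_real)
  next
    show "continuous_on (- {0}) (\<lambda>w. complex_of_real (inverse (norm w) * (v \<bullet> sgn w)))" for v
      by (intro continuous_intros) auto
  qed
qed

text \<open>
  The explicit density shows that \<open>\<mu>\<close> is continuously differentiable and that the polynomial is a
  local isometry. So the invariance of \<open>\<mu>\<close> is that of the quadratic differential \<open>\<nu>\<close>.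
\<close>

lemma harmonic_coefficient_zero:
  assumes U: "open U" and \<phi>: "\<phi> holomorphic_on U" and bij: "bij_betw \<phi> U (- cball 0 1)"
    and PU: "poly P0 ` U \<subseteq> U" and d: "2 \<le> d" and \<phi>P: "\<And>z. z \<in> U \<Longrightarrow> \<phi> (poly P0 z) = \<phi> z ^ d"
    and f: "continuous_on UNIV f" "inj f" and conj: "\<And>z. f (poly P0 z) = poly P1 (f z)"
    and wp: "weak_op_on UNIV (1/2) (- \<i>/2) f p" and wq: "weak_op_on UNIV (1/2) (\<i>/2) f q"
    and p: "locally_integrable p" "p \<in> borel_measurable lebesgue"
    and q: "locally_integrable q" "q \<in> borel_measurable lebesgue"
    and eq: "AE z in lebesgue. z \<in> U \<longrightarrow> q z = \<mu> z * p z"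
    and harm: "harmonic_beltrami_on U \<mu>" and z: "z \<in> U"
  shows "\<mu> z = 0"
proof -
  obtain \<nu> where \<nu>: "\<nu> holomorphic_on U"
    and \<mu>\<nu>: "\<And>z. z \<in> U \<Longrightarrow> \<mu> z = cnj (\<nu> z) / complex_of_real ((hyperbolic_density U z)\<^sup>2)"
    using harm unfolding harmonic_beltrami_on_def by blast
  have inj: "inj_on \<phi> U" and im: "\<phi> ` U = - cball 0 1" using bij by (auto simp: bij_betw_def)
  have n1: "1 < norm (\<phi> z)" if "z \<in> U" for z using im that by force
  have \<phi>nz: "\<phi> z \<noteq> 0" if "z \<in> U" for z using n1[OF that] by auto
  have ln0: "0 < ln (norm (\<phi> z))" if "z \<in> U" for z using n1[OF that] by (rule ln_gt_zero)
  have d\<phi>: "deriv \<phi> z \<noteq> 0" if "z \<in> U" for z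
    using holomorphic_injective_imp_regular[OF \<phi> U inj that] .
  define \<rho> where "\<rho> z = norm (deriv \<phi> z) / (norm (\<phi> z) * ln (norm (\<phi> z)))" for z
  have \<rho>: "hyperbolic_density U z = \<rho> z" if "z \<in> U" for z
    unfolding \<rho>_def by (rule hyperbolic_density_exterior[OF U \<phi> bij that])
  have \<rho>0: "\<rho> z > 0" if "z \<in> U" for z
    unfolding \<rho>_def using ln0[OF that] \<phi>nz[OF that] d\<phi>[OF that] by simp
  have dP: "poly (pderiv P0) z \<noteq> 0" if "z \<in> U" for z
  proof
    assume "poly (pderiv P0) z = 0"
    then have "of_nat d * \<phi> z ^ (d - 1) * deriv \<phi> z = 0"
      using boettcher_deriv[OF U \<phi> PU \<phi>P that] by simp
    then show False using d \<phi>nz[OF that] d\<phi>[OF that] by simp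
  qed
  \<comment> \<open>the polynomial is a local isometry of the hyperbolic metric\<close>
  have iso: "\<rho> (poly P0 z) * norm (poly (pderiv P0) z) = \<rho> z" if "z \<in> U" for z
  proof -
    have "norm (deriv \<phi> (poly P0 z)) * norm (poly (pderiv P0) z) = real d * norm (\<phi> z) ^ (d - 1) * norm (deriv \<phi> z)"
      using arg_cong[OF boettcher_deriv[OF U \<phi> PU \<phi>P that], of norm] by (simp add: norm_mult norm_power)
    moreover have "norm (\<phi> z) ^ d = norm (\<phi> z) ^ (d - 1) * norm (\<phi> z)"
      using d by (intro power_minus_mult[symmetric]) simp
    moreover have "ln (norm (\<phi> z) ^ d) = real d * ln (norm (\<phi> z))"
      using \<phi>nz[OF that] by (simp add: ln_realpow)
    ultimately show ?thesis
      unfolding \<rho>_def \<phi>P[OF that] norm_power using d \<phi>nz[OF that] ln0[OF that] by (simp add: field_simps)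
  qed
  have C\<mu>: "C1_on U \<mu>"
  proof (rule C1_on_transform[OF U])
    define l where "l z = complex_of_real (ln (norm (\<phi> z)))" for z
    have Cl: "C1_on U l" unfolding l_def by (rule C1_on_ln_norm[OF U \<phi> \<phi>nz])
    have C\<phi>: "C1_on U \<phi>" and Cd: "C1_on U (deriv \<phi>)" and C\<nu>: "C1_on U \<nu>"
      by (rule C1_on_holomorphic[OF U], rule \<phi> holomorphic_deriv[OF \<phi> U] \<nu>)+
    show "C1_on U (\<lambda>z. cnj (\<nu> z) * ((\<phi> z * cnj (\<phi> z)) * (l z * l z) * inverse (deriv \<phi> z * cnj (deriv \<phi> z))))"
      by (intro C1_on_mult C1_on_cnj C1_on_inverse C\<nu> C\<phi> Cd Cl) (use d\<phi> in simp)
    fix z assume z: "z \<in> U"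
    have "complex_of_real ((\<rho> z)\<^sup>2) = of_real ((norm (deriv \<phi> z))\<^sup>2) / (of_real ((norm (\<phi> z))\<^sup>2) * (l z)\<^sup>2)"
      unfolding \<rho>_def l_def by (simp add: power_mult_distrib power_divide)
    then have "complex_of_real ((\<rho> z)\<^sup>2) = (deriv \<phi> z * cnj (deriv \<phi> z)) / ((\<phi> z * cnj (\<phi> z)) * (l z)\<^sup>2)"
      unfolding complex_norm_square .
    then show "\<mu> z = cnj (\<nu> z) * ((\<phi> z * cnj (\<phi> z)) * (l z * l z) * inverse (deriv \<phi> z * cnj (deriv \<phi> z)))"
      unfolding \<mu>\<nu>[OF z] \<rho>[OF z] by (simp add: power2_eq_square divide_inverse mult_ac)
  qed
  have \<nu>P: "\<nu> (poly P0 z) * (poly (pderiv P0) z)\<^sup>2 = \<nu> z" if z: "z \<in> U" for z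
  proof -
    let ?w = "poly P0 z" and ?D = "poly (pderiv P0) z"
    have w: "?w \<in> U" using PU z by blast
    have "\<mu> ?w * cnj ?D = \<mu> z * ?D"
      by (rule beltrami_coefficient_invariant[OF U f wp wq p(1) q(1) p(2) q(2) eq C\<mu> conj PU z dP[OF z]])
    then have "cnj (\<nu> ?w) / of_real ((\<rho> ?w)\<^sup>2) * cnj ?D = cnj (\<nu> z) / of_real ((\<rho> z)\<^sup>2) * ?D"
      unfolding \<mu>\<nu>[OF z] \<mu>\<nu>[OF w] \<rho>[OF z] \<rho>[OF w] .
    also have "complex_of_real ((\<rho> z)\<^sup>2) = of_real ((\<rho> ?w)\<^sup>2) * (?D * cnj ?D)"
      unfolding iso[OF z, symmetric] power_mult_distrib of_real_mult complex_norm_square ..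
    finally have "cnj (\<nu> ?w) * cnj ?D * cnj ?D = cnj (\<nu> z)"
      using \<rho>0[OF w] dP[OF z] by (simp add: field_simps)
    then have "cnj (\<nu> ?w * ?D\<^sup>2) = cnj (\<nu> z)" by (simp add: power2_eq_square mult_ac)
    then show ?thesis by (simp only: complex_cnj_cancel_iff)
  qed
  have "\<nu> z = 0"
    by (rule invariant_quadratic_differential_zero[OF U \<phi> bij PU \<phi>P d \<nu> \<nu>P z])
  then show ?thesis using \<mu>\<nu>[OF z] by simp
qed

section \<open>The power map and polynomials near infinity\<close>

text \<open>
  The map in the coordinate \<open>v = 1 / z\<close>; the singularity at \<open>v = 0\<close> is removable.
\<close>

lemma inversion_holomorphic_injective:
  assumes h: "h holomorphic_on {z. R < norm z}" and inj: "inj_on h {z. R < norm z}" and R: "0 < R"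
    and nz: "\<And>z. R < norm z \<Longrightarrow> h z \<noteq> 0" and inf: "filterlim h at_infinity at_infinity"
    and g: "\<And>v. g v = (if v = 0 then 0 else inverse (h (inverse v)))"
  shows "g holomorphic_on ball 0 (1 / R)" "inj_on g (ball 0 (1 / R))"
proof -
  let ?r = "1 / R"
  have inv: "R < norm (inverse v)" if v: "v \<in> ball 0 ?r - {0}" for v :: complex
  proof -
    have "R * norm v < 1" "0 < norm v" using v R by (auto simp: pos_less_divide_eq mult.commute)
    then show ?thesis by (simp add: norm_divide pos_less_divide_eq inverse_eq_divide del: norm_inverse)
  qed
  have lim0: "(g \<longlongrightarrow> 0) (at 0)"
  proof -
    have "filterlim (\<lambda>u. h (inverse u)) at_infinity (at 0)"
      by (rule filterlim_compose[OF inf filterlim_inverse_at_infinity])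
    then have "((\<lambda>u. inverse (h (inverse u))) \<longlongrightarrow> 0) (at 0)"
      by (rule filterlim_compose[OF tendsto_inverse_0])
    then show ?thesis
      by (rule Lim_transform_eventually) (auto simp: eventually_at g intro!: exI[of _ 1])
  qed
  show "g holomorphic_on ball 0 ?r"
  proof (rule no_isolated_singularity'[of "{0}"])
    have "(g \<longlongrightarrow> g 0) (at 0 within ball 0 ?r)"
      using Lim_at_imp_Lim_at_within[OF lim0, of "ball 0 ?r"] by (simp add: g)
    then show "(g \<longlongrightarrow> g z) (at z within ball 0 ?r)" if "z \<in> {0}" for z using that by simp
    have im: "inverse ` (ball 0 ?r - {0}) \<subseteq> {z :: complex. R < norm z}" using inv by blast
    have hi: "inverse holomorphic_on (ball 0 ?r - {0::complex})" by (intro holomorphic_intros) auto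
    have "(\<lambda>u. h (inverse u)) holomorphic_on (ball 0 ?r - {0})"
      using holomorphic_on_compose_gen[OF hi h im] by (simp only: o_def)
    then have "(\<lambda>u. inverse (h (inverse u))) holomorphic_on (ball 0 ?r - {0})"
      by (rule holomorphic_on_inverse) (use nz[OF inv] in blast)
    then show "g holomorphic_on (ball 0 ?r - {0})"
      by (rule holomorphic_transform) (simp add: g)
  qed auto
  have g0: "g v \<noteq> 0" if "v \<in> ball 0 ?r - {0}" for v using nz[OF inv[OF that]] that by (simp add: g)
  show "inj_on g (ball 0 ?r)"
  proof (rule inj_onI)
    fix u v assume uv: "u \<in> ball 0 ?r" "v \<in> ball 0 ?r" "g u = g v"
    show "u = v"
    proof (cases "u = 0 \<or> v = 0")
      case True
      then show ?thesis using uv g0 by (metis g Diff_iff empty_iff insert_iff)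
    next
      case False
      then have "h (inverse u) = h (inverse v)" using uv(3) by (simp add: g)
      moreover have "R < norm (inverse u)" "R < norm (inverse v)" using inv uv False by blast+
      ultimately have "inverse u = inverse v" using inj_onD[OF inj] by blast
      then show ?thesis by simp
    qed
  qed
qed

text \<open>
  In the coordinate \<open>u = 1 / w\<close> the map becomes an injective holomorphic map \<open>B\<close> of the disk that fixes
  0. With \<open>x = norm (B u) / norm u\<close>, the functional equation gives \<open>x ^ (d ^ n)\<close> at the point
  \<open>u ^ (d ^ n)\<close>, and this tends to \<open>norm (deriv B 0)\<close>, which is positive and finite. So \<open>x = 1\<close>, and
  the equality case of the Schwarz lemma applies.
\<close>

lemma power_conjugacy_rotation:
  assumes A: "A holomorphic_on (- cball 0 1)" and im: "A ` (- cball 0 1) \<subseteq> - cball 0 1"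
    and inj: "inj_on A (- cball 0 1)" and inf: "filterlim A at_infinity at_infinity"
    and d: "2 \<le> d" and pw: "\<And>w. w \<in> - cball 0 1 \<Longrightarrow> A (w ^ d) = A w ^ d"
  obtains \<omega> where "\<omega> ^ (d - 1) = 1" "\<And>w. w \<in> - cball 0 1 \<Longrightarrow> A w = \<omega> * (w::complex)"
proof -
  define B where "B u = (if u = 0 then 0 else inverse (A (inverse u)))" for u
  have inE: "inverse u \<in> - cball 0 1" if "u \<in> ball 0 1 - {0}" for u :: complex
    using that one_less_inverse[of "norm u"] by (auto simp: norm_inverse not_le)
  have AE: "1 < norm (A w)" if "w \<in> - cball 0 1" for w using im that by force
  have Bn: "norm (B u) < 1" if "norm u < 1" for u
  proof (cases "u = 0")
    case False
    then have "1 < norm (A (inverse u))" using AE[OF inE] that by simp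
    then show ?thesis using False by (simp add: B_def norm_inverse inverse_less_1_iff)
  qed (simp add: B_def)
  have E: "{z :: complex. 1 < norm z} = - cball 0 1" by auto
  have nzA: "A z \<noteq> 0" if "1 < norm z" for z using AE[of z] that by auto
  have hB: "B holomorphic_on ball 0 1" and injB: "inj_on B (ball 0 1)"
    using inversion_holomorphic_injective[of A 1, unfolded E, OF A inj zero_less_one nzA inf B_def] by simp_all
  define b where "b = deriv B 0"
  have b0: "b \<noteq> 0"
    unfolding b_def by (rule holomorphic_injective_imp_regular[OF hB open_ball injB]) simp
  have "(B has_field_derivative b) (at 0)"
    unfolding b_def by (rule holomorphic_derivI[OF hB open_ball]) simp
  then have lim: "((\<lambda>u. B u / u) \<longlongrightarrow> b) (at 0)"
    unfolding DERIV_def by (simp add: B_def)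
  have Bpow: "B (u ^ d) = B u ^ d" if "u \<in> ball 0 1 - {0}" for u
    using pw[OF inE[OF that]] that by (simp add: B_def power_inverse)
  have nB: "norm (B u) = norm u" if u: "u \<in> ball 0 1 - {0}" for u
  proof -
    define x where "x = norm (B u) / norm u"
    define U where "U n = u ^ (d ^ n)" for n
    have Un: "U n \<in> ball 0 1 - {0}" for n
      using u d by (auto simp: U_def norm_power power_less_one_iff)
    have U1: "U (Suc n) = U n ^ d" for n unfolding U_def by (simp add: power_mult[symmetric] mult.commute)
    have xn: "norm (B (U n) / U n) = x ^ (d ^ n)" for n
    proof (induction n)
      case 0 then show ?case by (simp add: U_def x_def norm_divide)
    next
      case (Suc n)
      have "norm (B (U (Suc n)) / U (Suc n)) = norm (B (U n) / U n) ^ d"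
        unfolding U1 Bpow[OF Un] by (simp add: norm_divide norm_power power_divide)
      then show ?case using Suc.IH by (simp add: power_mult[symmetric] mult.commute)
    qed
    have limd: "filterlim (\<lambda>n. d ^ n) sequentially sequentially"
      using d by (intro filterlim_subseq strict_monoI_Suc) simp
    have U0: "U \<longlonglongrightarrow> 0"
      unfolding U_def by (rule filterlim_compose[OF LIMSEQ_power_zero limd]) (use u in simp)
    have "filterlim U (at 0) sequentially"
      using U0 Un by (auto simp: filterlim_at)
    then have "(\<lambda>n. B (U n) / U n) \<longlonglongrightarrow> b" by (rule filterlim_compose[OF lim])
    then have xl: "(\<lambda>n. x ^ (d ^ n)) \<longlonglongrightarrow> norm b"
      using tendsto_norm[of "\<lambda>n. B (U n) / U n" b] by (simp only: xn)
    have x0: "0 \<le> x" unfolding x_def by simp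
    have "norm b = norm b ^ d"
    proof (rule LIMSEQ_unique)
      show "(\<lambda>n. x ^ (d ^ Suc n)) \<longlonglongrightarrow> norm b" using LIMSEQ_Suc[OF xl] .
      have "(\<lambda>n. (x ^ (d ^ n)) ^ d) \<longlonglongrightarrow> norm b ^ d" by (intro tendsto_intros xl)
      then show "(\<lambda>n. x ^ (d ^ Suc n)) \<longlonglongrightarrow> norm b ^ d"
        by (simp add: power_mult[symmetric] mult.commute)
    qed
    then have "norm b * (norm b ^ (d - 1) - 1) = 0"
      using power_minus_mult[of d "norm b"] d by (simp add: algebra_simps)
    then have "norm b ^ (d - 1) = 1" using b0 by simp
    then have b1: "norm b = 1" using power_eq_1_iff[of "norm b" "d - 1"] d by simp
    have "\<not> x < 1"
    proof
      assume x1: "x < 1"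
      have "x ^ (d ^ n) \<le> x" for n
        using power_decreasing[of 1 "d ^ n" x] x0 x1 d by simp
      then have "norm b \<le> x" using xl by (intro LIMSEQ_le_const2) auto
      then show False using b1 x1 by simp
    qed
    moreover have "\<not> x > 1"
    proof
      assume x1: "x > 1"
      have "x \<le> x ^ (d ^ n)" for n
        using power_increasing[of 1 "d ^ n" x] x1 d by simp
      then have "x \<le> norm b" using xl by (intro LIMSEQ_le_const) auto
      then show False using b1 x1 by simp
    qed
    ultimately have "x = 1" by simp
    then show ?thesis using u unfolding x_def by simp
  qed
  have B00: "B 0 = 0" unfolding B_def by simp
  have "\<exists>z. norm z < 1 \<and> z \<noteq> 0 \<and> norm (B z) = norm z"
    using nB[of "1/2"] by (intro exI[of _ "1/2"]) (simp add: norm_divide)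
  then obtain \<alpha> where \<alpha>: "\<And>z. norm z < 1 \<Longrightarrow> B z = \<alpha> * z" "norm \<alpha> = 1"
    using Schwarz_Lemma(3)[OF hB B00 Bn, of 0] by auto
  define \<omega> where "\<omega> = inverse \<alpha>"
  have \<alpha>0: "\<alpha> \<noteq> 0" using \<alpha>(2) by auto
  have main: "A w = \<omega> * w" if w: "w \<in> - cball 0 1" for w
  proof -
    have w0: "w \<noteq> 0" and w1: "norm (inverse w) < 1" using w by (auto simp: norm_inverse inverse_less_1_iff)
    have "inverse (A w) = \<alpha> * inverse w" using \<alpha>(1)[OF w1] w0 by (simp add: B_def)
    then show ?thesis unfolding \<omega>_def by (metis inverse_inverse_eq inverse_mult_distrib)
  qed
  have "\<omega> * 2 ^ d = (\<omega> * 2) ^ d"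
  proof -
    have "(2::real) ^ 1 \<le> 2 ^ d" using d by (intro power_increasing) auto
    then have "(2::complex) ^ d \<in> - cball 0 1" by (simp add: norm_power)
    moreover have "(2::complex) \<in> - cball 0 1" by simp
    ultimately show ?thesis using pw[of 2] main by simp
  qed
  then have "\<omega> = \<omega> ^ d" by (simp add: power_mult_distrib)
  then have "\<omega> * (\<omega> ^ (d - 1) - 1) = 0"
    using power_minus_mult[of d \<omega>] d by (simp add: algebra_simps)
  then have "\<omega> ^ (d - 1) = 1" using \<alpha>0 unfolding \<omega>_def by simp
  then show thesis using main that by blast
qed

lemma monic_poly_near_infinity:
  assumes deg: "degree P = d" and lc: "lead_coeff P = 1" and M: "\<And>k. k < d \<Longrightarrow> norm (coeff P k) \<le> M"
    and z: "1 \<le> norm z"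
  shows "norm (poly P z / z ^ d - 1) \<le> real d * M / norm (z::complex)"
proof (cases "d = 0")
  case True
  then have "P = [:1:]" using deg lc by (metis degree_0_id lead_coeff_pCons(2) degree_eq_zeroE pCons_eq_0_iff)
  then show ?thesis using True by simp
next
  case False
  have z0: "z \<noteq> 0" using z by auto
  have "poly P z = (\<Sum>i<d. coeff P i * z ^ i) + z ^ d"
    unfolding poly_altdef deg lessThan_Suc_atMost[symmetric] using lc deg by simp
  then have "norm (poly P z / z ^ d - 1) = norm (\<Sum>i<d. coeff P i * z ^ i) / norm z ^ d"
    using z0 by (simp add: field_simps norm_divide norm_power)
  also have "\<dots> \<le> (real d * M * norm z ^ (d - 1)) / norm z ^ d"
  proof (rule divide_right_mono)
    have "norm (\<Sum>i<d. coeff P i * z ^ i) \<le> (\<Sum>i<d. M * norm z ^ (d - 1))"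
    proof (rule sum_norm_le)
      fix i assume "i \<in> {..<d}"
      then have i: "i < d" by simp
      have "norm z ^ i \<le> norm z ^ (d - 1)" using z i by (intro power_increasing) auto
      then show "norm (coeff P i * z ^ i) \<le> M * norm z ^ (d - 1)"
        unfolding norm_mult norm_power using M[OF i] by (intro mult_mono) (auto intro: order_trans[OF norm_ge_zero])
    qed
    then show "norm (\<Sum>i<d. coeff P i * z ^ i) \<le> real d * M * norm z ^ (d - 1)" by (simp add: mult.assoc)
  qed simp
  also have "\<dots> = real d * M / norm z"
    using z0 power_minus_mult[of d "norm z"] False by (simp add: field_simps)
  finally show ?thesis .
qed

text \<open>
  Large enough for \<open>norm (poly P z / z ^ d - 1) \<le> 1 / 8\<close>, for \<open>norm (poly P z) \<ge> 2 * norm z\<close>, and for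
  the logarithm in the estimate of the Boettcher coordinate to be small.
\<close>

definition escape_radius :: "nat \<Rightarrow> real \<Rightarrow> real" where
  "escape_radius d M = 4 + 8 * (real d * M)"

lemma monic_poly_escape:
  assumes deg: "degree P = d" and lc: "lead_coeff P = 1" and M: "\<And>k. k < d \<Longrightarrow> norm (coeff P k) \<le> M"
    and d: "2 \<le> d" and z: "escape_radius d M < norm z"
  shows "norm (poly P z / z ^ d - 1) \<le> 1 / 8" "2 * norm (z::complex) \<le> norm (poly P z)"
proof -
  have "0 \<le> M" using M[of 0] d by (auto intro: order_trans[OF norm_ge_zero])
  then have C0: "0 \<le> real d * M" by simp
  have z4: "4 < norm z" and zC: "8 * (real d * M) \<le> norm z" using z C0 unfolding escape_radius_def by auto
  have "norm (poly P z / z ^ d - 1) \<le> real d * M / norm z"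
    by (rule monic_poly_near_infinity[OF deg lc M]) (use z4 in auto)
  also have "\<dots> \<le> 1 / 8" using zC z4 by (subst pos_divide_le_eq) auto
  finally show 1: "norm (poly P z / z ^ d - 1) \<le> 1 / 8" .
  have "norm (1::complex) - norm (poly P z / z ^ d - 1) \<le> norm (poly P z / z ^ d)"
    using norm_triangle_ineq2[of 1 "1 - poly P z / z ^ d"] by (simp add: norm_minus_commute)
  then have "7 / 8 \<le> norm (poly P z / z ^ d)" using 1 by simp
  then have "7 / 8 \<le> norm (poly P z) / norm z ^ d" unfolding norm_divide norm_power .
  moreover have "0 < norm z ^ d" using z4 by (intro zero_less_power) linarith
  ultimately have "7 / 8 * norm z ^ d \<le> norm (poly P z)" by (simp only: pos_le_divide_eq)
  moreover have "norm z ^ 2 \<le> norm z ^ d" using z4 d by (intro power_increasing) auto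
  moreover have "4 * norm z \<le> norm z ^ 2" unfolding power2_eq_square by (rule mult_right_mono) (use z4 in auto)
  ultimately show "2 * norm z \<le> norm (poly P z)" using z4 by linarith
qed

lemma norm_exp_minus_one_le:
  fixes z :: complex assumes "norm z \<le> 1/2" shows "norm (exp z - 1) \<le> 2 * norm z"
proof -
  have "norm (exp z - exp 0) \<le> 2 * norm (z - 0)"
  proof (rule field_differentiable_bound[of "cball 0 (1/2)" exp exp])
    show "(exp has_field_derivative exp w) (at w within cball 0 (1/2))" for w :: complex
      by (rule DERIV_subset[OF DERIV_exp]) simp
    show "norm (exp w) \<le> 2" if "w \<in> cball 0 (1/2)" for w :: complex
      using that by (intro exp_bound_half) simp
  qed (use assms in auto)
  then show ?thesis by simp
qed

text \<open>
  In the coordinate \<open>v = 1 / z\<close> let \<open>L v\<close> be the logarithm of \<open>\<phi> z / z\<close> that vanishes at \<open>v = 0\<close>, and let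
  \<open>s v = 1 / poly P z\<close>. The functional equation becomes \<open>d * L v = L (s v) + Ln (1 + e v)\<close>: both sides
  are continuous logarithms of the same function and agree at 0. Here \<open>norm (e v) \<le> C * norm v\<close>, so
  \<open>norm (L v) \<le> norm (L (s v)) / 2 + C * norm v\<close>, and iteration along the orbit \<open>s ^^ n\<close>, which tends to
  0, yields \<open>norm (L v) \<le> 2 * C * norm v\<close>. The bound depends only on \<open>d\<close> and \<open>M\<close>.
\<close>

lemma boettcher_near_identity:
  fixes \<phi> :: "complex \<Rightarrow> complex"
  assumes deg: "degree P = d" and lc: "lead_coeff P = 1" and M: "\<And>k. k < d \<Longrightarrow> norm (coeff P k) \<le> M"
    and d: "2 \<le> d"
    and cont: "continuous_on {z. escape_radius d M < norm z} \<phi>"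
    and nz: "\<And>z. escape_radius d M < norm z \<Longrightarrow> \<phi> z \<noteq> 0"
    and conj: "\<And>z. escape_radius d M < norm z \<Longrightarrow> \<phi> (poly P z) = \<phi> z ^ d"
    and lim: "((\<lambda>z. \<phi> z / z) \<longlongrightarrow> 1) at_infinity"
    and z: "escape_radius d M < norm z"
  shows "norm (\<phi> z / z - 1) \<le> 4 * (real d * M) / norm z"
proof -
  define R where "R = escape_radius d M"
  define C where "C = real d * M"
  have "0 \<le> M" using M[of 0] d by (auto intro: order_trans[OF norm_ge_zero])
  then have C0: "0 \<le> C" unfolding C_def by simp
  have R: "R = 4 + 8 * C" unfolding R_def escape_radius_def C_def by simp
  have R0: "4 \<le> R" using R C0 by simp
  define r where "r = 1 / R"
  have r0: "0 < r" using R0 by (simp add: r_def)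
  have inv: "R < norm (1 / v)" if "v \<in> ball 0 r - {0}" for v :: complex
  proof -
    have "norm v < 1 / R" "0 < norm v" using that by (auto simp: r_def)
    then show ?thesis using R0 by (simp add: norm_divide field_simps)
  qed
  define u where "u v = (if v = 0 then 1 else \<phi> (1 / v) * v)" for v
  define s where "s v = (if v = 0 then 0 else 1 / poly P (1 / v))" for v
  define e where "e v = (if v = 0 then 0 else poly P (1 / v) * v ^ d - 1)" for v
  have e_eq: "poly P (1 / v) * v ^ d = poly P (1 / v) / (1 / v) ^ d" for v :: complex
    by (simp add: power_one_over)
  have e_le: "norm (e v) \<le> C * norm v" "norm (e v) \<le> 1 / 8" if v: "v \<in> ball 0 r" for v
  proof -
    have "norm (e v) \<le> C * norm v \<and> norm (e v) \<le> 1 / 8"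
    proof (cases "v = 0")
      case False
      then have i: "R < norm (1 / v)" using inv v by blast
      then have "1 \<le> norm (1 / v)" using R0 by linarith
      from monic_poly_near_infinity[OF deg lc M this] monic_poly_escape(1)[OF deg lc M d i[unfolded R_def]]
      show ?thesis using False by (simp add: e_def e_eq C_def norm_divide)
    qed (use C0 in \<open>simp add: e_def\<close>)
    then show "norm (e v) \<le> C * norm v" "norm (e v) \<le> 1 / 8" by auto
  qed
  have s_le: "norm (s v) \<le> norm v / 2" if v: "v \<in> ball 0 r" for v
  proof (cases "v = 0")
    case False
    then have i: "R < norm (1 / v)" using inv v by blast
    from monic_poly_escape(2)[OF deg lc M d i[unfolded R_def]]
    have "2 / norm v \<le> norm (poly P (1 / v))" by (simp add: norm_divide)
    moreover have "0 < 2 / norm v" using False by simp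
    ultimately have "1 / norm (poly P (1 / v)) \<le> 1 / (2 / norm v)"
      by (intro divide_left_mono mult_pos_pos) auto
    then show ?thesis using False by (simp add: s_def norm_divide)
  qed (simp add: s_def)
  have s_in: "s v \<in> ball 0 r" if "v \<in> ball 0 r" for v
  proof -
    have "norm (s v) < r" using s_le[OF that] that norm_ge_zero[of v] unfolding mem_ball_0 by linarith
    then show ?thesis by simp
  qed
  have Pnz: "poly P (1 / v) \<noteq> 0" if "v \<in> ball 0 r - {0}" for v
    using monic_poly_escape(2)[OF deg lc M d inv[OF that, unfolded R_def]] that by auto
  have s_nz: "s v \<noteq> 0" if "v \<in> ball 0 r - {0}" for v using Pnz[OF that] that by (simp add: s_def)

  have contI: "continuous_on (ball 0 r) h"
    if c: "continuous_on (ball 0 r - {0}) h" and l: "(h \<longlongrightarrow> h 0) (at 0)" for h :: "complex \<Rightarrow> complex"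
  proof (rule continuous_at_imp_continuous_on, rule ballI)
    fix x :: complex assume x: "x \<in> ball 0 r"
    show "isCont h x"
    proof (cases "x = 0")
      case True
      then show ?thesis using l by (simp add: isCont_def)
    next
      case False
      have "open (ball 0 r - {0::complex})" by (intro open_delete open_ball)
      then show ?thesis using c x False by (metis Diff_iff continuous_on_eq_continuous_at singletonD)
    qed
  qed
  have lin: "\<And>h k. (\<And>v. v \<in> ball 0 r \<Longrightarrow> norm (h v) \<le> k * norm v) \<Longrightarrow> (h \<longlongrightarrow> (0::complex)) (at (0::complex))"
  proof -
    fix h :: "complex \<Rightarrow> complex" and k assume h: "\<And>v. v \<in> ball 0 r \<Longrightarrow> norm (h v) \<le> k * norm v"
    have "((\<lambda>v::complex. k * norm v) \<longlongrightarrow> 0) (at 0)"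
      by (intro tendsto_mult_right_zero tendsto_norm_zero tendsto_ident_at)
    moreover have "\<forall>\<^sub>F v in at 0. norm (h v) \<le> k * norm v"
      unfolding eventually_at using h r0 by (intro exI[of _ r]) (auto simp: dist_norm)
    ultimately show "(h \<longlongrightarrow> 0) (at 0)" by (rule Lim_null_comparison[rotated])
  qed
  have cu: "continuous_on (ball 0 r) u"
  proof (rule contI)
    have "continuous_on (ball 0 r - {0}) (\<lambda>v. \<phi> (1 / v) * v)"
      by (intro continuous_on_mult continuous_on_id continuous_on_compose2[OF cont] continuous_on_divide continuous_on_const)
         (use inv in \<open>auto simp: R_def\<close>)
    then show "continuous_on (ball 0 r - {0}) u" by (rule continuous_on_eq) (simp add: u_def)
    have "((\<lambda>v. \<phi> (inverse v) / inverse v) \<longlongrightarrow> 1) (at 0)"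
      by (rule filterlim_compose[OF lim filterlim_inverse_at_infinity])
    then have "(u \<longlongrightarrow> 1) (at 0)"
      by (rule Lim_transform_eventually) (auto simp: eventually_at u_def field_simps intro!: exI[of _ 1])
    then show "(u \<longlongrightarrow> u 0) (at 0)" by (simp add: u_def)
  qed
  have cs: "continuous_on (ball 0 r) s"
  proof (rule contI)
    have "continuous_on (ball 0 r - {0}) (\<lambda>v. 1 / poly P (1 / v))"
      by (intro continuous_on_divide continuous_on_const continuous_on_poly continuous_on_id ballI Pnz) auto
    then show "continuous_on (ball 0 r - {0}) s" by (rule continuous_on_eq) (simp add: s_def)
    have "(s \<longlongrightarrow> 0) (at 0)" by (rule lin[where k = "1/2"]) (use s_le in simp)
    then show "(s \<longlongrightarrow> s 0) (at 0)" by (simp add: s_def)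
  qed
  have ce: "continuous_on (ball 0 r) e"
  proof (rule contI)
    have "continuous_on (ball 0 r - {0}) (\<lambda>v. poly P (1 / v) * v ^ d - 1)"
      by (intro continuous_on_mult continuous_on_diff continuous_on_power continuous_on_divide continuous_on_const continuous_on_poly continuous_on_id ballI) auto
    then show "continuous_on (ball 0 r - {0}) e" by (rule continuous_on_eq) (simp add: e_def)
    have "(e \<longlongrightarrow> 0) (at 0)" by (rule lin[OF e_le(1)])
    then show "(e \<longlongrightarrow> e 0) (at 0)" by (simp add: e_def)
  qed
  have unz: "u v \<noteq> 0" if "v \<in> ball 0 r" for v
  proof (cases "v = 0")
    case False
    then show ?thesis using nz[of "1 / v"] inv[of v] that by (simp add: u_def R_def)
  qed (simp add: u_def)
  obtain l where l: "continuous_on (ball 0 r) l" and ul: "\<And>v. v \<in> ball 0 r \<Longrightarrow> u v = exp (l v)"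
    using continuous_logarithm_on_ball[OF cu unz] by blast
  define L where "L v = l v - l 0" for v
  have z0: "0 \<in> ball 0 r" using r0 by simp
  have cL: "continuous_on (ball 0 r) L" unfolding L_def by (intro continuous_on_diff l continuous_on_const)
  have uL: "u v = exp (L v)" if "v \<in> ball 0 r" for v
    unfolding L_def exp_diff ul[OF that, symmetric] ul[OF z0, symmetric] by (simp add: u_def)
  have L0: "L 0 = 0" unfolding L_def by simp
  have ne1: "1 + e v \<notin> \<real>\<^sub>\<le>\<^sub>0" if "v \<in> ball 0 r" for v
  proof -
    have "\<bar>Re (e v)\<bar> \<le> 1 / 8" using e_le(2)[OF that] abs_Re_le_cmod order_trans by blast
    then have "0 < Re (1 + e v)" by simp
    then show ?thesis using complex_nonpos_Reals_iff by force
  qed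
  define N where "N v = of_nat d * L v - L (s v) - Ln (1 + e v)" for v
  have cN: "continuous_on (ball 0 r) N"
    unfolding N_def
    by (intro continuous_on_diff continuous_on_mult continuous_on_const cL continuous_on_compose2[OF cL cs]
        continuous_on_Ln' continuous_on_add ce ne1) (use s_in in auto)
  have expN: "exp (N v) = 1" if v: "v \<in> ball 0 r" for v
  proof -
    have "1 + e v \<noteq> 0" using ne1[OF v] by auto
    then have "exp (N v) = u v ^ d / u (s v) / (1 + e v)"
      unfolding N_def exp_diff uL[OF v] uL[OF s_in[OF v]] by (simp add: exp_of_nat_mult)
    also have "\<dots> = 1"
    proof (cases "v = 0")
      case False
      then have v': "v \<in> ball 0 r - {0}" using v by blast
      have i: "escape_radius d M < norm (1 / v)" using inv[OF v'] unfolding R_def .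
      have "\<phi> (poly P (1 / v)) \<noteq> 0" using conj[OF i] nz[OF i] by simp
      then show ?thesis
        using False s_nz[OF v'] Pnz[OF v'] conj[OF i] nz[OF i]
        by (simp add: u_def e_def s_def power_mult_distrib)
    qed (use d in \<open>simp add: u_def s_def e_def\<close>)
    finally show ?thesis .
  qed
  have "N constant_on ball 0 r"
  proof (rule continuous_discrete_range_constant[OF _ cN])
    fix x :: complex assume x: "x \<in> ball 0 r"
    show "\<exists>e>0. \<forall>y. y \<in> ball 0 r \<and> N y \<noteq> N x \<longrightarrow> e \<le> norm (N y - N x)"
    proof (intro exI[of _ 1] conjI allI impI)
      fix y assume y: "y \<in> ball 0 r \<and> N y \<noteq> N x"
      show "1 \<le> norm (N y - N x)"
      proof (rule ccontr)
        assume "\<not> 1 \<le> norm (N y - N x)"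
        then have "\<bar>Im (N y) - Im (N x)\<bar> < 1" using abs_Im_le_cmod[of "N y - N x"] by simp
        then have "\<bar>Im (N y) - Im (N x)\<bar> < 2 * pi" using pi_gt3 by linarith
        then have "N y = N x" by (rule exp_complex_eqI) (use expN x y in simp)
        then show False using y by blast
      qed
    qed simp
  qed simp
  then have N0: "N v = 0" if "v \<in> ball 0 r" for v
  proof -
    have "N v = N 0" using \<open>N constant_on ball 0 r\<close> that z0 unfolding constant_on_def by metis
    then show ?thesis by (simp add: N_def s_def e_def L0)
  qed
  have step: "norm (L v) \<le> norm (L (s v)) / 2 + C * norm v" if v: "v \<in> ball 0 r" for v
  proof -
    have "of_nat d * L v = L (s v) + Ln (1 + e v)" using N0[OF v] by (simp add: N_def algebra_simps)
    then have "real d * norm (L v) = norm (L (s v) + Ln (1 + e v))" by (metis norm_mult norm_of_nat)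
    also have "\<dots> \<le> norm (L (s v)) + norm (Ln (1 + e v))" by (rule norm_triangle_ineq)
    also have "norm (Ln (1 + e v)) \<le> 2 * norm (e v)" by (rule norm_Ln_le) (use e_le(2)[OF v] in simp)
    also have "2 * norm (e v) \<le> 2 * (C * norm v)" using e_le(1)[OF v] by simp
    finally have "real d * norm (L v) \<le> norm (L (s v)) + 2 * (C * norm v)" by simp
    moreover have "2 * norm (L v) \<le> real d * norm (L v)" using d by (intro mult_right_mono) auto
    ultimately show ?thesis by linarith
  qed
  have iter: "norm ((s ^^ n) v) \<le> norm v \<and> norm (L v) \<le> norm (L ((s ^^ n) v)) / 2 ^ n + 2 * C * norm v"
    if "v \<in> ball 0 r" for n v
    using that
  proof (induction n arbitrary: v)
    case 0
    have "0 \<le> 2 * C * norm v" using C0 by simp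
    then show ?case by simp
  next
    case (Suc n)
    let ?w = "(s ^^ n) (s v)"
    have w: "(s ^^ Suc n) v = ?w" by (simp only: funpow_Suc_right comp_apply)
    have IH: "norm ?w \<le> norm (s v)" "norm (L (s v)) \<le> norm (L ?w) / 2 ^ n + 2 * C * norm (s v)"
      using Suc.IH[OF s_in[OF Suc.prems]] by blast+
    have sv: "norm (s v) \<le> norm v / 2" by (rule s_le[OF Suc.prems])
    have "2 * C * norm (s v) \<le> 2 * C * (norm v / 2)" using sv C0 by (intro mult_left_mono) auto
    then have "norm (L (s v)) \<le> norm (L ?w) / 2 ^ n + C * norm v" using IH(2) by simp
    then have "norm (L (s v)) / 2 \<le> (norm (L ?w) / 2 ^ n + C * norm v) / 2"
      by (rule divide_right_mono) simp
    then have "norm (L v) \<le> (norm (L ?w) / 2 ^ n + C * norm v) / 2 + C * norm v"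
      using order_trans[OF step[OF Suc.prems] add_right_mono] by blast
    also have "\<dots> = norm (L ?w) / 2 ^ Suc n + 3 / 2 * (C * norm v)"
      by (simp add: add_divide_distrib)
    also have "3 / 2 * (C * norm v) \<le> 2 * (C * norm v)" using C0 by (intro mult_right_mono) auto
    finally have "norm (L v) \<le> norm (L ?w) / 2 ^ Suc n + 2 * C * norm v" by (simp only: mult.assoc)
    moreover have "norm ?w \<le> norm v" using IH(1) sv norm_ge_zero[of v] by linarith
    ultimately show ?case unfolding w by blast
  qed
  define v where "v = 1 / z"
  have zR: "R < norm z" using z unfolding R_def .
  have znz: "z \<noteq> 0" using zR R0 by auto
  have "1 / norm z < 1 / R" using zR R0 by (intro divide_strict_left_mono mult_pos_pos) auto
  then have v: "v \<in> ball 0 r" by (simp add: v_def r_def norm_divide)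
  have Lv: "norm (L v) \<le> 2 * C * norm v"
  proof -
    have sub: "cball 0 (norm v) \<subseteq> ball 0 r" using v by auto
    have "bounded (L ` cball 0 (norm v))"
      by (intro compact_imp_bounded compact_continuous_image continuous_on_subset[OF cL sub] compact_cball)
    then obtain K where K: "\<And>w. w \<in> cball 0 (norm v) \<Longrightarrow> norm (L w) \<le> K"
      unfolding bounded_iff by blast
    have bd: "norm (L v) \<le> K * (1 / 2) ^ n + 2 * C * norm v" for n
    proof -
      have "norm ((s ^^ n) v) \<le> norm v" by (rule conjunct1[OF iter[OF v]])
      then have "norm (L ((s ^^ n) v)) \<le> K" by (intro K) (simp only: mem_cball_0)
      then have "norm (L ((s ^^ n) v)) / 2 ^ n \<le> K / 2 ^ n" by (rule divide_right_mono) simp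
      then have "norm (L v) \<le> K / 2 ^ n + 2 * C * norm v"
        by (rule order_trans[OF conjunct2[OF iter[OF v]] add_right_mono])
      moreover have "K / 2 ^ n = K * (1 / 2) ^ n" by (simp add: power_one_over)
      ultimately show ?thesis by (simp only:)
    qed
    have le: "\<exists>N. \<forall>n\<ge>N. norm (L v) \<le> K * (1 / 2) ^ n + 2 * C * norm v"
      using bd by (intro exI[of _ 0] allI impI)
    have "(\<lambda>n. (1 / 2 :: real) ^ n) \<longlonglongrightarrow> 0" by (rule LIMSEQ_power_zero) simp
    then have "(\<lambda>n. K * (1 / 2) ^ n + 2 * C * norm v) \<longlonglongrightarrow> K * 0 + 2 * C * norm v"
      by (intro tendsto_add tendsto_mult tendsto_const)
    from LIMSEQ_le_const[OF this le] show ?thesis by simp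
  qed
  have half: "2 * C * norm v \<le> 1 / 2"
  proof -
    have "norm v \<le> 1 / R" using v by (simp add: r_def)
    then have "2 * C * norm v \<le> 2 * C * (1 / R)" using C0 by (intro mult_left_mono) auto
    also have "\<dots> \<le> 1 / 2" using R C0 by (simp add: field_simps)
    finally show ?thesis .
  qed
  have "\<phi> z / z = u v" unfolding u_def v_def using znz by simp
  then have "norm (\<phi> z / z - 1) = norm (exp (L v) - 1)" using uL[OF v] by simp
  also have "\<dots> \<le> 2 * norm (L v)" by (rule norm_exp_minus_one_le) (use Lv half in linarith)
  also have "\<dots> \<le> 4 * C * norm v" using Lv by simp
  finally show ?thesis unfolding C_def v_def by (simp add: norm_divide)
qed

section \<open>From a harmonic conjugacy of the sphere to a rotation\<close>

lemma filled_julia_invariant: "poly p z \<in> filled_julia p \<longleftrightarrow> z \<in> filled_julia p"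
proof -
  have "range (\<lambda>n. (poly p ^^ n) z) = insert z (range (\<lambda>n. (poly p ^^ n) (poly p z)))"
  proof -
    have "range (\<lambda>n. (poly p ^^ n) z) = insert ((poly p ^^ 0) z) (range (\<lambda>n. (poly p ^^ Suc n) z))"
      by (subst UNIV_nat_eq) (simp add: image_image)
    then show ?thesis by (simp add: funpow_swap1)
  qed
  then show ?thesis unfolding filled_julia_def by simp
qed

text \<open>
  A forward-invariant set contained in \<open>cball 0 R\<close> consists of points whose whole orbit stays in that
  ball, which is a closed condition.
\<close>

lemma open_basin:
  assumes "filled_julia p \<subseteq> cball 0 R" shows "open (- filled_julia p)"
proof -
  have "filled_julia p = (\<Inter>n. {z. norm ((poly p ^^ n) z) \<le> R})"
  proof (intro equalityI subsetI)
    fix z assume z: "z \<in> filled_julia p"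
    have "(poly p ^^ n) z \<in> filled_julia p" for n
      by (induction n) (simp_all add: z filled_julia_invariant)
    then have "norm ((poly p ^^ n) z) \<le> R" for n using subsetD[OF assms, of "(poly p ^^ n) z"] by simp
    then show "z \<in> (\<Inter>n. {z. norm ((poly p ^^ n) z) \<le> R})" by simp
  next
    fix z assume "z \<in> (\<Inter>n. {z. norm ((poly p ^^ n) z) \<le> R})"
    then show "z \<in> filled_julia p" unfolding filled_julia_def bounded_iff by blast
  qed
  moreover have "closed {z. norm ((poly p ^^ n) z) \<le> R}" for n
  proof -
    have "continuous_on UNIV (poly p ^^ n)"
    proof (induction n)
      case (Suc n)
      have "continuous_on UNIV (poly p)" by (intro continuous_intros)
      with Suc show ?case
        unfolding funpow.simps by (intro continuous_on_compose) (auto intro: continuous_on_subset)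
    qed (simp add: id_def)
    then show ?thesis by (intro closed_Collect_le continuous_intros)
  qed
  ultimately have "closed (filled_julia p)" by (simp add: closed_INT)
  then show ?thesis by (rule open_Compl)
qed

lemma escape_subset_basin:
  assumes deg: "degree P = d" and lc: "lead_coeff P = 1" and M: "\<And>k. k < d \<Longrightarrow> norm (coeff P k) \<le> M"
    and d: "2 \<le> d" and z: "escape_radius d M < norm z"
  shows "z \<notin> filled_julia P"
proof
  assume "z \<in> filled_julia P"
  then obtain B where B: "\<And>n. norm ((poly P ^^ n) z) \<le> B"
    unfolding filled_julia_def bounded_iff by auto
  have z0: "0 < norm z"
  proof -
    have "0 \<le> M" using M[of 0] d by (auto intro: order_trans[OF norm_ge_zero])
    then have "0 \<le> real d * M" by simp
    then show ?thesis using z unfolding escape_radius_def by linarith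
  qed
  have grow: "2 ^ n * norm z \<le> norm ((poly P ^^ n) z)" for n
  proof (induction n)
    case (Suc n)
    have "1 * norm z \<le> 2 ^ n * norm z" by (intro mult_right_mono) auto
    then have "escape_radius d M < norm ((poly P ^^ n) z)" using Suc z by linarith
    from monic_poly_escape(2)[OF deg lc M d this] Suc show ?case by simp
  qed simp
  obtain n where n: "B / norm z < 2 ^ n" using real_arch_pow[of 2 "B / norm z"] by auto
  have "B < 2 ^ n * norm z" using n z0 by (simp add: pos_divide_less_eq)
  then show False using grow[of n] B[of n] by linarith
qed

lemma sphere_homeo_finite:
  assumes F: "homeomorphic_map riemann_sphere riemann_sphere F" and inf: "F None = None"
  shows "F (Some z) \<noteq> None" "inj (\<lambda>z. the (F (Some z)))"
proof -
  have ts: "topspace riemann_sphere = UNIV"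
    unfolding riemann_sphere_def by (simp add: UNIV_option_conv)
  have inj: "inj F" using homeomorphic_imp_injective_map[OF F] unfolding ts .
  show 1: "F (Some z) \<noteq> None" for z
  proof
    assume "F (Some z) = None"
    then have "F (Some z) = F None" using inf by simp
    then have "Some z = None" by (rule injD[OF inj])
    then show False by simp
  qed
  show "inj (\<lambda>z. the (F (Some z)))"
  proof (rule injI)
    fix x y assume "the (F (Some x)) = the (F (Some y))"
    moreover have "F (Some x) = Some (the (F (Some x)))" "F (Some y) = Some (the (F (Some y)))"
      using 1[of x] 1[of y] by simp_all
    ultimately have "F (Some x) = F (Some y)" by (simp only:)
    then have "Some x = Some y" by (rule injD[OF inj])
    then show "x = y" by simp
  qed
qed

lemma sphere_homeo_continuous:
  assumes F: "homeomorphic_map riemann_sphere riemann_sphere F" and inf: "F None = None"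
  shows "continuous_on UNIV (\<lambda>z. the (F (Some z)))"
proof -
  have cF: "continuous_map riemann_sphere riemann_sphere F"
    by (rule homeomorphic_imp_continuous_map[OF F])
  have cS: "continuous_map euclidean riemann_sphere Some"
    unfolding riemann_sphere_def by (rule continuous_map_Some)
  have c: "continuous_map euclidean riemann_sphere (F \<circ> Some)"
    by (rule continuous_map_compose[OF cS cF])
  show ?thesis
  proof (rule continuous_on_open_vimage[OF open_UNIV, THEN iffD2], intro allI impI)
    fix V :: "complex set" assume V: "open V"
    have "openin riemann_sphere (Some ` V)" 
      unfolding riemann_sphere_def openin_Alexandroff_compactification_image_Some
      by (rule open_openin[THEN iffD1, OF V])
    from openin_continuous_map_preimage[OF c this]
    have "open {z. F (Some z) \<in> Some ` V}" by (intro open_openin[THEN iffD2]) simp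
    moreover have "{z. F (Some z) \<in> Some ` V} = (\<lambda>z. the (F (Some z))) -` V"
    proof (intro equalityI subsetI)
      fix z assume "z \<in> (\<lambda>z. the (F (Some z))) -` V"
      then have "Some (the (F (Some z))) \<in> Some ` V" by blast
      then show "z \<in> {z. F (Some z) \<in> Some ` V}" using sphere_homeo_finite(1)[OF F inf, of z] by simp
    next
      fix z assume "z \<in> {z. F (Some z) \<in> Some ` V}"
      then obtain v where "v \<in> V" "F (Some z) = Some v" by blast
      then show "z \<in> (\<lambda>z. the (F (Some z))) -` V" by simp
    qed
    ultimately show "open ((\<lambda>z. the (F (Some z))) -` V \<inter> UNIV)" by simp
  qed
qed

text \<open>
  The preimage of a closed disk is closed in the sphere and misses infinity, so it is a compact subset
  of the plane.
\<close>

lemma sphere_homeo_proper: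
  assumes F: "homeomorphic_map riemann_sphere riemann_sphere F" and inf: "F None = None" and B: "bounded B"
  shows "bounded ((\<lambda>z. the (F (Some z))) -` B)"
proof -
  obtain r where r0: "\<forall>x\<in>B. norm x \<le> r" using B unfolding bounded_iff by blast
  then have r: "B \<subseteq> cball 0 r" by auto
  have cF: "continuous_map riemann_sphere riemann_sphere F"
    by (rule homeomorphic_imp_continuous_map[OF F])
  have "closedin riemann_sphere (Some ` cball (0::complex) r)"
    unfolding riemann_sphere_def by (simp add: closed_closedin[symmetric])
  from closedin_continuous_map_preimage[OF cF this]
  have cl: "closedin riemann_sphere {x \<in> topspace riemann_sphere. F x \<in> Some ` cball 0 r}" .
  let ?T = "{x \<in> topspace riemann_sphere. F x \<in> Some ` cball 0 r}"
  have "None \<notin> ?T" using inf by auto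
  with cl obtain K where K: "compact K" "?T = Some ` K"
    unfolding riemann_sphere_def closedin_Alexandroff_compactification by auto
  have "(\<lambda>z. the (F (Some z))) -` B \<subseteq> K"
  proof
    fix z assume "z \<in> (\<lambda>z. the (F (Some z))) -` B"
    then have "the (F (Some z)) \<in> cball 0 r" using r by blast
    then have "Some (the (F (Some z))) \<in> Some ` cball 0 r" by blast
    then have "F (Some z) \<in> Some ` cball 0 r" using sphere_homeo_finite(1)[OF F inf, of z] by simp
    then have "Some z \<in> ?T" unfolding riemann_sphere_def by simp
    then show "z \<in> K" unfolding K(2) by blast
  qed
  then show ?thesis using compact_imp_bounded[OF K(1)] bounded_subset by blast
qed

lemma tangent_to_identity_at_infinity:
  assumes lim: "((\<lambda>z. h z / z) \<longlongrightarrow> 1) at_infinity"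
  shows "filterlim h at_infinity (at_infinity :: complex filter)"
proof -
  have "filterlim (\<lambda>z. h z / z * z) at_infinity at_infinity"
    by (rule tendsto_mult_filterlim_at_infinity[OF lim _ filterlim_ident]) simp
  moreover have "\<forall>\<^sub>F z in at_infinity. h z / z * z = h z"
    unfolding eventually_at_infinity by (intro exI[of _ 1]) auto
  ultimately show ?thesis by (simp cong: filterlim_cong)
qed

text \<open>
  In the coordinate \<open>1 / z\<close> the map extends holomorphically and injectively over 0; apply the open
  mapping theorem there. It follows that the inverse function tends to infinity at infinity.
\<close>

lemma holomorphic_inverse_at_infinity:
  assumes \<phi>: "\<phi> holomorphic_on {z. R < norm z}" and inj: "inj_on \<phi> {z. R < norm z}"
    and nz: "\<And>z. R < norm z \<Longrightarrow> \<phi> z \<noteq> 0" and lim: "((\<lambda>z. \<phi> z / z) \<longlongrightarrow> 1) at_infinity"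
  shows "\<exists>S. \<forall>w. S < norm w \<longrightarrow> (\<exists>z. R < norm z \<and> \<phi> z = (w::complex))"
proof -
  define R1 where "R1 = max R 1"
  have R1: "0 < R1" "R \<le> R1" by (auto simp: R1_def)
  define r where "r = 1 / R1"
  have r0: "0 < r" using R1 by (simp add: r_def)
  have inv: "R1 < norm (inverse v)" if "v \<in> ball 0 r - {0}" for v :: complex
  proof -
    have "norm v < 1 / R1" "0 < norm v" using that by (auto simp: r_def)
    then have "R1 * norm v < 1" "0 < norm v" using R1 by (auto simp: pos_less_divide_eq mult.commute)
    then show ?thesis by (simp add: norm_divide pos_less_divide_eq inverse_eq_divide del: norm_inverse)
  qed
  have invR: "R < norm (inverse v)" if "v \<in> ball 0 r - {0}" for v :: complex
    using inv[OF that] R1 by linarith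
  define g where "g v = (if v = 0 then 0 else inverse (\<phi> (inverse v)))" for v
  have inf: "filterlim \<phi> at_infinity at_infinity"
    by (rule tangent_to_identity_at_infinity[OF lim])
  have sub: "{z :: complex. R1 < norm z} \<subseteq> {z. R < norm z}" using R1 by auto
  have "g holomorphic_on ball 0 r \<and> inj_on g (ball 0 r)"
    unfolding r_def
    using inversion_holomorphic_injective[OF holomorphic_on_subset[OF \<phi> sub] inj_on_subset[OF inj sub] R1(1) _ inf g_def]
      nz sub by blast
  then have hg: "g holomorphic_on ball 0 r" and injg: "inj_on g (ball 0 r)" by simp_all
  have "open (g ` ball 0 r)" by (rule open_mapping_thm3[OF hg open_ball injg])
  moreover have "0 \<in> g ` ball 0 r" using r0 by (intro image_eqI[of _ _ 0]) (auto simp: g_def)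
  ultimately obtain e where e: "e > 0" "ball 0 e \<subseteq> g ` ball 0 r" by (rule openE) (rule that)
  show ?thesis
  proof (intro exI[of _ "1 / e"] allI impI)
    fix w :: complex assume w: "1 / e < norm w"
    then have wp: "0 < norm w" using e(1) by (smt (verit) divide_pos_pos)
    have w0: "w \<noteq> 0" using wp by auto
    have "1 < norm w * e" using w e(1) by (simp add: pos_divide_less_eq)
    then have "norm (inverse w) < e"
      using wp by (simp add: inverse_eq_divide norm_divide pos_divide_less_eq mult.commute)
    then have "inverse w \<in> ball 0 e" by simp
    then obtain v where v: "v \<in> ball 0 r" "inverse w = g v" using e(2) by blast
    have "v \<noteq> 0" using v(2) w0 by (auto simp: g_def)
    then have "\<phi> (inverse v) = w" using v(2) by (simp add: g_def)
    moreover have "R < norm (inverse v)" using invR v(1) \<open>v \<noteq> 0\<close> by blast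
    ultimately show "\<exists>z. R < norm z \<and> \<phi> z = w" by blast
  qed
qed

text \<open>
  The coefficient \<open>\<mu>\<close> vanishes on the basin, so the weak zbar-derivative of \<open>f\<close> does, too.
\<close>

lemma harmonic_conjugacy_holomorphic:
  assumes d: "2 \<le> d" and deg: "degree P0 = d" and \<phi>: "boettcher_coordinate P0 \<phi>0"
    and F: "homeomorphic_map riemann_sphere riemann_sphere F" and inf: "F None = None"
    and conj: "\<And>z. f (poly P0 z) = poly P1 (f z)" and f: "\<And>z. f z = the (F (Some z))"
    and qc: "quasiconformal_harmonic_on F (- filled_julia P0)"
  shows "f holomorphic_on (- filled_julia P0)"
proof -
  let ?U = "- filled_julia P0"
  have f_eq: "f = (\<lambda>z. the (F (Some z)))" using f by auto
  have fin: "F (Some z) \<noteq> None" for z by (rule sphere_homeo_finite(1)[OF F inf])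
  have fi: "inj f" unfolding f_eq by (rule sphere_homeo_finite(2)[OF F inf])
  have fc: "continuous_on UNIV f" unfolding f_eq by (rule sphere_homeo_continuous[OF F inf])
  obtain \<mu> where \<mu>: "quasiconformal_with F \<mu>" "harmonic_beltrami_on ?U \<mu>"
    using qc unfolding quasiconformal_harmonic_on_def by blast
  have UNIV_eq: "{z. F (Some z) \<noteq> None} = UNIV" using fin by auto
  obtain p q where p2: "locally_L2_on UNIV p" and q2: "locally_L2_on UNIV q"
    and wd0: "weak_derivatives_on UNIV (\<lambda>z. the (F (Some z))) p q"
    and pq: "AE z in lebesgue. z \<in> UNIV \<longrightarrow> q z = \<mu> z * p z"
    using \<mu>(1) unfolding quasiconformal_with_def UNIV_eq Let_def by (elim conjE exE) (rule that)
  have wd: "weak_derivatives_on UNIV f p q" using wd0 by (simp only: f_eq)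
  have wp: "weak_op_on UNIV (1/2) (- \<i>/2) f p"
    unfolding weak_op_on_def wirtinger_z_eq[symmetric]
    by (intro allI impI, rule conjunct1) (rule wd[unfolded weak_derivatives_on_def, rule_format])
  have wq: "weak_op_on UNIV (1/2) (\<i>/2) f q"
    unfolding weak_op_on_def wirtinger_zbar_eq[symmetric]
    by (intro allI impI, rule conjunct2) (rule wd[unfolded weak_derivatives_on_def, rule_format])
  have p: "locally_integrable p" "p \<in> borel_measurable lebesgue"
    and q: "locally_integrable q" "q \<in> borel_measurable lebesgue"
    using locally_L2_imp_locally_integrable[OF p2] locally_L2_imp_locally_integrable[OF q2] p2 q2
    unfolding locally_L2_on_def set_borel_measurable_def by simp_all
  obtain R where R: "filled_julia P0 \<subseteq> cball 0 R"
    using \<phi> unfolding boettcher_coordinate_def by blast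
  have U: "open ?U" by (rule open_basin[OF R])
  have \<phi>hol: "\<phi>0 holomorphic_on ?U" and bij: "bij_betw \<phi>0 ?U (- cball 0 1)"
    and \<phi>P: "\<And>z. z \<in> ?U \<Longrightarrow> \<phi>0 (poly P0 z) = \<phi>0 z ^ d"
    using \<phi> deg unfolding boettcher_coordinate_def by auto
  have PU: "poly P0 ` ?U \<subseteq> ?U" using filled_julia_invariant by auto
  have pqU: "AE z in lebesgue. z \<in> ?U \<longrightarrow> q z = \<mu> z * p z"
    using pq by (rule AE_mp) (rule AE_I2, simp)
  have \<mu>0: "\<mu> z = 0" if "z \<in> ?U" for z
    by (rule harmonic_coefficient_zero[OF U \<phi>hol bij PU d \<phi>P fc fi conj wp wq p q pqU \<mu>(2) that])
  have "weak_op_on ?U (1/2) (\<i>/2) f (\<lambda>_. 0)"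
    unfolding weak_op_on_def
  proof (intro allI impI)
    fix \<eta> \<eta>' assume t: "test_function ?U \<eta> \<eta>'"
    have \<eta>0: "\<eta> z = 0" if "z \<notin> ?U" for z using t that unfolding test_function_def by blast
    have "(LINT z|lebesgue. q z * \<eta> z) = (LINT z|lebesgue. 0 * \<eta> z)"
    proof (rule integral_cong_AE)
      show "(\<lambda>z. q z * \<eta> z) \<in> borel_measurable lebesgue"
        by (intro borel_measurable_times q continuous_lebesgue_measurable test_function_continuous[OF t])
      show "AE z in lebesgue. q z * \<eta> z = 0 * \<eta> z"
        using pqU
      proof (rule AE_mp, intro AE_I2 impI)
        fix z assume h: "z \<in> ?U \<longrightarrow> q z = \<mu> z * p z"
        show "q z * \<eta> z = 0 * \<eta> z"
          using h \<eta>0[of z] \<mu>0[of z] by (cases "z \<in> ?U") simp_all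
      qed
    qed simp
    moreover have "(LINT z|lebesgue. f z * first_order_op (1/2) (\<i>/2) (\<eta>' z)) = - (LINT z|lebesgue. q z * \<eta> z)"
      using wq test_function_subset[OF t subset_UNIV] unfolding weak_op_on_def by blast
    ultimately show "(LINT z|lebesgue. f z * first_order_op (1/2) (\<i>/2) (\<eta>' z)) = - (LINT z|lebesgue. 0 * \<eta> z)"
      by (simp only:)
  qed
  then show ?thesis by (rule weyl_lemma[OF U fc])
qed

text \<open>
  The map \<open>A = \<phi>1 \<circ> f \<circ> \<phi>0\<inverse>\<close> of the exterior of the disk commutes with the power map.
\<close>

lemma harmonic_conjugacy_rotation:
  assumes d: "2 \<le> d" and deg: "degree P0 = d" "degree P1 = d"
    and \<phi>0: "boettcher_coordinate P0 \<phi>0" and \<phi>1: "boettcher_coordinate P1 \<phi>1"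
    and F: "homeomorphic_map riemann_sphere riemann_sphere F" and inf: "F None = None"
    and conjF: "\<And>z. F (poly_sphere P0 z) = poly_sphere P1 (F z)" and f: "\<And>z. f z = the (F (Some z))"
    and qc: "quasiconformal_harmonic_on F (- filled_julia P0)"
  obtains \<omega> where "\<omega> ^ (d - 1) = 1"
    "\<And>z. z \<in> - filled_julia P0 \<Longrightarrow> f z \<in> - filled_julia P1 \<and> \<phi>1 (f z) = \<omega> * \<phi>0 z"
proof -
  let ?U = "- filled_julia P0" and ?V = "- filled_julia P1" and ?E = "- cball (0::complex) 1"
  have fin: "F (Some z) = Some (f z)" for z
    using sphere_homeo_finite(1)[OF F inf, of z] f by simp
  have f_eq: "f = (\<lambda>z. the (F (Some z)))" using f by auto
  have conj: "f (poly P0 z) = poly P1 (f z)" for z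
    using conjF[of "Some z"] by (simp add: poly_sphere_def fin)
  have fi: "inj f" unfolding f_eq by (rule sphere_homeo_finite(2)[OF F inf])
  have proper: "bounded (f -` B)" if "bounded B" for B
    unfolding f_eq by (rule sphere_homeo_proper[OF F inf that])
  have fh: "f holomorphic_on ?U"
    by (rule harmonic_conjugacy_holomorphic[OF d deg(1) \<phi>0 F inf conj f qc])
  have iter: "f ((poly P0 ^^ n) z) = (poly P1 ^^ n) (f z)" for n z
    by (induction n) (simp_all add: conj)
  have fV: "f z \<in> ?V" if z: "z \<in> ?U" for z
  proof
    assume "f z \<in> filled_julia P1"
    then have "bounded (range (\<lambda>n. (poly P1 ^^ n) (f z)))" unfolding filled_julia_def by simp
    then have "bounded (f -` range (\<lambda>n. (poly P1 ^^ n) (f z)))" by (rule proper)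
    moreover have "range (\<lambda>n. (poly P0 ^^ n) z) \<subseteq> f -` range (\<lambda>n. (poly P1 ^^ n) (f z))"
      using iter by auto
    ultimately have "bounded (range (\<lambda>n. (poly P0 ^^ n) z))" using bounded_subset by blast
    then show False using z unfolding filled_julia_def by simp
  qed
  obtain R where R: "filled_julia P0 \<subseteq> cball 0 R"
    using \<phi>0 unfolding boettcher_coordinate_def by blast
  have U: "open ?U" by (rule open_basin[OF R])
  have \<phi>0hol: "\<phi>0 holomorphic_on ?U" and bij0: "bij_betw \<phi>0 ?U ?E"
    and \<phi>0P: "\<And>z. z \<in> ?U \<Longrightarrow> \<phi>0 (poly P0 z) = \<phi>0 z ^ d" and lim0: "((\<lambda>z. \<phi>0 z / z) \<longlongrightarrow> 1) at_infinity"
    using \<phi>0 deg unfolding boettcher_coordinate_def by auto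
  have \<phi>1hol: "\<phi>1 holomorphic_on ?V" and bij1: "bij_betw \<phi>1 ?V ?E"
    and \<phi>1P: "\<And>z. z \<in> ?V \<Longrightarrow> \<phi>1 (poly P1 z) = \<phi>1 z ^ d" and lim1: "((\<lambda>z. \<phi>1 z / z) \<longlongrightarrow> 1) at_infinity"
    using \<phi>1 deg unfolding boettcher_coordinate_def by auto
  have inj0: "inj_on \<phi>0 ?U" and im0: "\<phi>0 ` ?U = ?E" using bij0 by (auto simp: bij_betw_def)
  have inj1: "inj_on \<phi>1 ?V" and im1: "\<phi>1 ` ?V = ?E" using bij1 by (auto simp: bij_betw_def)
  obtain \<gamma> where \<gamma>: "\<gamma> holomorphic_on ?E" and \<gamma>\<phi>: "\<And>z. z \<in> ?U \<Longrightarrow> \<gamma> (\<phi>0 z) = z"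
    using holomorphic_has_inverse[OF \<phi>0hol U inj0] unfolding im0 by metis
  have \<gamma>U: "\<gamma> w \<in> ?U" "\<phi>0 (\<gamma> w) = w" if "w \<in> ?E" for w
  proof -
    obtain z where "z \<in> ?U" "w = \<phi>0 z" using \<open>w \<in> ?E\<close> im0 by blast
    then show "\<gamma> w \<in> ?U" "\<phi>0 (\<gamma> w) = w" using \<gamma>\<phi> by auto
  qed
  define A where "A w = \<phi>1 (f (\<gamma> w))" for w
  have im\<gamma>: "\<gamma> ` ?E \<subseteq> ?U" "(\<lambda>w. f (\<gamma> w)) ` ?E \<subseteq> ?V" using \<gamma>U(1) fV by blast+
  have f\<gamma>: "(\<lambda>w. f (\<gamma> w)) holomorphic_on ?E"
    using holomorphic_on_compose_gen[OF \<gamma> fh im\<gamma>(1)] by (simp only: o_def)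
  have Ahol: "A holomorphic_on ?E"
    unfolding A_def[abs_def] using holomorphic_on_compose_gen[OF f\<gamma> \<phi>1hol im\<gamma>(2)] by (simp only: o_def)
  have Aim: "A ` ?E \<subseteq> ?E" using fV \<gamma>U(1) im1 unfolding A_def by blast
  have Ainj: "inj_on A ?E"
  proof (rule inj_onI)
    fix v w assume vw: "v \<in> ?E" "w \<in> ?E" "A v = A w"
    have "f (\<gamma> v) = f (\<gamma> w)"
      using inj_onD[OF inj1 vw(3)[unfolded A_def]] fV \<gamma>U(1) vw(1,2) by blast
    then have "\<gamma> v = \<gamma> w" using fi by (metis injD)
    then show "v = w" using \<gamma>U(2) vw(1,2) by metis
  qed
  have Apow: "A (w ^ d) = A w ^ d" if w: "w \<in> ?E" for w
  proof -
    have "\<phi>0 (poly P0 (\<gamma> w)) = w ^ d" using \<phi>0P[OF \<gamma>U(1)[OF w]] \<gamma>U(2)[OF w] by simp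
    moreover have "poly P0 (\<gamma> w) \<in> ?U" using \<gamma>U(1)[OF w] filled_julia_invariant by auto
    ultimately have "\<gamma> (w ^ d) = poly P0 (\<gamma> w)" using \<gamma>\<phi> by metis
    then show ?thesis unfolding A_def using conj \<phi>1P[OF fV[OF \<gamma>U(1)[OF w]]] by simp
  qed
  have \<gamma>inf: "filterlim \<gamma> at_infinity at_infinity"
    unfolding filterlim_at_infinity[OF order_refl]
  proof (intro allI impI)
    fix r :: real assume "r > 0"
    define R1 where "R1 = max R r"
    have sub: "{z. R1 < norm z} \<subseteq> ?U"
    proof
      fix z :: complex assume "z \<in> {z. R1 < norm z}"
      then have "z \<notin> cball 0 R" by (auto simp: R1_def)
      then show "z \<in> ?U" using R by blast
    qed
    have "\<exists>S. \<forall>w. S < norm w \<longrightarrow> (\<exists>z. R1 < norm z \<and> \<phi>0 z = w)"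
    proof (rule holomorphic_inverse_at_infinity[OF holomorphic_on_subset[OF \<phi>0hol sub] inj_on_subset[OF inj0 sub] _ lim0])
      fix z :: complex assume "R1 < norm z"
      then have "\<phi>0 z \<in> ?E" using sub im0 by blast
      then show "\<phi>0 z \<noteq> 0" by auto
    qed
    then obtain S where S: "\<And>w. S < norm w \<Longrightarrow> \<exists>z. R1 < norm z \<and> \<phi>0 z = w" by blast
    show "\<forall>\<^sub>F w in at_infinity. r \<le> norm (\<gamma> w)"
      unfolding eventually_at_infinity
    proof (intro exI[of _ "S + 1"] allI impI)
      fix w :: complex assume "S + 1 \<le> norm w"
      then obtain z where z: "R1 < norm z" "\<phi>0 z = w" using S[of w] by auto
      have "\<gamma> w = z" using \<gamma>\<phi>[of z] sub z by blast
      then show "r \<le> norm (\<gamma> w)" using z(1) by (simp add: R1_def)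
    qed
  qed
  have finf: "filterlim f at_infinity at_infinity"
    unfolding filterlim_at_infinity[OF order_refl]
  proof (intro allI impI)
    fix r :: real assume "r > 0"
    obtain b where b: "\<And>z. z \<in> f -` cball 0 r \<Longrightarrow> norm z \<le> b"
      using proper[OF bounded_cball[of 0 r]] unfolding bounded_iff by blast
    show "\<forall>\<^sub>F z in at_infinity. r \<le> norm (f z)"
      unfolding eventually_at_infinity
    proof (intro exI[of _ "b + 1"] allI impI)
      fix z :: complex assume z: "b + 1 \<le> norm z"
      show "r \<le> norm (f z)"
      proof (rule ccontr)
        assume "\<not> r \<le> norm (f z)"
        then have "norm z \<le> b" by (intro b) simp
        then show False using z by simp
      qed
    qed
  qed
  have \<phi>1inf: "filterlim \<phi>1 at_infinity at_infinity"
    by (rule tangent_to_identity_at_infinity[OF lim1])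
  have Ainf: "filterlim A at_infinity at_infinity"
    unfolding A_def[abs_def] by (rule filterlim_compose[OF \<phi>1inf filterlim_compose[OF finf \<gamma>inf]])
  obtain \<omega> where \<omega>: "\<omega> ^ (d - 1) = 1" "\<And>w. w \<in> ?E \<Longrightarrow> A w = \<omega> * w"
    using power_conjugacy_rotation[OF Ahol Aim Ainj Ainf d Apow] by blast
  show thesis
  proof (rule that[OF \<omega>(1)])
    fix z assume z: "z \<in> ?U"
    then have "\<phi>0 z \<in> ?E" using im0 by blast
    then have "\<phi>1 (f z) = \<omega> * \<phi>0 z" using \<omega>(2) \<gamma>\<phi>[OF z] unfolding A_def by metis
    then show "f z \<in> ?V \<and> \<phi>1 (f z) = \<omega> * \<phi>0 z" using fV[OF z] by blast
  qed
qed

section \<open>The rotation along a path of parameters\<close>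

lemma boettcher_coordinate_near_infinity:
  assumes deg: "degree P = d" and lc: "lead_coeff P = 1" and M: "\<And>k. k < d \<Longrightarrow> norm (coeff P k) \<le> M"
    and d: "2 \<le> d" and \<phi>: "boettcher_coordinate P \<phi>" and z: "escape_radius d M < norm z"
  shows "norm (\<phi> z / z - 1) \<le> 4 * (real d * M) / norm z"
proof -
  have sub: "z \<in> - filled_julia P" if "escape_radius d M < norm z" for z
    using escape_subset_basin[OF deg lc M d that] by simp
  have hol: "\<phi> holomorphic_on - filled_julia P" and bij: "bij_betw \<phi> (- filled_julia P) (- cball 0 1)"
    and conj: "\<And>z. z \<in> - filled_julia P \<Longrightarrow> \<phi> (poly P z) = \<phi> z ^ d"
    and lim: "((\<lambda>z. \<phi> z / z) \<longlongrightarrow> 1) at_infinity"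
    using \<phi> deg unfolding boettcher_coordinate_def by auto
  show ?thesis
  proof (rule boettcher_near_identity[OF deg lc M d _ _ _ lim z])
    show "continuous_on {z. escape_radius d M < norm z} \<phi>"
      by (rule continuous_on_subset[OF holomorphic_on_imp_continuous_on[OF hol]]) (use sub in blast)
    show "\<phi> y \<noteq> 0" if y: "escape_radius d M < norm y" for y
    proof -
      have "\<phi> y \<in> - cball 0 1" using bij sub[OF y] unfolding bij_betw_def by blast
      then show ?thesis by auto
    qed
    show "\<phi> (poly P y) = \<phi> y ^ d" if "escape_radius d M < norm y" for y
      by (rule conj[OF sub[OF that]])
  qed
qed

lemma holomorphic_on_param_segment:
  fixes t :: "complex ^ 'n"
  assumes h: "\<And>s. s \<in> {0..1} \<Longrightarrow> holomorphic_at_param h (s *\<^sub>R t)"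
  shows "continuous_on {0..1::real} (\<lambda>s. h (s *\<^sub>R t))"
proof (rule continuous_at_imp_continuous_on, rule ballI)
  fix s :: real assume s: "s \<in> {0..1}"
  obtain D where "(h has_derivative D) (at (s *\<^sub>R t))"
    using h[OF s] unfolding holomorphic_at_param_def by blast
  then have "isCont h (s *\<^sub>R t)" by (rule has_derivative_continuous)
  moreover have "isCont (\<lambda>s. s *\<^sub>R t) s" by (intro continuous_intros)
  ultimately show "isCont (\<lambda>s. h (s *\<^sub>R t)) s" by (rule isCont_o2[rotated])
qed

lemma coefficient_bound_on_segment:
  fixes t :: "complex ^ 'n"
  assumes h: "\<And>s k. s \<in> {0..1} \<Longrightarrow> holomorphic_at_param (\<lambda>t. coeff (P t) k) (s *\<^sub>R t)"
  shows "\<exists>M. \<forall>s\<in>{0..1}. \<forall>k<d. norm (coeff (P (s *\<^sub>R t)) k) \<le> M"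
proof -
  have "compact ((\<lambda>s. coeff (P (s *\<^sub>R t)) k) ` {0..1::real})" for k
    by (rule compact_continuous_image[OF holomorphic_on_param_segment[OF h]]) auto
  then have "bounded (\<Union>k<d. (\<lambda>s. coeff (P (s *\<^sub>R t)) k) ` {0..1::real})"
    by (intro bounded_UN ballI compact_imp_bounded) auto
  then obtain M where "\<forall>x\<in>(\<Union>k<d. (\<lambda>s. coeff (P (s *\<^sub>R t)) k) ` {0..1::real}). norm x \<le> M"
    unfolding bounded_iff by blast
  then show ?thesis by (intro exI[of _ M] ballI allI impI) blast
qed

text \<open>
  Parameters at which infinity moves to a finite point, and parameters at which it moves to a point
  of the sphere outside \<open>cball 0 R\<close>, form two open sets that cover the segment. They are disjoint by
  the bound on \<open>c\<close>, so the first one is empty.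
\<close>

lemma infinity_fixed_on_segment:
  fixes t :: "complex ^ 'n"
  assumes hol: "sphere_holomorphic_on (\<lambda>t. \<psi> t None) D" and seg: "\<And>s. s \<in> {0..1} \<Longrightarrow> s *\<^sub>R t \<in> D"
    and 0: "\<psi> 0 None = None"
    and fixed: "\<And>s c. s \<in> {0..1} \<Longrightarrow> \<psi> (s *\<^sub>R t) None = Some c \<Longrightarrow> norm c \<le> R"
    and s: "s \<in> {0..1::real}"
  shows "\<psi> (s *\<^sub>R t) None = None"
proof -
  define G where "G s = \<psi> (s *\<^sub>R t) None" for s
  have "continuous_map (top_of_set {0..1}) (top_of_set D) (\<lambda>s. s *\<^sub>R t)"
    using seg by (auto simp: continuous_map_in_subtopology intro!: continuous_intros)
  moreover have "continuous_map (top_of_set D) riemann_sphere (\<lambda>t. \<psi> t None)"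
    using hol unfolding sphere_holomorphic_on_def by blast
  ultimately have "continuous_map (top_of_set {0..1}) riemann_sphere ((\<lambda>t. \<psi> t None) \<circ> (\<lambda>s. s *\<^sub>R t))"
    by (rule continuous_map_compose)
  then have G: "continuous_map (top_of_set {0..1}) riemann_sphere G" by (simp add: G_def[abs_def] o_def)
  have oplane: "openin riemann_sphere (Some ` (UNIV :: complex set))"
    unfolding riemann_sphere_def openin_Alexandroff_compactification_image_Some by simp
  have onear: "openin riemann_sphere (insert None (Some ` (UNIV - cball (0::complex) R)))"
    unfolding riemann_sphere_def openin_Alexandroff_compactification
    by (rule disjI2, rule exI[of _ "cball 0 R"]) (auto simp: closed_closedin[symmetric])
  define A where "A = {s \<in> topspace (top_of_set {0..1::real}). G s \<in> insert None (Some ` (UNIV - cball 0 R))}"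
  define B where "B = {s \<in> topspace (top_of_set {0..1::real}). G s \<in> Some ` UNIV}"
  have oA: "openin (top_of_set {0..1}) A"
    unfolding A_def by (rule openin_continuous_map_preimage[OF G onear])
  have oB: "openin (top_of_set {0..1}) B"
    unfolding B_def by (rule openin_continuous_map_preimage[OF G oplane])
  have "A \<inter> B = {}"
  proof (rule ccontr)
    assume "A \<inter> B \<noteq> {}"
    then obtain s where "s \<in> A" "s \<in> B" by blast
    then obtain c where c: "s \<in> {0..1}" "G s = Some c" "c \<notin> cball 0 R" unfolding A_def B_def by auto
    then show False using fixed[of s c] unfolding G_def by simp
  qed
  moreover have "{0..1} \<subseteq> A \<union> B"
  proof
    fix s :: real assume "s \<in> {0..1}"
    then show "s \<in> A \<union> B" unfolding A_def B_def by (cases "G s") auto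
  qed
  moreover have "0 \<in> A" using 0 unfolding A_def G_def by simp
  moreover have "connected {0..1::real}" by simp
  ultimately have "B = {}"
    using oA oB unfolding connected_openin by blast
  then have "G s \<notin> Some ` UNIV" using s unfolding B_def by auto
  then show ?thesis unfolding G_def by (metis not_None_eq rangeI)
qed

lemma scaled_mem_polydisk:
  assumes t: "t \<in> polydisk r" and s: "s \<in> {0..1}"
  shows "s *\<^sub>R t \<in> polydisk r"
proof -
  have "norm ((s *\<^sub>R t) $ i) < r $ i" for i
  proof -
    have "norm ((s *\<^sub>R t) $ i) = \<bar>s\<bar> * norm (t $ i)" by simp
    also have "\<dots> \<le> 1 * norm (t $ i)" using s by (intro mult_right_mono) auto
    also have "\<dots> < r $ i" using t unfolding polydisk_def by simp
    finally show ?thesis .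
  qed
  then show ?thesis unfolding polydisk_def by simp
qed

text \<open>
  The values of \<open>\<omega>\<close> are roots of unity, so continuity suffices. For large \<open>z\<close> the quotient
  \<open>x s = f s z / \<phi> 0 z\<close> is continuous in \<open>s\<close>. It differs from
  \<open>\<omega> s = \<phi> s (f s z) / \<phi> 0 z\<close> by at most \<open>C / norm (\<phi> 0 z)\<close>, since \<open>\<phi> s\<close> is close to the identity at
  \<open>f s z\<close>. The point \<open>z\<close> is chosen anew for each parameter \<open>s0\<close>, and near \<open>s0\<close> the value \<open>f s z\<close> stays beyond
  \<open>R\<close>.
\<close>

lemma rotation_number_constant:
  fixes f :: "real \<Rightarrow> complex \<Rightarrow> complex" and Q :: "real \<Rightarrow> complex poly"
  assumes d: "2 \<le> d"
    and Q: "\<And>s. s \<in> {0..1} \<Longrightarrow> degree (Q s) = d \<and> lead_coeff (Q s) = 1"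
    and M: "\<And>s k. s \<in> {0..1} \<Longrightarrow> k < d \<Longrightarrow> norm (coeff (Q s) k) \<le> M"
    and \<phi>: "\<And>s. s \<in> {0..1} \<Longrightarrow> boettcher_coordinate (Q s) (\<phi> s)"
    and f: "\<And>z. continuous_on {0..1} (\<lambda>s. f s z)"
    and f_inf: "\<And>s B. s \<in> {0..1} \<Longrightarrow> bounded B \<Longrightarrow> bounded (f s -` B)"
    and \<omega>: "\<And>s. s \<in> {0..1} \<Longrightarrow> \<omega> s ^ (d - 1) = 1"
    and conj: "\<And>s z. s \<in> {0..1} \<Longrightarrow> z \<in> - filled_julia (Q 0) \<Longrightarrow> \<phi> s (f s z) = \<omega> s * \<phi> 0 z"
    and s: "s \<in> {0..1}"
  shows "\<omega> s = \<omega> 0"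
proof -
  define R where "R = escape_radius d M"
  define C where "C = 4 * (real d * M)"
  have "0 \<le> M" using M[of 0 0] d by (auto intro: order_trans[OF norm_ge_zero])
  then have C0: "0 \<le> C" unfolding C_def by simp
  have RC: "R = 4 + 2 * C" unfolding R_def escape_radius_def C_def by simp
  have near: "norm (\<phi> s w / w - 1) \<le> C / norm w" if s: "s \<in> {0..1}" and w: "R < norm w" for s w
    using boettcher_coordinate_near_infinity[OF conjunct1[OF Q[OF s]] conjunct2[OF Q[OF s]] M[OF s] d \<phi>[OF s], of w] w
    unfolding C_def R_def by blast
  have "continuous_on {0..1} \<omega>"
    unfolding continuous_on_iff
  proof (intro ballI allI impI)
    fix s0 :: real and \<epsilon> :: real assume s0: "s0 \<in> {0..1}" and \<epsilon>: "0 < \<epsilon>"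
    \<comment> \<open>a point so large that \<open>f s0\<close> maps it beyond \<open>R\<close> and that \<open>C / norm (\<phi> 0 z)\<close> is small\<close>
    obtain b where b: "\<forall>z \<in> f s0 -` cball 0 R. norm z \<le> b"
      using f_inf[OF s0 bounded_cball[of 0 R]] unfolding bounded_iff by blast
    define m where "m = max (max R b) (8 * C / \<epsilon>) + 1"
    define z where "z = complex_of_real m"
    have m: "R < m" "b < m" "8 * C / \<epsilon> < m" unfolding m_def by auto
    have R4: "4 \<le> R" using RC C0 by simp
    then have mpos: "0 < m" using m(1) by linarith
    have nz: "norm z = m" unfolding z_def using mpos by simp
    have zR: "R < norm z" using nz m by simp
    have zU: "z \<in> - filled_julia (Q 0)"
      using escape_subset_basin[of "Q 0" d M z] Q[of 0] M[of 0] d zR unfolding R_def by auto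
    have z0: "z \<noteq> 0" using nz mpos by auto
    have "norm (\<phi> 0 z / z - 1) \<le> C / norm z" using near[of 0 z] zR by simp
    also have "\<dots> \<le> 1 / 2" unfolding nz using m(1) RC mpos by (simp add: pos_divide_le_eq)
    finally have "1 / 2 \<le> norm (\<phi> 0 z / z)"
      using norm_triangle_ineq2[of 1 "1 - \<phi> 0 z / z"] by (simp add: norm_minus_commute)
    then have \<phi>z: "m / 2 \<le> norm (\<phi> 0 z)"
      unfolding norm_divide nz using mpos by (simp add: pos_le_divide_eq)
    have \<phi>0: "\<phi> 0 z \<noteq> 0" using \<phi>z mpos by auto
    have small: "C / norm (\<phi> 0 z) \<le> \<epsilon> / 4"
    proof -
      have "8 * C < m * \<epsilon>" using m(3) \<epsilon> by (simp add: pos_divide_less_eq)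
      moreover have "m * \<epsilon> \<le> 2 * norm (\<phi> 0 z) * \<epsilon>" using \<phi>z \<epsilon> by (intro mult_right_mono) auto
      ultimately have "4 * C \<le> \<epsilon> * norm (\<phi> 0 z)" by (simp add: mult_ac)
      then show ?thesis using \<phi>0 by (simp add: pos_divide_le_eq)
    qed
    have fR0: "R < norm (f s0 z)"
    proof (rule ccontr)
      assume "\<not> R < norm (f s0 z)"
      then have "z \<in> f s0 -` cball 0 R" by simp
      then have "norm z \<le> b" using b by blast
      then show False using nz m(2) by simp
    qed
    define x where "x s = f s z / \<phi> 0 z" for s
    have xw: "norm (\<omega> s - x s) \<le> \<epsilon> / 4" if s: "s \<in> {0..1}" and fR: "R < norm (f s z)" for s
    proof -
      have f0: "f s z \<noteq> 0" using fR R4 by auto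
      have "\<omega> s = \<phi> s (f s z) / \<phi> 0 z" using conj[OF s zU] \<phi>0 by simp
      then have "\<omega> s - x s = x s * (\<phi> s (f s z) / f s z - 1)"
        unfolding x_def using f0 \<phi>0 by (simp add: field_simps)
      then have "norm (\<omega> s - x s) = norm (x s) * norm (\<phi> s (f s z) / f s z - 1)" by (simp add: norm_mult)
      also have "\<dots> \<le> norm (x s) * (C / norm (f s z))" by (intro mult_left_mono near s fR) simp
      also have "\<dots> = C / norm (\<phi> 0 z)" unfolding x_def norm_divide using f0 by simp
      finally show ?thesis using small by linarith
    qed
    have cx: "continuous_on {0..1} x" unfolding x_def by (intro continuous_on_divide f continuous_on_const) (simp add: \<phi>0)
    obtain \<delta>1 where \<delta>1: "\<delta>1 > 0" "\<And>s. s \<in> {0..1} \<Longrightarrow> dist s s0 < \<delta>1 \<Longrightarrow> dist (x s) (x s0) < \<epsilon> / 2"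
      using cx s0 \<epsilon> unfolding continuous_on_iff by (meson half_gt_zero)
    obtain \<delta>2 where \<delta>2: "\<delta>2 > 0" "\<And>s. s \<in> {0..1} \<Longrightarrow> dist s s0 < \<delta>2 \<Longrightarrow> dist (f s z) (f s0 z) < norm (f s0 z) - R"
      using f[of z] s0 fR0 unfolding continuous_on_iff by (meson diff_gt_0_iff_gt)
    show "\<exists>\<delta>>0. \<forall>s\<in>{0..1}. dist s s0 < \<delta> \<longrightarrow> dist (\<omega> s) (\<omega> s0) < \<epsilon>"
    proof (intro exI[of _ "min \<delta>1 \<delta>2"] conjI ballI impI)
      fix s assume s: "s \<in> {0..1}" "dist s s0 < min \<delta>1 \<delta>2"
      have "norm (f s0 z) - norm (f s z) \<le> dist (f s z) (f s0 z)"
        using norm_triangle_ineq2[of "f s0 z" "f s z"] by (simp add: dist_norm norm_minus_commute)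
      moreover have "dist (f s z) (f s0 z) < norm (f s0 z) - R" using \<delta>2(2)[of s] s by simp
      ultimately have fR: "R < norm (f s z)" by linarith
      have "dist (\<omega> s) (x s) \<le> \<epsilon> / 4" using xw[OF s(1) fR] by (simp add: dist_norm)
      moreover have "dist (x s) (x s0) < \<epsilon> / 2" using \<delta>1(2)[of s] s by simp
      moreover have "dist (x s0) (\<omega> s0) \<le> \<epsilon> / 4" using xw[OF s0 fR0] by (simp add: dist_norm norm_minus_commute)
      moreover have "dist (\<omega> s) (\<omega> s0) \<le> dist (\<omega> s) (x s) + dist (x s) (x s0) + dist (x s0) (\<omega> s0)"
        using dist_triangle[of "\<omega> s" "\<omega> s0" "x s"] dist_triangle[of "x s" "\<omega> s0" "x s0"] by linarith
      ultimately show "dist (\<omega> s) (\<omega> s0) < \<epsilon>" by linarith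
    qed (use \<delta>1(1) \<delta>2(1) in simp)
  qed
  moreover have "finite (\<omega> ` {0..1})"
  proof (rule finite_subset)
    show "\<omega> ` {0..1} \<subseteq> {z. z ^ (d - 1) = 1}" using \<omega> by blast
    show "finite {z :: complex. z ^ (d - 1) = 1}" using d by (intro finite_roots_unity) simp
  qed
  ultimately have "\<omega> constant_on {0..1}" by (intro continuous_finite_range_constant) auto
  then obtain c where "\<forall>s\<in>{0..1}. \<omega> s = c" unfolding constant_on_def by blast
  then show ?thesis using s by simp
qed

theorem theorem1p1:
  fixes r :: "real ^ 'n"
    and \<Delta> :: "(complex ^ 'n) set"
    and P :: "complex ^ 'n \<Rightarrow> complex poly"
    and d :: nat
    and \<psi> :: "complex ^ 'n \<Rightarrow> complex option \<Rightarrow> complex option"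
    and \<phi> :: "complex ^ 'n \<Rightarrow> complex \<Rightarrow> complex"
  assumes "\<forall>i. 0 < r $ i"
    and "\<Delta> = polydisk r"
    and "d \<ge> 2"
    and "\<forall>t\<in>\<Delta>. degree (P t) = d \<and> lead_coeff (P t) = 1"
    and "\<forall>k. holomorphic_on_param (\<lambda>t. coeff (P t) k) \<Delta>"
    and "\<forall>s\<in>\<Delta>. \<forall>t\<in>\<Delta>. topologically_conjugate (P s) (P t)"
    and "\<forall>t\<in>\<Delta>. connected (julia (P t))"
    and "mcmullen_sullivan_motion \<Delta> P \<psi>"
    and "\<forall>t\<in>\<Delta>. boettcher_coordinate (P t) (\<phi> t)"
  shows "\<forall>t\<in>\<Delta>.
           (\<forall>z \<in> - filled_julia (P 0).
              \<exists>w \<in> - filled_julia (P t). \<psi> t (Some z) = Some w \<and> \<phi> 0 z = \<phi> t w) \<and>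
           (\<lambda>z. the (\<psi> t (Some z))) holomorphic_on (- filled_julia (P 0))"
proof (rule ballI)
  fix t assume t: "t \<in> \<Delta>"
  note d = \<open>d \<ge> 2\<close>
  have seg: "s *\<^sub>R t \<in> \<Delta>" if "s \<in> {0..1}" for s
    using scaled_mem_polydisk[OF _ that] t assms(2) by simp
  have "0 *\<^sub>R t \<in> \<Delta>" by (rule seg) simp
  then have zero: "0 \<in> \<Delta>" by simp
  have P: "degree (P u) = d" "lead_coeff (P u) = 1" if "u \<in> \<Delta>" for u using assms(4) that by auto
  have \<phi>: "boettcher_coordinate (P u) (\<phi> u)" if "u \<in> \<Delta>" for u using assms(9) that by blast
  have motion: "holomorphic_motion \<Delta> UNIV \<psi>" and
    homeo: "\<And>u. u \<in> \<Delta> \<Longrightarrow> homeomorphic_map riemann_sphere riemann_sphere (\<psi> u)" and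
    conj: "\<And>u z. u \<in> \<Delta> \<Longrightarrow> \<psi> u (poly_sphere (P 0) z) = poly_sphere (P u) (\<psi> u z)" and
    qc: "\<And>u. u \<in> \<Delta> \<Longrightarrow> quasiconformal_harmonic_on (\<psi> u) (- filled_julia (P 0))"
    using assms(8) unfolding mcmullen_sullivan_motion_def by blast+
  have \<psi>0: "\<psi> 0 z = z" for z using motion unfolding holomorphic_motion_def by blast
  have \<psi>hol: "sphere_holomorphic_on (\<lambda>t. \<psi> t z) \<Delta>" for z using motion unfolding holomorphic_motion_def by blast
  have coeff_hol: "holomorphic_at_param (\<lambda>t. coeff (P t) k) (s *\<^sub>R t)" if "s \<in> {0..1}" for s k
    using assms(5) seg[OF that] unfolding holomorphic_on_param_def by blast
  obtain M where M: "\<And>s k. s \<in> {0..1} \<Longrightarrow> k < d \<Longrightarrow> norm (coeff (P (s *\<^sub>R t)) k) \<le> M"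
    using coefficient_bound_on_segment[OF coeff_hol, of d] by blast
  define F where "F s = \<psi> (s *\<^sub>R t)" for s
  define f where "f s z = the (F s (Some z))" for s z
  have inf: "F s None = None" if "s \<in> {0..1}" for s
    unfolding F_def
  proof (rule infinity_fixed_on_segment[where \<psi> = \<psi> and D = \<Delta> and R = "escape_radius d M", OF \<psi>hol seg \<psi>0 _ that])
    fix s c assume s: "s \<in> {0..1::real}" and c: "\<psi> (s *\<^sub>R t) None = Some c"
    have fix': "poly (P (s *\<^sub>R t)) c = c"
      using conj[OF seg[OF s], of None] c by (simp add: poly_sphere_def)
    show "norm c \<le> escape_radius d M"
    proof (rule ccontr)
      assume "\<not> norm c \<le> escape_radius d M"
      then have c1: "escape_radius d M < norm c" by simp
      from monic_poly_escape(2)[OF P(1)[OF seg[OF s]] P(2)[OF seg[OF s]] M[OF s] d c1]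
      have "2 * norm c \<le> norm c" using fix' by simp
      then have "c = 0" by simp
      moreover have "0 \<le> M" using M[OF s, of 0] d by (auto intro: order_trans[OF norm_ge_zero])
      then have "0 \<le> real d * M" by simp
      ultimately show False using c1 unfolding escape_radius_def by simp
    qed
  qed
  have homeoF: "homeomorphic_map riemann_sphere riemann_sphere (F s)" if "s \<in> {0..1}" for s
    unfolding F_def by (rule homeo[OF seg[OF that]])
  have conjF: "F s (poly_sphere (P 0) z) = poly_sphere (P (s *\<^sub>R t)) (F s z)" if "s \<in> {0..1}" for s z
    unfolding F_def by (rule conj[OF seg[OF that]])
  have qcF: "quasiconformal_harmonic_on (F s) (- filled_julia (P 0))" if "s \<in> {0..1}" for s
    unfolding F_def by (rule qc[OF seg[OF that]])
  have fin: "F s (Some z) = Some (f s z)" if "s \<in> {0..1}" for s z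
    using sphere_homeo_finite(1)[OF homeoF[OF that] inf[OF that], of z] unfolding f_def by simp
  have "\<exists>\<omega>. \<omega> ^ (d - 1) = 1 \<and> (\<forall>z \<in> - filled_julia (P 0). f s z \<in> - filled_julia (P (s *\<^sub>R t)) \<and>
      \<phi> (s *\<^sub>R t) (f s z) = \<omega> * \<phi> 0 z)" if s: "s \<in> {0..1}" for s
  proof -
    obtain w where "w ^ (d - 1) = 1" "\<And>z. z \<in> - filled_julia (P 0) \<Longrightarrow>
        f s z \<in> - filled_julia (P (s *\<^sub>R t)) \<and> \<phi> (s *\<^sub>R t) (f s z) = w * \<phi> 0 z"
      by (rule harmonic_conjugacy_rotation[OF d P(1)[OF zero] P(1)[OF seg[OF s]] \<phi>[OF zero] \<phi>[OF seg[OF s]]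
            homeoF[OF s] inf[OF s] conjF[OF s] f_def qcF[OF s]]) (rule that)
    then show ?thesis by blast
  qed
  then obtain \<omega> where \<omega>: "\<And>s. s \<in> {0..1} \<Longrightarrow> \<omega> s ^ (d - 1) = 1"
    and rot: "\<And>s z. s \<in> {0..1} \<Longrightarrow> z \<in> - filled_julia (P 0) \<Longrightarrow> f s z \<in> - filled_julia (P (s *\<^sub>R t))"
      "\<And>s z. s \<in> {0..1} \<Longrightarrow> z \<in> - filled_julia (P 0) \<Longrightarrow> \<phi> (s *\<^sub>R t) (f s z) = \<omega> s * \<phi> 0 z"
    by metis
  have "\<omega> 1 = \<omega> 0"
  proof (rule rotation_number_constant[where Q = "\<lambda>s. P (s *\<^sub>R t)" and \<phi> = "\<lambda>s. \<phi> (s *\<^sub>R t)" and f = f, OF d])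
    show "continuous_on {0..1} (\<lambda>s. f s z)" for z
      unfolding f_def F_def
    proof (rule holomorphic_on_param_segment)
      fix s :: real assume s: "s \<in> {0..1}"
      have "\<psi> (s *\<^sub>R t) (Some z) \<noteq> None" using fin[OF s] unfolding F_def by simp
      then show "holomorphic_at_param (\<lambda>t. the (\<psi> t (Some z))) (s *\<^sub>R t)"
        using \<psi>hol[of "Some z"] seg[OF s] unfolding sphere_holomorphic_on_def by blast
    qed
    show "bounded (f s -` B)" if "s \<in> {0..1}" "bounded B" for s B
      using sphere_homeo_proper[OF homeoF[OF that(1)] inf[OF that(1)] that(2)] unfolding f_def .
  qed (use P seg M \<phi> \<omega> rot in auto)
  moreover have "\<omega> 0 = 1"
  proof -
    have "bij_betw (\<phi> 0) (- filled_julia (P 0)) (- cball 0 1)"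
      using \<phi>[OF zero] unfolding boettcher_coordinate_def by blast
    moreover have "(2::complex) \<in> - cball 0 1" by simp
    ultimately obtain z where z: "z \<in> - filled_julia (P 0)" "\<phi> 0 z = 2"
      unfolding bij_betw_def by (metis imageE)
    have "f 0 z = z" unfolding f_def F_def by (simp add: \<psi>0)
    then show ?thesis using rot(2)[of 0 z] z by simp
  qed
  ultimately have \<omega>1: "\<omega> 1 = 1" by simp
  have one: "(1::real) \<in> {0..1}" by simp
  have F1: "F 1 = \<psi> t" unfolding F_def by simp
  have "\<exists>w \<in> - filled_julia (P t). \<psi> t (Some z) = Some w \<and> \<phi> 0 z = \<phi> t w" if z: "z \<in> - filled_julia (P 0)" for z
    using fin[OF one, of z] rot(1)[OF one z] rot(2)[OF one z] \<omega>1 F1 by (intro bexI[of _ "f 1 z"]) simp_all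
  moreover have "f 1 holomorphic_on (- filled_julia (P 0))"
  proof (rule harmonic_conjugacy_holomorphic[OF d P(1)[OF zero] \<phi>[OF zero] homeoF[OF one] inf[OF one] _ f_def qcF[OF one]])
    show "f 1 (poly (P 0) z) = poly (P (1 *\<^sub>R t)) (f 1 z)" for z
      using conjF[OF one, of "Some z"] by (simp add: poly_sphere_def fin)
  qed
  then have "(\<lambda>z. the (\<psi> t (Some z))) holomorphic_on (- filled_julia (P 0))"
    unfolding f_def[abs_def] F1 .
  ultimately show "(\<forall>z \<in> - filled_julia (P 0).
              \<exists>w \<in> - filled_julia (P t). \<psi> t (Some z) = Some w \<and> \<phi> 0 z = \<phi> t w) \<and>
           (\<lambda>z. the (\<psi> t (Some z))) holomorphic_on (- filled_julia (P 0))" by blast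
qed

end
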